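(* Let $p=3$ or $p=5$, let $V$ be a vector space of dimension $3$ over $\mathbf{F}_p$, let $H$ be any subgroup of $GL(V)$ of order $p^2$, and let $K(2)^*$ denote the second Morava K-theory at the prime $p$. Then $K(2)^*(BV)$ is not a permutation module for $H$, i.e. it is not a permutation module over $K(2)^*[H]$.
   Context: Permutation modules. For a ring $R$ and a finite group $G$, an $R$-free $R[G]$-module $M$ is a permutation module if it has an $R$-basis permuted by the action of $G$. The module $K(n)^*(BV)$ (used here with $n=2$, $d=\dim V=3$). The coefficient ring is $K(n)^*=\mathbf{F}_p[v_n,v_n^{-1}]$ with $v_n$ in degree $-2(p^n-1)$. $GL(V)$ acts on the right of $V$, hence on the left of $K(n)^*(BV)$. Explicitly, identifying $V$ with the row vectors $(\mathbf{F}_p)^d$, $$K(n)^*(BV)=K(n)^*[x_1,\ldots,x_d]/(x_1^{p^n},\ldots,x_d^{p^n}),\qquad \deg x_i=2,$$ where $x_j$ is the Chern class of the 1-dimensional representation given by the $j$th coordinate. $GL(V)$ acts by graded $K(n)^*$-algebra automorphisms, and the matrix $(a_{ij})\in GL_d(\mathbf{F}_p)$ sends $x_j$ to the reduction modulo $p$ of $e\bigl(\sum_i a_{ij}\,l(x_i)\bigr)$ (with the $a_{ij}$ lifted to integers), where $l(x)=\sum_{i\ge 0} v_n^{(p^{ni}-1)/(p^n-1)}x^{p^{ni}}/p^i$ and $e$ is the compositional inverse of $l$; the resulting power series in $x_1,\dots,x_d$ has coefficients in $\mathbf{Z}_{(p)}[v_n]$, so reduction mod $p$ makes sense. *)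

theory Defs
  imports
    "HOL-Analysis.Analysis"
    "HOL-Library.Poly_Mapping"
    "HOL-Computational_Algebra.Computational_Algebra"
    "HOL-Algebra.Group"
    "Berlekamp_Zassenhaus.Finite_Field"
begin

section \<open>Permutation modules\<close>

text \<open>
  An action \<open>act\<close> of the group \<open>G\<close> on the \<open>R\<close>-module with scalar multiplication \<open>smul\<close> is
  given; it makes the \<open>R\<close>-module an \<open>R[G]\<close>-module.  The module is a permutation module iff it
  has an \<open>R\<close>-basis permuted by \<open>G\<close>.  The qualifier \<open>Modules\<close> selects the type-class based
  locale, as opposed to the one of HOL-Algebra.
\<close>

definition permutation_module ::
  "('r::comm_ring_1 \<Rightarrow> 'm::ab_group_add \<Rightarrow> 'm) \<Rightarrow> ('g, 'x) monoid_scheme \<Rightarrow> ('g \<Rightarrow> 'm \<Rightarrow> 'm) \<Rightarrow> bool"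
where
  "permutation_module smul G act \<longleftrightarrow>
     (\<exists>B. \<not> Modules.module.dependent smul B \<and> Modules.module.span smul B = UNIV \<and>
          (\<forall>g\<in>carrier G. bij_betw (act g) B B))"


section \<open>The general linear group\<close>

definition GL :: "('a::field ^ 'd ^ 'd) monoid" where
  "GL = \<lparr>carrier = {A. invertible A}, mult = (**), one = mat 1\<rparr>"

lemma group_GL: "Group.group (GL :: ('a::field ^ 'd ^ 'd) monoid)"
proof (rule groupI)
  fix x :: "'a ^ 'd ^ 'd" assume "x \<in> carrier GL"
  then obtain y where "x ** y = mat 1" "y ** x = mat 1"
    by (auto simp: GL_def invertible_def)
  thus "\<exists>y\<in>carrier GL. y \<otimes>\<^bsub>GL\<^esub> x = \<one>\<^bsub>GL\<^esub>"
    by (auto simp: GL_def invertible_def)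
next
  show "\<one>\<^bsub>GL\<^esub> \<in> carrier (GL :: ('a ^ 'd ^ 'd) monoid)"
    by (auto simp: GL_def invertible_def intro!: exI[of _ "mat 1"])
qed (auto simp: GL_def invertible_mult matrix_mul_assoc)


section \<open>Formal power series in several variables\<close>

text \<open>Monomials are exponent vectors \<open>m :: 'd \<Rightarrow>\<^sub>0 nat\<close>, the variables being indexed by \<open>'d\<close>.\<close>

lemma finite_bounded_monomials:
  "finite {m :: 'd::finite \<Rightarrow>\<^sub>0 nat. \<forall>i. Poly_Mapping.lookup m i \<le> b i}" (is "finite ?S")
proof -
  have "Poly_Mapping.lookup ` ?S \<subseteq> PiE UNIV (\<lambda>i. {..b i})" by auto
  moreover have "finite (PiE (UNIV :: 'd set) (\<lambda>i. {..b i}))" by (intro finite_PiE) auto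
  ultimately have "finite (Poly_Mapping.lookup ` ?S)" by (rule finite_subset)
  thus ?thesis by (rule finite_imageD) (auto simp: inj_on_def poly_mapping_eqI)
qed

lemma finite_monomial_splits: "finite {(a, b). a + b = (m :: 'd::finite \<Rightarrow>\<^sub>0 nat)}"
proof (rule finite_subset)
  let ?S = "{a :: 'd \<Rightarrow>\<^sub>0 nat. \<forall>i. Poly_Mapping.lookup a i \<le> Poly_Mapping.lookup m i}"
  show "{(a, b). a + b = m} \<subseteq> ?S \<times> ?S" by (auto simp: lookup_add)
  show "finite (?S \<times> ?S)" by (intro finite_cartesian_product finite_bounded_monomials)
qed

typedef ('d, 'a) mfps = "UNIV :: (('d \<Rightarrow>\<^sub>0 nat) \<Rightarrow> 'a) set"
  morphisms mcoeff Abs_mfps by simp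

setup_lifting type_definition_mfps

lemma mfps_eqI: "(\<And>m. mcoeff f m = mcoeff g m) \<Longrightarrow> f = g"
  by (metis mcoeff_inject ext)

instantiation mfps :: (finite, comm_ring_1) comm_ring_1
begin

lift_definition zero_mfps :: "('a, 'b) mfps" is "\<lambda>_. 0" .
lift_definition one_mfps :: "('a, 'b) mfps" is "\<lambda>m. if m = 0 then 1 else 0" .
lift_definition plus_mfps :: "('a, 'b) mfps \<Rightarrow> ('a, 'b) mfps \<Rightarrow> ('a, 'b) mfps"
  is "\<lambda>f g m. f m + g m" .
lift_definition minus_mfps :: "('a, 'b) mfps \<Rightarrow> ('a, 'b) mfps \<Rightarrow> ('a, 'b) mfps"
  is "\<lambda>f g m. f m - g m" .
lift_definition uminus_mfps :: "('a, 'b) mfps \<Rightarrow> ('a, 'b) mfps"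
  is "\<lambda>f m. - f m" .
lift_definition times_mfps :: "('a, 'b) mfps \<Rightarrow> ('a, 'b) mfps \<Rightarrow> ('a, 'b) mfps"
  is "\<lambda>f g m. \<Sum>(a, b) | a + b = m. f a * g b" .

instance
proof
  fix f g h :: "('a, 'b) mfps"
  show "f * g * h = f * (g * h)"
  proof transfer
    fix f g h :: "('a \<Rightarrow>\<^sub>0 nat) \<Rightarrow> 'b"
    let ?S = "\<lambda>m :: 'a \<Rightarrow>\<^sub>0 nat. {(a, b). a + b = m}"
    have fin: "\<And>m. finite (?S m)" by (rule finite_monomial_splits)
    show "(\<lambda>m. \<Sum>(u, c)\<in>?S m. (\<Sum>(a, b)\<in>?S u. f a * g b) * h c) =
          (\<lambda>m. \<Sum>(a, u)\<in>?S m. f a * (\<Sum>(b, c)\<in>?S u. g b * h c))"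
    proof
      fix m
      have "(\<Sum>(u, c)\<in>?S m. (\<Sum>(a, b)\<in>?S u. f a * g b) * h c) =
            (\<Sum>x\<in>?S m. \<Sum>y\<in>?S (fst x). f (fst y) * g (snd y) * h (snd x))"
        by (simp add: sum_distrib_right case_prod_unfold)
      also have "\<dots> = (\<Sum>z\<in>(SIGMA x:?S m. ?S (fst x)).
               f (fst (snd z)) * g (snd (snd z)) * h (snd (fst z)))"
        by (subst sum.Sigma) (use fin in \<open>simp_all add: case_prod_unfold\<close>)
      also have "\<dots> = (\<Sum>z\<in>(SIGMA x:?S m. ?S (snd x)).
               f (fst (fst z)) * (g (fst (snd z)) * h (snd (snd z))))"
        by (rule sum.reindex_bij_witness[where
              i = "\<lambda>z. ((fst (fst z) + fst (snd z), snd (snd z)), (fst (fst z), fst (snd z)))" and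
              j = "\<lambda>z. ((fst (snd z), snd (snd z) + snd (fst z)), (snd (snd z), snd (fst z)))"])
           (auto simp: add_ac mult_ac)
      also have "\<dots> = (\<Sum>x\<in>?S m. \<Sum>y\<in>?S (snd x). f (fst x) * (g (fst y) * h (snd y)))"
        by (subst sum.Sigma) (use fin in \<open>simp_all add: case_prod_unfold\<close>)
      also have "\<dots> = (\<Sum>(a, u)\<in>?S m. f a * (\<Sum>(b, c)\<in>?S u. g b * h c))"
        by (simp add: sum_distrib_left case_prod_unfold)
      finally show "(\<Sum>(u, c)\<in>?S m. (\<Sum>(a, b)\<in>?S u. f a * g b) * h c) =
            (\<Sum>(a, u)\<in>?S m. f a * (\<Sum>(b, c)\<in>?S u. g b * h c))" .
    qed
  qed
  show "f * g = g * f"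
    by transfer
       (auto simp: fun_eq_iff add_ac mult_ac
          intro!: sum.reindex_bij_witness[where i = prod.swap and j = prod.swap])
  show "1 * f = f"
  proof transfer
    fix f :: "('a \<Rightarrow>\<^sub>0 nat) \<Rightarrow> 'b"
    show "(\<lambda>m. \<Sum>(a, b) | a + b = m. (if a = 0 then 1 else 0) * f b) = f"
    proof
      fix m
      have "(\<Sum>(a, b) | a + b = m. (if a = 0 then 1 else 0) * f b) = (\<Sum>(a, b)\<in>{(0 :: 'a \<Rightarrow>\<^sub>0 nat, m)}. f b)"
        by (rule sum.mono_neutral_cong_right[OF finite_monomial_splits]) (auto split: if_splits)
      thus "(\<Sum>(a, b) | a + b = m. (if a = 0 then 1 else 0) * f b) = f m" by simp
    qed
  qed
  show "(f + g) * h = f * h + g * h"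
    by transfer (auto simp: fun_eq_iff algebra_simps sum.distrib[symmetric] intro!: sum.cong)
  show "(0 :: ('a, 'b) mfps) \<noteq> 1"
    by transfer (auto simp: fun_eq_iff)
qed (transfer; auto simp: fun_eq_iff algebra_simps; fail)+

end

lift_definition mfps_var :: "'d \<Rightarrow> ('d, 'a::comm_ring_1) mfps" is
  "\<lambda>i m. if m = Poly_Mapping.single i 1 then 1 else 0" .

text \<open>
  Substitution of \<open>s\<close>, whose constant coefficient has to vanish, for the variable of \<open>f\<close>.  Then
  \<open>s ^ k\<close> does not contribute to monomials of total degree less than \<open>k\<close>.
\<close>

definition mfps_compose :: "'a::comm_ring_1 fps \<Rightarrow> ('d::finite, 'a) mfps \<Rightarrow> ('d, 'a) mfps" where
  "mfps_compose f s =
     Abs_mfps (\<lambda>m. \<Sum>k\<le>(\<Sum>i\<in>UNIV. Poly_Mapping.lookup m i). fps_nth f k * mcoeff (s ^ k) m)"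


section \<open>The logarithm and the exponential of the formal group law\<close>

text \<open>The variable of \<^typ>\<open>rat poly\<close> plays the role of \<open>v\<^sub>n\<close>.\<close>

definition morava_log :: "nat \<Rightarrow> nat \<Rightarrow> rat poly fps" where
  "morava_log p n = Abs_fps (\<lambda>k. \<Sum>i | k = p ^ (n * i).
     Polynomial.monom (1 / of_nat (p ^ i)) ((p ^ (n * i) - 1) div (p ^ n - 1)))"

definition morava_exp :: "nat \<Rightarrow> nat \<Rightarrow> rat poly fps" where
  "morava_exp p n = (THE e. fps_nth e 0 = 0 \<and> fps_compose e (morava_log p n) = fps_X)"

lemma morava_log_nth_0: "p > 1 \<Longrightarrow> fps_nth (morava_log p n) 0 = 0"
  by (simp add: morava_log_def)

lemma morava_log_nth_1:
  assumes "p > 1" "n > 0"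
  shows "fps_nth (morava_log p n) 1 = 1"
proof -
  have "p ^ (n * i) \<noteq> 1" if "i > 0" for i
    using assms that one_less_power[of p "n * i"] by simp
  hence "{i. (1::nat) = p ^ (n * i)} = {0}" by (metis (mono_tags, lifting) gr0I mult_0_right
      power_0 Collect_cong singleton_conv)
  thus ?thesis by (simp add: morava_log_def monom_0 one_pCons)
qed

lemma ex1_fps_left_inverse:
  fixes l :: "'a::comm_ring_1 fps"
  assumes l0: "fps_nth l 0 = 0" and l1: "fps_nth l 1 = 1"
  shows "\<exists>!e. fps_nth e 0 = 0 \<and> fps_compose e l = fps_X"
proof -
  have top: "fps_nth (l ^ k) k = 1" for k
    using startsby_zero_power_nth_same[OF l0, of k] l1 by simp
  define c where "c = wfrec less_than (\<lambda>c k. fps_nth fps_X k - (\<Sum>i<k. c i * fps_nth (l ^ i) k))"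
  have c: "c k = fps_nth fps_X k - (\<Sum>i<k. c i * fps_nth (l ^ i) k)" for k
    unfolding c_def by (subst wfrec) (auto simp: cut_def)
  have comp: "fps_nth (fps_compose e l) k = (\<Sum>i<k. fps_nth e i * fps_nth (l ^ i) k) + fps_nth e k"
    for e k
  proof -
    have "{0..k} = insert k {..<k}" by auto
    thus ?thesis by (simp add: fps_compose_nth top add.commute)
  qed
  show ?thesis
  proof (rule ex1I[of _ "Abs_fps c"])
    have "c 0 = 0" by (subst c) simp
    moreover have "fps_compose (Abs_fps c) l = fps_X"
      proof (rule fps_ext)
      fix k
      show "fps_nth (fps_compose (Abs_fps c) l) k = fps_nth fps_X k"
        using comp[of "Abs_fps c" k] c[of k] by simp
    qed
    ultimately show "fps_nth (Abs_fps c) 0 = 0 \<and> fps_compose (Abs_fps c) l = fps_X" by simp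
  next
    fix e assume e: "fps_nth e 0 = 0 \<and> fps_compose e l = fps_X"
    have "fps_nth e k = c k" for k
    proof (induction k rule: less_induct)
      case (less k)
      have "fps_nth e k = fps_nth fps_X k - (\<Sum>i<k. fps_nth e i * fps_nth (l ^ i) k)"
        using comp[of e k] e by (simp add: algebra_simps)
      also have "\<dots> = c k" by (subst c) (simp add: less)
      finally show ?case .
    qed
    thus "e = Abs_fps c" by (intro fps_ext) simp
  qed
qed

lemma morava_exp:
  assumes "p > 1" "n > 0"
  shows "fps_nth (morava_exp p n) 0 = 0"
    and "fps_compose (morava_exp p n) (morava_log p n) = fps_X"
  using theI'[OF ex1_fps_left_inverse[OF morava_log_nth_0 morava_log_nth_1, OF assms(1) assms]]
  unfolding morava_exp_def by blast+

lemma morava_log_compose_exp: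
  assumes "p > 1" "n > 0"
  shows "fps_compose (morava_log p n) (morava_exp p n) = fps_X"
proof -
  let ?l = "morava_log p n" and ?e = "morava_exp p n"
  note l0 = morava_log_nth_0[OF assms(1), of n] and e = morava_exp[OF assms]
  have "fps_nth (fps_compose ?e ?l) 1 = fps_nth ?e 1"
    by (simp add: fps_compose_nth morava_log_nth_1[OF assms, simplified])
  hence e1: "fps_nth ?e 1 = 1" using e by simp
  obtain d where d: "fps_nth d 0 = 0" "fps_compose d ?e = fps_X"
    using ex1_fps_left_inverse[OF e(1) e1] by blast
  have "d = fps_compose d (fps_compose ?e ?l)" by (simp add: e)
  also have "\<dots> = fps_compose (fps_compose d ?e) ?l" by (rule fps_compose_assoc[OF l0 e(1)])
  also have "\<dots> = ?l" by (simp add: d l0)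
  finally show ?thesis using d by simp
qed


section \<open>The coefficient ring\<close>

text \<open>
  Laurent polynomials over the field with \<open>p = CARD('p)\<close> elements: \<^typ>\<open>'a \<Rightarrow>\<^sub>0 'b\<close> carries
  the convolution product.
\<close>

type_synonym 'p K2 = "int \<Rightarrow>\<^sub>0 'p mod_ring"

text \<open>
  Reduction modulo \<open>p\<close> of rational numbers whose denominator is prime to \<open>p\<close>, extended
  coefficientwise to polynomials in \<open>v\<^sub>2\<close>.  It is only used on elements of the localization of
  the integers at \<open>p\<close>; elsewhere it has no meaning.
\<close>

definition rat_mod :: "rat \<Rightarrow> 'p::prime_card mod_ring" where
  "rat_mod r = of_int (fst (quotient_of r)) / of_int (snd (quotient_of r))"

definition K2_reduce :: "rat poly \<Rightarrow> 'p::prime_card K2" where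
  "K2_reduce f = (\<Sum>k\<le>Polynomial.degree f. Poly_Mapping.single (int k) (rat_mod (Polynomial.coeff f k)))"


section \<open>The ring \<open>K(2)\<^sup>*(BV)\<close>\<close>

text \<open>
  \<open>V\<close> is the space of row vectors over the prime field with coordinates indexed by \<open>'d\<close>.  The
  gradings of the coefficient ring and of this quotient ring are not recorded: the bases in
  the definition of permutation modules are not required to be homogeneous.
\<close>

definition pvar :: "'d \<Rightarrow> (('d \<Rightarrow>\<^sub>0 nat) \<Rightarrow>\<^sub>0 'a::comm_ring_1)" where
  "pvar j = Poly_Mapping.single (Poly_Mapping.single j 1) 1"

definition K2BV_rel ::
  "(('d::finite \<Rightarrow>\<^sub>0 nat) \<Rightarrow>\<^sub>0 'p::prime_card K2) \<Rightarrow> (('d \<Rightarrow>\<^sub>0 nat) \<Rightarrow>\<^sub>0 'p K2) \<Rightarrow> bool"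
where
  "K2BV_rel f g \<longleftrightarrow> (\<exists>c. f - g = (\<Sum>j\<in>UNIV. c j * pvar j ^ (CARD('p) ^ 2)))"

lemma K2BV_rel_refl [simp]: "K2BV_rel f f"
  unfolding K2BV_rel_def by (rule exI[of _ "\<lambda>_. 0"]) simp

lemma K2BV_rel_uminus: "K2BV_rel f g \<Longrightarrow> K2BV_rel (- f) (- g)"
  unfolding K2BV_rel_def
proof (elim exE)
  fix c assume "f - g = (\<Sum>j\<in>UNIV. c j * pvar j ^ (CARD('b) ^ 2))"
  hence "- f - - g = (\<Sum>j\<in>UNIV. (- c j) * pvar j ^ (CARD('b) ^ 2))"
    by (simp add: sum_negf algebra_simps)
  thus "\<exists>c. - f - - g = (\<Sum>j\<in>UNIV. c j * pvar j ^ (CARD('b) ^ 2))" by (rule exI[of _ "\<lambda>j. - c j"])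
qed

lemma K2BV_rel_add: "K2BV_rel f g \<Longrightarrow> K2BV_rel f' g' \<Longrightarrow> K2BV_rel (f + f') (g + g')"
  unfolding K2BV_rel_def
proof (elim exE)
  fix c c' assume "f - g = (\<Sum>j\<in>UNIV. c j * pvar j ^ (CARD('b) ^ 2))"
    "f' - g' = (\<Sum>j\<in>UNIV. c' j * pvar j ^ (CARD('b) ^ 2))"
  hence "f + f' - (g + g') = (\<Sum>j\<in>UNIV. (c j + c' j) * pvar j ^ (CARD('b) ^ 2))"
    by (simp add: algebra_simps sum.distrib)
  thus "\<exists>c. f + f' - (g + g') = (\<Sum>j\<in>UNIV. c j * pvar j ^ (CARD('b) ^ 2))"
    by (rule exI[of _ "\<lambda>j. c j + c' j"])
qed

lemma K2BV_rel_mult_left: "K2BV_rel f g \<Longrightarrow> K2BV_rel (h * f) (h * g)"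
  unfolding K2BV_rel_def
proof (elim exE)
  fix c assume c: "f - g = (\<Sum>j\<in>UNIV. c j * pvar j ^ (CARD('b) ^ 2))"
  have "h * f - h * g = h * (f - g)" by (simp add: algebra_simps)
  also have "\<dots> = (\<Sum>j\<in>UNIV. (h * c j) * pvar j ^ (CARD('b) ^ 2))"
    by (simp add: c sum_distrib_left mult.assoc)
  finally show "\<exists>c. h * f - h * g = (\<Sum>j\<in>UNIV. c j * pvar j ^ (CARD('b) ^ 2))"
    by (rule exI[of _ "\<lambda>j. h * c j"])
qed

lemma K2BV_rel_sym: "K2BV_rel f g \<Longrightarrow> K2BV_rel g f"
  using K2BV_rel_add[OF K2BV_rel_uminus[of f g] K2BV_rel_refl[of "f + g"]] by simp

lemma K2BV_rel_trans: "K2BV_rel f g \<Longrightarrow> K2BV_rel g h \<Longrightarrow> K2BV_rel f h"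
  using K2BV_rel_add[OF K2BV_rel_add[of f g g h] K2BV_rel_refl[of "- g"]] by simp

lemma K2BV_rel_mult:
  assumes "K2BV_rel f g" "K2BV_rel f' g'"
  shows "K2BV_rel (f * f') (g * g')"
proof (rule K2BV_rel_trans)
  show "K2BV_rel (f * f') (f * g')" by (rule K2BV_rel_mult_left) fact
  show "K2BV_rel (f * g') (g * g')" using K2BV_rel_mult_left[OF assms(1), of g'] by (simp add: mult.commute)
qed

lemma pvar_power: "pvar j ^ k = Poly_Mapping.single (Poly_Mapping.single j k) 1"
  by (induction k) (simp_all add: pvar_def mult_single single_add[symmetric])

lemma lookup_mult_0:
  fixes f g :: "('d \<Rightarrow>\<^sub>0 nat) \<Rightarrow>\<^sub>0 'a::comm_ring_1"
  shows "Poly_Mapping.lookup (f * g) 0 = Poly_Mapping.lookup f 0 * Poly_Mapping.lookup g 0"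
proof -
  have eq: "(0 = l + q) \<longleftrightarrow> l = 0 \<and> q = 0" for l q :: "'d \<Rightarrow>\<^sub>0 nat"
    by (auto simp: poly_mapping_eq_iff fun_eq_iff lookup_add)
  have "Poly_Mapping.lookup (f * g) 0 =
      (\<Sum>l. Poly_Mapping.lookup f l * (\<Sum>q. Poly_Mapping.lookup g q when q = 0 when l = 0))"
    unfolding lookup_mult eq by (intro Sum_any.cong arg_cong2[of _ _ _ _ "(*)"] refl) (auto simp: when_def)
  also have "\<dots> = (\<Sum>l. (Poly_Mapping.lookup f l * Poly_Mapping.lookup g 0) when l = 0)"
    by (rule Sum_any.cong) (simp add: when_def)
  finally show ?thesis by simp
qed

lemma K2BV_rel_one_zero: "\<not> K2BV_rel 1 0"
proof
  assume "K2BV_rel (1 :: ('d::finite \<Rightarrow>\<^sub>0 nat) \<Rightarrow>\<^sub>0 'p::prime_card K2) 0"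
  then obtain c :: "'d \<Rightarrow> ('d \<Rightarrow>\<^sub>0 nat) \<Rightarrow>\<^sub>0 'p K2"
    where c: "1 = (\<Sum>j\<in>UNIV. c j * pvar j ^ (CARD('p) ^ 2))"
    by (auto simp: K2BV_rel_def)
  have "Poly_Mapping.single j (CARD('p) ^ 2) \<noteq> 0" for j :: 'd
    by (metis lookup_single_eq lookup_zero power_not_zero zero_less_card_finite less_numeral_extra(3))
  hence "Poly_Mapping.lookup (pvar j ^ (CARD('p) ^ 2) :: ('d \<Rightarrow>\<^sub>0 nat) \<Rightarrow>\<^sub>0 'p K2) 0 = 0" for j
    by (simp add: pvar_power lookup_single when_def)
  hence "Poly_Mapping.lookup (\<Sum>j\<in>UNIV. c j * pvar j ^ (CARD('p) ^ 2)) 0 = 0"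
    by (simp add: lookup_sum lookup_mult_0)
  thus False unfolding c[symmetric] by simp
qed

quotient_type ('p, 'd) K2BV = "('d::finite \<Rightarrow>\<^sub>0 nat) \<Rightarrow>\<^sub>0 'p::prime_card K2" / K2BV_rel
  morphisms rep_K2BV K2BV_class
  by (rule equivpI) (auto intro!: reflpI sympI transpI intro: K2BV_rel_sym K2BV_rel_trans)

instantiation K2BV :: (prime_card, finite) comm_ring_1
begin

lift_definition zero_K2BV :: "('a, 'b) K2BV" is 0 .
lift_definition one_K2BV :: "('a, 'b) K2BV" is 1 .
lift_definition plus_K2BV :: "('a, 'b) K2BV \<Rightarrow> ('a, 'b) K2BV \<Rightarrow> ('a, 'b) K2BV" is "(+)"
  by (rule K2BV_rel_add)
lift_definition uminus_K2BV :: "('a, 'b) K2BV \<Rightarrow> ('a, 'b) K2BV" is uminus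
  by (rule K2BV_rel_uminus)
lift_definition minus_K2BV :: "('a, 'b) K2BV \<Rightarrow> ('a, 'b) K2BV \<Rightarrow> ('a, 'b) K2BV" is "(-)"
  unfolding diff_conv_add_uminus by (intro K2BV_rel_add K2BV_rel_uminus)
lift_definition times_K2BV :: "('a, 'b) K2BV \<Rightarrow> ('a, 'b) K2BV \<Rightarrow> ('a, 'b) K2BV" is "(*)"
  by (rule K2BV_rel_mult)

instance
proof
  show "(0 :: ('a, 'b) K2BV) \<noteq> 1"
    by transfer (metis K2BV_rel_one_zero K2BV_rel_sym)
qed (transfer; simp add: algebra_simps; fail)+

end

definition K2BV_scale :: "'p::prime_card K2 \<Rightarrow> ('p, 'd::finite) K2BV \<Rightarrow> ('p, 'd) K2BV" where
  "K2BV_scale c x = K2BV_class (Poly_Mapping.single 0 c) * x"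

definition K2BV_var :: "'d \<Rightarrow> ('p::prime_card, 'd::finite) K2BV" where
  "K2BV_var j = K2BV_class (pvar j)"

lemma module_K2BV: "Modules.module (K2BV_scale :: _ \<Rightarrow> ('p::prime_card, 'd::finite) K2BV \<Rightarrow> _)"
proof
  fix a b :: "'p K2" and x y :: "('p, 'd) K2BV"
  show "K2BV_scale a (x + y) = K2BV_scale a x + K2BV_scale a y"
    by (simp add: K2BV_scale_def algebra_simps)
  show "K2BV_scale (a + b) x = K2BV_scale a x + K2BV_scale b x"
    by (simp add: K2BV_scale_def single_add plus_K2BV.abs_eq[symmetric] distrib_right)
  show "K2BV_scale a (K2BV_scale b x) = K2BV_scale (a * b) x"
    by (simp add: K2BV_scale_def times_K2BV.abs_eq mult_single mult.assoc[symmetric])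
  show "K2BV_scale 1 x = x"
    by (simp add: K2BV_scale_def one_K2BV.abs_eq[symmetric])
qed

lemma K2BV_scale_mult_left: "K2BV_scale c (x * y) = K2BV_scale c x * y"
  by (simp add: K2BV_scale_def mult.assoc)


section \<open>The action of the general linear group\<close>

text \<open>
  The reduction modulo \<open>p\<close> of a power series with coefficients in \<open>\<rat>[v\<^sub>2]\<close>, as an
  element of the quotient ring: all other monomials lie in the ideal of relations.
\<close>

definition K2BV_of_series :: "('d::finite, rat poly) mfps \<Rightarrow> ('p::prime_card, 'd) K2BV" where
  "K2BV_of_series s = K2BV_class (\<Sum>m | \<forall>i. Poly_Mapping.lookup m i < CARD('p) ^ 2.
     Poly_Mapping.single m (K2_reduce (mcoeff s m)))"

text \<open>The image of \<open>x\<^sub>j\<close> under the matrix \<open>A\<close>.\<close>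

definition K2BV_image :: "'p::prime_card mod_ring ^ 'd ^ 'd \<Rightarrow> 'd::finite \<Rightarrow> ('p, 'd) K2BV" where
  "K2BV_image A j = K2BV_of_series (mfps_compose (morava_exp CARD('p) 2)
     (\<Sum>i\<in>UNIV. of_int (to_int_mod_ring (A $ i $ j)) * mfps_compose (morava_log CARD('p) 2) (mfps_var i)))"

definition K2BV_eval ::
  "('d::finite \<Rightarrow> ('p::prime_card, 'd) K2BV) \<Rightarrow> (('d \<Rightarrow>\<^sub>0 nat) \<Rightarrow>\<^sub>0 'p K2) \<Rightarrow> ('p, 'd) K2BV"
where
  "K2BV_eval y f = (\<Sum>m\<in>Poly_Mapping.keys f.
     K2BV_scale (Poly_Mapping.lookup f m) (\<Prod>j\<in>UNIV. y j ^ Poly_Mapping.lookup m j))"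

lemma K2BV_eval_superset:
  assumes "finite S" "Poly_Mapping.keys f \<subseteq> S"
  shows "K2BV_eval y f = (\<Sum>m\<in>S.
     K2BV_scale (Poly_Mapping.lookup f m) (\<Prod>j\<in>UNIV. y j ^ Poly_Mapping.lookup m j))"
  unfolding K2BV_eval_def
  by (rule sum.mono_neutral_left)
     (use assms Modules.module.scale_zero_left[OF module_K2BV] in \<open>auto simp: in_keys_iff\<close>)

lemma K2BV_eval_add: "K2BV_eval y (f + g) = K2BV_eval y f + K2BV_eval y g"
proof -
  let ?S = "Poly_Mapping.keys f \<union> Poly_Mapping.keys g"
  have "finite ?S" "Poly_Mapping.keys (f + g) \<subseteq> ?S" "Poly_Mapping.keys f \<subseteq> ?S"
    "Poly_Mapping.keys g \<subseteq> ?S"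
    using Poly_Mapping.keys_add[of f g] by auto
  thus ?thesis
    by (simp add: K2BV_eval_superset[of ?S] lookup_add sum.distrib
        Modules.module.scale_left_distrib[OF module_K2BV])
qed

lemma K2BV_eval_0 [simp]: "K2BV_eval y 0 = 0"
  by (simp add: K2BV_eval_def)

lemma K2BV_eval_sum: "K2BV_eval y (sum f S) = (\<Sum>x\<in>S. K2BV_eval y (f x))"
  by (induction S rule: infinite_finite_induct) (auto simp: K2BV_eval_add)

lemma K2BV_eval_single:
  "K2BV_eval y (Poly_Mapping.single m c) = K2BV_scale c (\<Prod>j\<in>UNIV. y j ^ Poly_Mapping.lookup m j)"
  by (subst K2BV_eval_superset[of "{m}"]) auto

lemma poly_mapping_sum_single:
  "f = (\<Sum>m\<in>Poly_Mapping.keys f. Poly_Mapping.single m (Poly_Mapping.lookup f m))"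
  by (rule poly_mapping_eqI)
     (auto simp: lookup_sum lookup_single when_def in_keys_iff)

lemma K2BV_scale_mult: "K2BV_scale (a * b) (x * y) = K2BV_scale a x * K2BV_scale b y"
proof -
  have "K2BV_scale (a * b) (x * y) = K2BV_scale b (K2BV_scale a (x * y))"
    by (simp add: Modules.module.scale_scale[OF module_K2BV] mult.commute)
  also have "\<dots> = K2BV_scale b (y * K2BV_scale a x)"
    by (simp add: K2BV_scale_mult_left mult.commute)
  also have "\<dots> = K2BV_scale a x * K2BV_scale b y"
    by (simp add: K2BV_scale_mult_left mult.commute)
  finally show ?thesis .
qed

lemma K2BV_eval_mult: "K2BV_eval y (f * g) = K2BV_eval y f * K2BV_eval y g"
proof -
  let ?l = Poly_Mapping.lookup
  have "f * g = (\<Sum>m\<in>Poly_Mapping.keys f. Poly_Mapping.single m (?l f m)) *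
      (\<Sum>m\<in>Poly_Mapping.keys g. Poly_Mapping.single m (?l g m))"
    by (simp add: poly_mapping_sum_single[symmetric])
  also have "\<dots> = (\<Sum>a\<in>Poly_Mapping.keys f. \<Sum>b\<in>Poly_Mapping.keys g.
      Poly_Mapping.single (a + b) (?l f a * ?l g b))"
    by (simp add: sum_product mult_single)
  also have "K2BV_eval y \<dots> = K2BV_eval y f * K2BV_eval y g"
    by (simp add: K2BV_eval_sum K2BV_eval_single lookup_add power_add prod.distrib
        K2BV_scale_mult K2BV_eval_def[of y f] K2BV_eval_def[of y g] sum_product)
  finally show ?thesis .
qed

lemma K2BV_eval_one [simp]: "K2BV_eval y 1 = 1"
  using K2BV_eval_single[of y 0 1] by (simp add: Modules.module.scale_one[OF module_K2BV])

lemma K2BV_eval_power: "K2BV_eval y (f ^ k) = K2BV_eval y f ^ k"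
  by (induction k) (simp_all add: K2BV_eval_mult)

lemma K2BV_eval_pvar [simp]: "K2BV_eval y (pvar j) = y j"
proof -
  have "(\<Prod>k\<in>UNIV. y k ^ Poly_Mapping.lookup (Poly_Mapping.single j (1::nat)) k) =
      (\<Prod>k\<in>{j}. y k ^ Poly_Mapping.lookup (Poly_Mapping.single j (1::nat)) k)"
    by (rule prod.mono_neutral_right) (auto simp: lookup_single when_def)
  thus ?thesis
    by (simp add: pvar_def K2BV_eval_single Modules.module.scale_one[OF module_K2BV])
qed

lemma K2BV_class_sum:
  fixes f :: "'i \<Rightarrow> ('d::finite \<Rightarrow>\<^sub>0 nat) \<Rightarrow>\<^sub>0 'p::prime_card K2"
  shows "K2BV_class (sum f S) = (\<Sum>x\<in>S. K2BV_class (f x))"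
proof -
  have "K2BV_class (f + g) = K2BV_class f + K2BV_class g"
    and "K2BV_class 0 = (0 :: ('p, 'd) K2BV)"
    for f g :: "('d \<Rightarrow>\<^sub>0 nat) \<Rightarrow>\<^sub>0 'p K2"
    by (simp_all add: plus_K2BV.abs_eq zero_K2BV.abs_eq)
  thus ?thesis by (induction S rule: infinite_finite_induct) simp_all
qed

lemma K2BV_class_power: "K2BV_class f ^ k = K2BV_class (f ^ k)"
  by (induction k) (simp_all add: times_K2BV.abs_eq one_K2BV.abs_eq)

lemma K2BV_var_power: "(K2BV_var j :: ('p::prime_card, 'd::finite) K2BV) ^ (CARD('p) ^ 2) = 0"
proof -
  have "K2BV_rel (pvar j ^ (CARD('p) ^ 2)) (0 :: ('d \<Rightarrow>\<^sub>0 nat) \<Rightarrow>\<^sub>0 'p K2)"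
    unfolding K2BV_rel_def
    by (rule exI[of _ "\<lambda>i. if i = j then 1 else 0"]) (simp add: if_distrib[of "\<lambda>x. x * _"] cong: if_cong)
  thus ?thesis
    by (simp add: K2BV_var_def K2BV_class_power zero_K2BV.abs_eq K2BV.abs_eq_iff)
qed

lemma CHAR_K2BV: "CHAR(('p::prime_card, 'd::finite) K2BV) = CARD('p)"
proof -
  have "of_nat CARD('p) = (0 :: 'p mod_ring)" by transfer simp
  hence "of_nat CARD('p) = (0 :: 'p K2)" by (simp flip: single_of_nat)
  hence "of_nat CARD('p) = (0 :: ('d \<Rightarrow>\<^sub>0 nat) \<Rightarrow>\<^sub>0 'p K2)" by (simp flip: single_of_nat)
  moreover have "K2BV_class (of_nat k) = (of_nat k :: ('p, 'd) K2BV)" for k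
    by (induction k) (simp_all add: plus_K2BV.abs_eq[symmetric] zero_K2BV.abs_eq one_K2BV.abs_eq)
  ultimately have "of_nat CARD('p) = (0 :: ('p, 'd) K2BV)"
    by (metis zero_K2BV.abs_eq)
  hence "CHAR(('p, 'd) K2BV) dvd CARD('p)" by (simp add: of_nat_eq_0_iff_char_dvd)
  moreover have "CHAR(('p, 'd) K2BV) \<noteq> 1" 
    using of_nat_eq_0_iff_char_dvd[of 1, where ?'a = "('p, 'd) K2BV"] by auto
  ultimately show ?thesis using prime_card[where 'a = 'p] by (auto simp: prime_nat_iff)
qed

lemma K2BV_class_single_power_eq_0:
  assumes "m \<noteq> 0"
  shows "(K2BV_class (Poly_Mapping.single m c) :: ('p::prime_card, 'd::finite) K2BV) ^ (CARD('p) ^ 2) = 0"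
proof -
  obtain j where j: "Poly_Mapping.lookup m j > 0"
    using assms by (metis gr0I lookup_zero poly_mapping_eqI)
  define m' where "m' = m - Poly_Mapping.single j 1"
  have "m = Poly_Mapping.single j 1 + m'"
    using j by (intro poly_mapping_eqI) (auto simp: m'_def lookup_add lookup_minus lookup_single when_def)
  hence "Poly_Mapping.single m c = pvar j * Poly_Mapping.single m' c"
    by (simp add: pvar_def mult_single)
  hence "K2BV_class (Poly_Mapping.single m c) =
      K2BV_var j * (K2BV_class (Poly_Mapping.single m' c) :: ('p, 'd) K2BV)"
    by (simp add: times_K2BV.abs_eq K2BV_var_def)
  thus ?thesis by (simp add: power_mult_distrib K2BV_var_power)
qed

lemma rat_mod_0 [simp]: "rat_mod 0 = 0"
  by (simp add: rat_mod_def)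

lemma K2_reduce_0 [simp]: "K2_reduce 0 = 0"
  by (simp add: K2_reduce_def)

lemma K2BV_of_series_power:
  assumes "mcoeff s 0 = 0"
  shows "(K2BV_of_series s :: ('p::prime_card, 'd::finite) K2BV) ^ (CARD('p) ^ 2) = 0"
proof -
  let ?S = "{m :: 'd \<Rightarrow>\<^sub>0 nat. \<forall>i. Poly_Mapping.lookup m i < CARD('p) ^ 2}"
  have "K2BV_class (Poly_Mapping.single m (K2_reduce (mcoeff s m))) ^ (CARD('p) ^ 2) = (0 :: ('p, 'd) K2BV)"
    for m
  proof (cases "m = 0")
    case True
    have "K2BV_class 0 = (0 :: ('p, 'd) K2BV)" by (simp add: zero_K2BV.abs_eq)
    thus ?thesis using True assms by (simp add: power_0_left)
  qed (rule K2BV_class_single_power_eq_0)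
  moreover have "(K2BV_of_series s :: ('p, 'd) K2BV) ^ (CARD('p) ^ 2) =
      (\<Sum>m\<in>?S. K2BV_class (Poly_Mapping.single m (K2_reduce (mcoeff s m))) ^ (CARD('p) ^ 2))"
    unfolding K2BV_of_series_def K2BV_class_sum
    by (rule freshmans_dream_sum') (simp_all add: CHAR_K2BV prime_card)
  ultimately show ?thesis by simp
qed

lemma K2BV_image_power: "(K2BV_image A j :: ('p::prime_card, 'd::finite) K2BV) ^ (CARD('p) ^ 2) = 0"
  unfolding K2BV_image_def
proof (rule K2BV_of_series_power)
  have "CARD('p) > 1" by (rule prime_gt_1_nat[OF prime_card])
  thus "mcoeff (mfps_compose (morava_exp CARD('p) 2) s) 0 = 0" for s :: "('d, rat poly) mfps"
    by (simp add: mfps_compose_def Abs_mfps_inverse morava_exp(1))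
qed

lemma K2BV_eval_cong:
  assumes "K2BV_rel f g"
  shows "K2BV_eval (K2BV_image A) f = K2BV_eval (K2BV_image A) (g :: ('d::finite \<Rightarrow>\<^sub>0 nat) \<Rightarrow>\<^sub>0 'p::prime_card K2)"
proof -
  obtain c :: "'d \<Rightarrow> ('d \<Rightarrow>\<^sub>0 nat) \<Rightarrow>\<^sub>0 'p K2"
    where c: "f - g = (\<Sum>j\<in>UNIV. c j * pvar j ^ (CARD('p) ^ 2))"
    using assms by (auto simp: K2BV_rel_def)
  have "f = g + (f - g)" by simp
  hence "K2BV_eval (K2BV_image A) f = K2BV_eval (K2BV_image A) g + K2BV_eval (K2BV_image A) (f - g)"
    by (metis K2BV_eval_add)
  also have "K2BV_eval (K2BV_image A) (f - g) = 0"
    unfolding c by (simp add: K2BV_eval_sum K2BV_eval_mult K2BV_eval_power K2BV_image_power)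
  finally show ?thesis by simp
qed

definition K2BV_act ::
  "'p::prime_card mod_ring ^ 'd ^ 'd \<Rightarrow> ('p, 'd::finite) K2BV \<Rightarrow> ('p, 'd) K2BV"
where
  "K2BV_act A x = K2BV_eval (K2BV_image A) (rep_K2BV x)"

lemma K2BV_act_class: "K2BV_act A (K2BV_class f) = K2BV_eval (K2BV_image A) f"
  unfolding K2BV_act_def by (rule K2BV_eval_cong) (simp add: Quotient3_rep_abs[OF Quotient3_K2BV])

text \<open>
  Every matrix acts by an algebra endomorphism; this and the images of the generators determine
  the action.
\<close>

lemma K2BV_act_algebra_hom:
  "K2BV_act A (x + y) = K2BV_act A x + K2BV_act A y"
  "K2BV_act A (x * y) = K2BV_act A x * K2BV_act A y"
  "K2BV_act A 1 = 1"
  "K2BV_act A (K2BV_scale c x) = K2BV_scale c (K2BV_act A x)"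
proof -
  obtain f g where fg: "x = K2BV_class f" "y = K2BV_class g"
    by (metis Quotient3_abs_rep[OF Quotient3_K2BV])
  show "K2BV_act A (x + y) = K2BV_act A x + K2BV_act A y"
    by (simp add: fg plus_K2BV.abs_eq K2BV_act_class K2BV_eval_add)
  show "K2BV_act A (x * y) = K2BV_act A x * K2BV_act A y"
    by (simp add: fg times_K2BV.abs_eq K2BV_act_class K2BV_eval_mult)
  show "K2BV_act A 1 = 1"
    by (simp add: one_K2BV.abs_eq K2BV_act_class)
  show "K2BV_act A (K2BV_scale c x) = K2BV_scale c (K2BV_act A x)"
    by (simp add: fg K2BV_scale_def times_K2BV.abs_eq K2BV_act_class K2BV_eval_mult K2BV_eval_single)
qed

lemma K2BV_act_var: "K2BV_act A (K2BV_var j) = K2BV_image A j"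
  by (simp add: K2BV_var_def K2BV_act_class)

end

(*
  The formal group law of height 2 becomes F(x, y) = x + y - v C(x^p, y^p) on elements with
  x^(p^2) = 0, where C(a, b) = ((a + b)^p - a^p - b^p) / p.  Hence y_i = x_i^p spans a linear
  representation, every matrix (invertible or not) acts functorially, and the action of H can be
  computed by hand.  Up to conjugation H contains b: x_3 -> x_3 +_F x_1 together with an element a
  which either sends x_2 to x_2 +_F e x_1 and x_3 to x_3 +_F x_2, or only changes x_2 to x_2 +_F x_1.

  If a basis is permuted by a and b, an element w with (a - 1)^2 w = (b - 1)^2 w = 0 has coordinates
  in arithmetic progression along the orbits, so it is killed by every invariant linear functional
  that vanishes on the invariants.  In the first case this fails for w = x_3^p + h, where
  (a - 1)^2 h = - (e x_1)^p, and for the coefficient of x_3^p.  In the second case x_1 is an invariant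
  of the form (a - 1) m + (b - 1) n, so that the coefficient of x_1 in it would have to vanish.
*)

theory Submission
  imports
    Defs
    "HOL-Algebra.Group_Action"
begin

text \<open>The nonlinear action never has to be expanded on general elements. A singular matrix
  whose columns have at most one nonzero entry acts by substituting multiples of single variables,
  and there the correction term of F disappears. Composed with a or b, a suitable substitution of
  this kind only changes its entries, so invariance becomes a condition on the coefficients of an
  ordinary polynomial.

  What has to be computed is h. Its source is a square: the second difference of k x_1^(p-2) x_2^2
  under x_2 -> x_2 + x_1 is 2 k x_1^p, and k is chosen with 2 k = -1 modulo p. Replacing + by +_F
  adds an error of first order in v, which further terms of h absorb; these are explicit for p = 3
  and for p = 5. The same h is needed in the second case: x_1 = (a - 1) x_2 holds up to a multiple
  of v, correcting this with x_3 leaves an error of order v^2, and h exhibits that error as a value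
  of a - 1.\<close>

section \<open>Linear functionals on permutation modules\<close>

text \<open>Bezout writes a multiple of \<open>d\<close> as one more than a multiple of
  \<open>p\<close>. Consequently a point that \<open>a\<close> moves has an orbit of exactly
  \<open>p\<close> elements.\<close>

lemma funpow_prime_period_fixed:
  fixes a :: "'b \<Rightarrow> 'b"
  assumes "prime p" "(a ^^ p) x = x" "(a ^^ d) x = x" "0 < d" "d < p"
  shows "a x = x"
proof -
  have mult: "(a ^^ (k * n)) x = x" if "(a ^^ k) x = x" for k n
    by (induction n) (simp_all add: that funpow_add)
  have "coprime d p"
    using assms by (metis coprime_commute nat_dvd_not_less prime_imp_coprime)
  then obtain m n where "d * m = p * n + 1"
    using bezout_nat[of d p] assms(4) by auto
  hence "(a ^^ (p * n + 1)) x = x" using mult[OF assms(3), of m] by simp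
  thus ?thesis using mult[OF assms(2), of n] by (simp add: funpow_add funpow_swap1)
qed

text \<open>Orbits are split off one at a time. Each has exactly \<open>p\<close> elements, so its
  contribution to the sum is the orbit sum assumed to vanish.\<close>

lemma sum_zero_free_orbits:
  fixes g :: "'b \<Rightarrow> 'c::comm_monoid_add"
  assumes p: "prime p" and "finite S"
    and "\<And>x. x \<in> S \<Longrightarrow> a x \<in> S \<and> (a ^^ p) x = x \<and> a x \<noteq> x"
    and "\<And>x. x \<in> S \<Longrightarrow> (\<Sum>i<p. g ((a ^^ i) x)) = 0"
  shows "sum g S = 0"
  using assms(2-)
proof (induction S rule: finite_psubset_induct)
  case (psubset S)
  show ?case
  proof (cases "S = {}")
    case False
    then obtain x where x: "x \<in> S" by blast
    let ?O = "(\<lambda>i. (a ^^ i) x) ` {..<p}"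
    have in_S: "(a ^^ i) y \<in> S" if "y \<in> S" for i y
      by (induction i) (use psubset.prems that in auto)
    \<comment> \<open>Periodicity supplies an inverse of \<open>a\<close> on \<open>S\<close>; with
      it the complement of an orbit is again stable under \<open>a\<close>.\<close>
    have inv: "(a ^^ (p - 1)) (a y) = y" if "y \<in> S" for y
      using psubset.prems(1)[OF that] prime_gt_0_nat[OF p]
      by (metis Suc_diff_1 comp_apply funpow_Suc_right)
    have inj: "inj_on (\<lambda>i. (a ^^ i) x) {..<p}"
    proof (rule linorder_inj_onI)
      fix i j assume ij: "i < j" "i \<in> {..<p}" "j \<in> {..<p}"
      have "(a ^^ (j - i)) ((a ^^ i) x) = (a ^^ j) x"
        using ij by (simp flip: funpow_add[THEN fun_cong, unfolded comp_apply])
      moreover have "(a ^^ i) x \<in> S" by (rule in_S[OF x])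
      ultimately show "(a ^^ i) x \<noteq> (a ^^ j) x"
        using funpow_prime_period_fixed[OF p, of a "(a ^^ i) x" "j - i"] psubset.prems(1) ij by force
    qed auto
    have closed: "a y \<in> ?O" if y: "y \<in> ?O" for y
    proof -
      obtain i where i: "i < p" "y = (a ^^ i) x" using y by auto
      show ?thesis
      proof (cases "Suc i < p")
        case True
        thus ?thesis using i by (auto intro!: image_eqI[of _ _ "Suc i"])
      next
        case False
        hence "a y = (a ^^ p) x" using i by (metis Suc_lessI comp_apply funpow.simps(2))
        hence "a y = (a ^^ 0) x" using psubset.prems(1)[OF x] by simp
        thus ?thesis using i by (auto intro!: image_eqI[of _ _ 0])
      qed
    qed
    have closed': "(a ^^ k) y \<in> ?O" if "y \<in> ?O" for y k
      by (induction k) (use that closed in auto)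
    have sub: "?O \<subseteq> S" using in_S[OF x] by auto
    have "x \<in> ?O" using prime_gt_0_nat[OF p] by (auto intro!: image_eqI[of _ _ 0])
    hence "sum g (S - ?O) = 0"
      using psubset.prems closed' inv x by (intro psubset.IH) fastforce+
    moreover have "sum g ?O = 0"
      using psubset.prems(2)[OF x] by (simp add: sum.reindex[OF inj])
    ultimately show ?thesis using sum.subset_diff[OF sub psubset.hyps, of g] by simp
  qed simp
qed

context Modules.module
begin

text \<open>A linear map that permutes the basis relabels coordinates. This turns relations such as
  \<open>f w = w\<close> or \<open>f (f w) - f w = f w - w\<close> into relations between the
  coordinates of \<open>w\<close> along an orbit of basis elements.\<close>

lemma representation_permuted:
  assumes B: "independent B" "span B = UNIV"
    and f: "\<And>x y. f (x + y) = f x + f y" "\<And>c x. f (scale c x) = scale c (f x)"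
    and bij: "bij_betw f B B" and x: "x \<in> B"
  shows "representation B (f m) (f x) = representation B m x"
proof -
  have f0: "f 0 = 0" using f(2)[of 0 0] by simp
  have "\<forall>x\<in>B. representation B (f m) (f x) = representation B m x"
  proof (rule span_induct_alt[of m B])
    show "m \<in> span B" using B by simp
  next
    show "\<forall>x\<in>B. representation B (f 0) (f x) = representation B 0 x"
      by (simp add: f0 representation_zero)
  next
    fix c b y assume b: "b \<in> B" and IH: "\<forall>x\<in>B. representation B (f y) (f x) = representation B y x"
    have "f b \<in> B" using b bij by (auto simp: bij_betw_def)
    moreover have "f x = f b \<longleftrightarrow> x = b" if "x \<in> B" for x
      using b that bij by (auto simp: bij_betw_def inj_on_def)
    ultimately show "\<forall>x\<in>B. representation B (f (scale c b + y)) (f x) = representation B (scale c b + y) x"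
      using IH b B by (simp add: f representation_add representation_scale representation_basis)
  qed
  thus ?thesis using x by blast
qed

text \<open>The basis splits into orbits of \<open>a\<close> that are not singletons, orbits of \<open>b\<close> on the
  fixed points of \<open>a\<close> that are not singletons, and common fixed points.\<close>

lemma functional_zero_orbitwise:
  fixes \<theta> :: "'b \<Rightarrow> 'a"
  assumes B: "independent B" "span B = UNIV" and p: "prime p"
    and bij: "bij_betw a B B" "bij_betw b B B"
    and comm: "\<And>x. a (b x) = b (a x)"
    and per: "\<And>x. (a ^^ p) x = x" "\<And>x. (b ^^ p) x = x"
    and \<theta>: "\<And>x y. \<theta> (x + y) = \<theta> x + \<theta> y" "\<And>c x. \<theta> (scale c x) = c * \<theta> x"
    and orb_a: "\<And>x. x \<in> B \<Longrightarrow> a x \<noteq> x \<Longrightarrow>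
        (\<Sum>i<p. representation B w ((a ^^ i) x) * \<theta> ((a ^^ i) x)) = 0"
    and orb_b: "\<And>x. x \<in> B \<Longrightarrow> b x \<noteq> x \<Longrightarrow>
        (\<Sum>i<p. representation B w ((b ^^ i) x) * \<theta> ((b ^^ i) x)) = 0"
    and fixed: "\<And>x. x \<in> B \<Longrightarrow> a x = x \<Longrightarrow> b x = x \<Longrightarrow> representation B w x * \<theta> x = 0"
  shows "\<theta> w = 0"
proof -
  define g where "g x = representation B w x * \<theta> x" for x
  define T where "T = {x. representation B w x \<noteq> 0}"
  \<comment> \<open>The support \<open>T\<close> of \<open>w\<close> need not be stable under
    \<open>a\<close> and \<open>b\<close>. Its closure under both is still finite, and it is a union
    of orbits.\<close>
  define S where "S = (\<Union>i<p. \<Union>j<p. (\<lambda>x. (a ^^ i) ((b ^^ j) x)) ` T)"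
  have p0: "p > 0" using p by (rule prime_gt_0_nat)
  have aB: "a x \<in> B" if "x \<in> B" for x using bij that by (auto simp: bij_betw_def)
  have bB: "b x \<in> B" if "x \<in> B" for x using bij that by (auto simp: bij_betw_def)
  have "(a ^^ i) x \<in> B" "(b ^^ i) x \<in> B" if "x \<in> B" for x i
    by (induction i; use that aB bB in simp)+
  hence SB: "S \<subseteq> B" using representation_ne_zero[of B w] by (auto simp: S_def T_def)
  have finT: "finite T" unfolding T_def by (rule finite_representation)
  hence fin: "finite S" unfolding S_def by auto
  have step: "\<exists>j<p. (f ^^ Suc i) = (f ^^ j)" if "i < p" "\<And>x. (f ^^ p) x = x" for i and f :: "'b \<Rightarrow> 'b"
  proof (cases "Suc i < p")
    case False
    hence "(f ^^ Suc i) = (f ^^ 0)" using that by (metis Suc_lessI ext funpow_0)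
    thus ?thesis using p0 by blast
  qed blast
  have comm': "b ((a ^^ i) x) = (a ^^ i) (b x)" for i x
    by (induction i) (simp_all add: comm[symmetric])
  have aS: "a x \<in> S" if xS: "x \<in> S" for x
  proof -
    obtain i j t where x: "i < p" "j < p" "t \<in> T" "x = (a ^^ i) ((b ^^ j) t)"
      using xS unfolding S_def by blast
    obtain k where "k < p" "(a ^^ Suc i) = (a ^^ k)" using step[OF x(1) per(1)] by blast
    hence "a x = (a ^^ k) ((b ^^ j) t)" using x by (metis comp_apply funpow.simps(2))
    thus ?thesis using x \<open>k < p\<close> unfolding S_def by blast
  qed
  have bS: "b x \<in> S" if xS: "x \<in> S" for x
  proof -
    obtain i j t where x: "i < p" "j < p" "t \<in> T" "x = (a ^^ i) ((b ^^ j) t)"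
      using xS unfolding S_def by blast
    obtain k where "k < p" "(b ^^ Suc j) = (b ^^ k)" using step[OF x(2) per(2)] by blast
    hence "b x = (a ^^ i) ((b ^^ k) t)" using x comm' by (metis comp_apply funpow.simps(2))
    thus ?thesis using x \<open>k < p\<close> unfolding S_def by blast
  qed
  \<comment> \<open>Hence the points moved by \<open>a\<close> are mapped to points moved by
    \<open>a\<close>.\<close>
  have a_inj: "a x = x" if "a (a x) = a x" for x
  proof -
    have "(a ^^ (p - 1)) (a y) = y" for y
      using per(1)[of y] p0 by (metis Suc_diff_1 comp_apply funpow_Suc_right)
    thus ?thesis using that by metis
  qed
  have b_inj: "x = y" if "b x = b y" for x y
  proof -
    have "(b ^^ (p - 1)) (b y) = y" for y
      using per(2)[of y] p0 by (metis Suc_diff_1 comp_apply funpow_Suc_right)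
    thus ?thesis using that by metis
  qed
  have "T \<subseteq> S"
  proof
    fix x assume "x \<in> T"
    hence "(a ^^ 0) ((b ^^ 0) x) \<in> S" using p0 unfolding S_def by blast
    thus "x \<in> S" by simp
  qed
  have \<theta>0: "\<theta> 0 = 0" using \<theta>(2)[of 0 0] by simp
  have \<theta>_sum: "\<theta> (sum h X) = (\<Sum>x\<in>X. \<theta> (h x))" for h :: "'b \<Rightarrow> 'b" and X
    by (induction X rule: infinite_finite_induct) (simp_all add: \<theta> \<theta>0)
  have "(\<Sum>x\<in>T. scale (representation B w x) x) = w"
    unfolding T_def using B by (simp add: sum_nonzero_representation_eq)
  hence "\<theta> w = \<theta> (\<Sum>x\<in>T. scale (representation B w x) x)" by simp
  also have "\<dots> = sum g T" by (simp add: \<theta>_sum \<theta> g_def)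
  also have "\<dots> = sum g S"
    by (rule sum.mono_neutral_left[OF fin \<open>T \<subseteq> S\<close>]) (auto simp: T_def g_def)
  also have "\<dots> = sum g {x\<in>S. a x \<noteq> x} + sum g {x\<in>S. a x = x}"
    by (subst sum.union_disjoint[symmetric]) (use fin in \<open>auto intro: arg_cong[of _ _ "sum g"]\<close>)
  also have "sum g {x\<in>S. a x \<noteq> x} = 0"
    by (rule sum_zero_free_orbits[OF p, of _ a])
      (use fin aS a_inj per SB orb_a in \<open>auto simp: g_def\<close>)
  also have "sum g {x\<in>S. a x = x} = sum g {x\<in>S. a x = x \<and> b x \<noteq> x} + sum g {x\<in>S. a x = x \<and> b x = x}"
    by (subst sum.union_disjoint[symmetric]) (use fin in \<open>auto intro: arg_cong[of _ _ "sum g"]\<close>)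
  \<comment> \<open>Commutativity is what keeps the fixed points of \<open>a\<close> stable under
    \<open>b\<close>.\<close>
  also have "sum g {x\<in>S. a x = x \<and> b x \<noteq> x} = 0"
    by (rule sum_zero_free_orbits[OF p, of _ b])
      (use fin bS b_inj per SB orb_b comm in \<open>auto simp: g_def\<close>)
  also have "sum g {x\<in>S. a x = x \<and> b x = x} = 0"
    by (rule sum.neutral) (use SB fixed in \<open>auto simp: g_def\<close>)
  finally show ?thesis by simp
qed

end

text \<open>With difference d the sum is p u(0) + p ((p - 1) / 2) d. Oddness makes (p - 1) / 2 an
  integer, so both terms carry the factor \<open>p\<close>.\<close>

lemma sum_arith_progression_zero:
  fixes u :: "nat \<Rightarrow> 'c::comm_ring_1"
  assumes "\<And>i. u (Suc (Suc i)) - u (Suc i) = u (Suc i) - u i" "odd p" "of_nat p = (0 :: 'c)"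
  shows "(\<Sum>i<p. u i) = 0"
proof -
  have u: "u i = u 0 + of_nat i * (u 1 - u 0)" for i
  proof (induction i rule: induct_nat_012)
    case (ge2 n)
    have "u (Suc (Suc n)) = 2 * u (Suc n) - u n" using assms(1)[of n] by (simp add: algebra_simps)
    thus ?case using ge2 by (simp add: algebra_simps)
  qed simp_all
  obtain k where k: "p = 2 * k + 1" using assms(2) by (elim oddE)
  have "(\<Sum>i<Suc m. i) * 2 = m * Suc m" for m :: nat
    by (induction m) simp_all
  from this[of "2 * k"] have "(\<Sum>i<p. i) * 2 = 2 * (k * p)"
    by (simp only: k Suc_eq_plus1 mult.assoc)
  hence "(\<Sum>i<p. i) = k * p" by linarith
  moreover have "(\<Sum>i<p. of_nat i :: 'c) = of_nat (\<Sum>i<p. i)" by simp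
  ultimately have "(\<Sum>i<p. of_nat i :: 'c) = of_nat k * of_nat p"
    by (simp only: of_nat_mult)
  moreover have "(\<Sum>i<p. u i) = (\<Sum>i<p. u 0 + of_nat i * (u 1 - u 0))"
    using u by (intro sum.cong refl) blast
  ultimately show ?thesis using assms(3) by (simp add: sum.distrib flip: sum_distrib_right)
qed

context Modules.module
begin

text \<open>Along an orbit that is not a singleton the coordinates of \<open>w\<close> form an arithmetic
  progression of length \<open>p\<close>, and \<open>\<theta>\<close> is constant.\<close>

lemma invariant_functional_zero:
  fixes \<theta> :: "'b \<Rightarrow> 'a"
  assumes B: "independent B" "span B = UNIV" and p: "prime p" "odd p" "of_nat p = (0 :: 'a)"
    and a: "\<And>x y. a (x + y) = a x + a y" "\<And>c x. a (scale c x) = scale c (a x)"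
    and b: "\<And>x y. b (x + y) = b x + b y" "\<And>c x. b (scale c x) = scale c (b x)"
    and bij: "bij_betw a B B" "bij_betw b B B"
    and comm: "\<And>x. a (b x) = b (a x)"
    and per: "\<And>x. (a ^^ p) x = x" "\<And>x. (b ^^ p) x = x"
    and \<theta>: "\<And>x y. \<theta> (x + y) = \<theta> x + \<theta> y" "\<And>c x. \<theta> (scale c x) = c * \<theta> x"
    and inv: "\<And>x. \<theta> (a x) = \<theta> x" "\<And>x. \<theta> (b x) = \<theta> x"
    and fixed: "\<And>x. a x = x \<Longrightarrow> b x = x \<Longrightarrow> \<theta> x = 0"
    and w: "a (a w) - a w = a w - w" "b (b w) - b w = b w - w"
  shows "\<theta> w = 0"
proof -
  have orb: "(\<Sum>i<p. representation B w ((f ^^ i) x) * \<theta> ((f ^^ i) x)) = 0"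
    if f: "\<And>x y. f (x + y) = f x + f y" "\<And>c x. f (scale c x) = scale c (f x)" "bij_betw f B B"
      and inv: "\<And>x. \<theta> (f x) = \<theta> x" and w: "f (f w) - f w = f w - w" and x: "x \<in> B" for f x
  proof -
    have fB: "(f ^^ i) x \<in> B" for i
      by (induction i) (use f(3) x in \<open>auto simp: bij_betw_def\<close>)
    have "representation B w ((f ^^ Suc (Suc i)) x) - representation B w ((f ^^ Suc i) x) =
        representation B w ((f ^^ Suc i) x) - representation B w ((f ^^ i) x)" for i
    proof -
      have rep: "representation B (f m) (f y) = representation B m y" if "y \<in> B" for m y
        using representation_permuted[OF B f that] .
      have "f y \<in> B" if "y \<in> B" for y using f(3) that by (auto simp: bij_betw_def)
      \<comment> \<open>All three coordinates are transported to the same basis element, two steps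
        ahead, where the relation satisfied by \<open>w\<close> can be read off.\<close>
      hence "representation B w ((f ^^ i) x) = representation B (f (f w)) ((f ^^ Suc (Suc i)) x)"
        "representation B w ((f ^^ Suc i) x) = representation B (f w) ((f ^^ Suc (Suc i)) x)"
        using rep fB[of i] fB[of "Suc i"] by simp_all
      moreover have "f (f w) = f w + f w - w" using w by (simp add: algebra_simps)
      moreover have "representation B (f w + f w - w) y = 
          representation B (f w) y + representation B (f w) y - representation B w y" for y
        using B by (simp add: representation_diff representation_add)
      ultimately show ?thesis by (simp add: algebra_simps)
    qed
    hence "(\<Sum>i<p. representation B w ((f ^^ i) x)) = 0"
      using p by (intro sum_arith_progression_zero) auto
    moreover have "\<theta> ((f ^^ i) x) = \<theta> x" for i by (induction i) (simp_all add: inv)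
    ultimately show ?thesis by (simp flip: sum_distrib_right)
  qed
  show ?thesis
    by (rule functional_zero_orbitwise[OF B p(1) bij comm per \<theta>])
      (use orb[OF a bij(1) inv(1) w(1)] orb[OF b bij(2) inv(2) w(2)] fixed in auto)
qed

text \<open>Compared with \<open>invariant_functional_zero\<close> the roles are exchanged: an
  invariant \<open>w\<close> has constant coordinates along every orbit, and it is the functional
  whose orbit sums vanish. At a basis element fixed by \<open>a\<close> and \<open>b\<close>, both a
  m - m and b n - n have coordinate zero, hence so has \<open>w\<close>.\<close>

lemma trace_functional_zero:
  fixes \<theta> :: "'b \<Rightarrow> 'a"
  assumes B: "independent B" "span B = UNIV" and p: "prime p"
    and a: "\<And>x y. a (x + y) = a x + a y" "\<And>c x. a (scale c x) = scale c (a x)"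
    and b: "\<And>x y. b (x + y) = b x + b y" "\<And>c x. b (scale c x) = scale c (b x)"
    and bij: "bij_betw a B B" "bij_betw b B B"
    and comm: "\<And>x. a (b x) = b (a x)"
    and per: "\<And>x. (a ^^ p) x = x" "\<And>x. (b ^^ p) x = x"
    and \<theta>: "\<And>x y. \<theta> (x + y) = \<theta> x + \<theta> y" "\<And>c x. \<theta> (scale c x) = c * \<theta> x"
    and trace: "\<And>x. (\<Sum>i<p. \<theta> ((a ^^ i) x)) = 0" "\<And>x. (\<Sum>i<p. \<theta> ((b ^^ i) x)) = 0"
    and w: "a w = w" "b w = w" "w = (a m - m) + (b n - n)"
  shows "\<theta> w = 0"
proof -
  have orb: "(\<Sum>i<p. representation B w ((f ^^ i) x) * \<theta> ((f ^^ i) x)) = 0"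
    if f: "\<And>x y. f (x + y) = f x + f y" "\<And>c x. f (scale c x) = scale c (f x)" "bij_betw f B B"
      and trace: "\<And>x. (\<Sum>i<p. \<theta> ((f ^^ i) x)) = 0" and w: "f w = w" and x: "x \<in> B" for f x
  proof -
    have fB: "(f ^^ i) x \<in> B" for i
      by (induction i) (use f(3) x in \<open>auto simp: bij_betw_def\<close>)
    have "representation B w ((f ^^ i) x) = representation B w x" for i
    proof (induction i)
      case (Suc i)
      thus ?case using representation_permuted[OF B f fB[of i], of w] w by simp
    qed simp
    thus ?thesis using trace[of x] by (simp flip: sum_distrib_left)
  qed
  have "representation B w x = 0" if x: "x \<in> B" "a x = x" "b x = x" for x
    using representation_permuted[OF B a bij(1) x(1), of m]
      representation_permuted[OF B b bij(2) x(1), of n] x B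
    by (subst w(3)) (simp add: representation_add representation_diff)
  thus ?thesis
    using orb[OF a bij(1) trace(1) w(1)] orb[OF b bij(2) trace(2) w(2)]
    by (intro functional_zero_orbitwise[OF B p(1) bij comm per \<theta>]) auto
qed

end

section \<open>The formal group law on nilpotent elements\<close>

text \<open>With C the cocycle for p = 3, \<open>w\<close> is C(y2, x1^3) and \<open>w'\<close> is
  C(y2, x1^3) + C(y2 + x1^3, x1^3), so the first arguments of \<open>h\<close> are one and two
  formal translations of \<open>x2\<close> by \<open>x1\<close>. The variable \<open>y2\<close>
  stands for the cube of \<open>x2\<close> but is kept independent, which lowers the degrees. Giving
  \<open>x1\<close>, \<open>x2\<close> weight 1, \<open>y2\<close> weight p and \<open>\<nu>\<close>
  weight 1 - p^2 makes \<open>h\<close> homogeneous of weight p, which limits the possible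
  correction terms.\<close>

lemma second_difference_3:
  fixes x1 x2 y2 \<nu> :: "'a::comm_ring_1"
  assumes char: "(3 :: 'a) = 0" and x1: "x1 ^ 9 = 0" and y2: "y2 ^ 3 = 0"
  defines "w \<equiv> (y2 * (x1 ^ 3) ^ 2 + y2 ^ 2 * (x1 ^ 3))"
  defines "w' \<equiv> w + ((y2 + x1 ^ 3) * (x1 ^ 3) ^ 2 + (y2 + x1 ^ 3) ^ 2 * (x1 ^ 3))"
  defines "h \<equiv> \<lambda>x y. x1 * x ^ 2 + \<nu> * (2 * x1 ^ 3 * x ^ 2 * y ^ 2)"
  shows "h (x2 + 2 * x1 - \<nu> * w') (y2 + 2 * x1 ^ 3) - 2 * h (x2 + x1 - \<nu> * w) (y2 + x1 ^ 3) +
      h x2 y2 = - (x1 ^ 3)"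
proof -
  \<comment> \<open>The displayed cofactors of \<open>x1 ^ 9\<close>, \<open>y2 ^ 3\<close> and
    \<open>3\<close> certify that the product lies in an ideal that is zero here. The other
    certificates are of the same kind.\<close>
  have w0: "x1 * w ^ 2 = 0"
  proof -
    have "x1 * w ^ 2 = x1 ^ 9 * (2 * x1 * y2 ^ 3 + x1 ^ 4 * y2 ^ 2) + y2 ^ 3 * (x1 ^ 7 * y2) + 3 * (0)"
      unfolding w_def by (simp add: algebra_simps eval_nat_numeral)
    thus ?thesis by (simp add: x1 y2)
  qed
  have w1: "x1 ^ 3 * w * (y2 + x1 ^ 3) ^ 2 = 0"
  proof -
    have "x1 ^ 3 * w * (y2 + x1 ^ 3) ^ 2 = x1 ^ 9 * (3 * y2 ^ 3 + 3 * x1 ^ 3 * y2 ^ 2 + x1 ^ 6 * y2) +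
        y2 ^ 3 * (x1 ^ 6 * y2) + 3 * (0)"
      unfolding w_def by (simp add: algebra_simps eval_nat_numeral)
    thus ?thesis by (simp add: x1 y2)
  qed
  \<comment> \<open>Expansion in the perturbation \<open>\<nu> * w\<close>: apart from the linear
    term coming from x1 x^2, every term contains a product that \<open>w0\<close> or
    \<open>w1\<close> kills.\<close>
  have hw: "h (x2 + x1 - \<nu> * w) (y2 + x1 ^ 3) = h (x2 + x1) (y2 + x1 ^ 3) - 2 * \<nu> * (x1 * (x2 +
      x1) * w)"
  proof -
    have "h (x2 + x1 - \<nu> * w) (y2 + x1 ^ 3) = h (x2 + x1) (y2 + x1 ^ 3) - 2 * \<nu> * (x1 * (x2 +
        x1) * w) + 1 * \<nu> ^ 2 * (x1 * w ^ 2) + (- 2) * \<nu> ^ 2 * (x1 ^ 3 * w * (y2 +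
        x1 ^ 3) ^ 2) * (2 * (x2 + x1) - \<nu> * w)"
      unfolding h_def by (simp add: algebra_simps eval_nat_numeral)
    thus ?thesis by (simp only: w0 w1 mult_zero_left mult_zero_right add_0_right)
  qed
  have w'0: "x1 * w' ^ 2 = 0"
  proof -
    have "x1 * w' ^ 2 = x1 ^ 9 * (16 * x1 * y2 ^ 3 + 24 * x1 ^ 4 * y2 ^ 2 + 16 * x1 ^ 7 * y2 +
        4 * x1 ^ 10) + y2 ^ 3 * (4 * x1 ^ 7 * y2) + 3 * (0)"
      unfolding w'_def w_def by (simp add: algebra_simps eval_nat_numeral)
    thus ?thesis by (simp add: x1 y2)
  qed
  have w'1: "x1 ^ 3 * w' * (y2 + 2 * x1 ^ 3) ^ 2 = 0"
  proof -
    have "x1 ^ 3 * w' * (y2 + 2 * x1 ^ 3) ^ 2 = x1 ^ 9 * (12 * y2 ^ 3 + 26 * x1 ^ 3 * y2 ^ 2 +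
        24 * x1 ^ 6 * y2 + 8 * x1 ^ 9) + y2 ^ 3 * (2 * x1 ^ 6 * y2) + 3 * (0)"
      unfolding w'_def w_def by (simp add: algebra_simps eval_nat_numeral)
    thus ?thesis by (simp add: x1 y2)
  qed
  have hw': "h (x2 + 2 * x1 - \<nu> * w') (y2 + 2 * x1 ^ 3) = h (x2 + 2 * x1) (y2 + 2 * x1 ^ 3) -
      2 * \<nu> * (x1 * (x2 + 2 * x1) * w')"
  proof -
    have "h (x2 + 2 * x1 - \<nu> * w') (y2 + 2 * x1 ^ 3) = h (x2 + 2 * x1) (y2 + 2 * x1 ^ 3) -
        2 * \<nu> * (x1 * (x2 + 2 * x1) * w') + 1 * \<nu> ^ 2 * (x1 * w' ^ 2) +
        (- 2) * \<nu> ^ 2 * (x1 ^ 3 * w' * (y2 + 2 * x1 ^ 3) ^ 2) * (2 * (x2 + 2 * x1) - \<nu> * w')"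
      unfolding h_def by (simp add: algebra_simps eval_nat_numeral)
    thus ?thesis by (simp only: w'0 w'1 mult_zero_left mult_zero_right add_0_right)
  qed
  \<comment> \<open>\<open>?D\<close> is the coefficient of \<open>\<nu>\<close> in the second
    difference, again with its certificate. The remaining 2 x1^3 comes from the square and is
    written as 3 x1^3 - x1^3.\<close>
  let ?D = "x1 ^ 9 * (4 * x2 ^ 2 + 20 * x1 * x2 + 20 * x1 ^ 2) + y2 ^ 3 * (0) + 3 * (4 * x1 ^ 7 * x2 * y2 +
      4 * x1 ^ 8 * y2)"
  have "(h (x2 + 2 * x1) (y2 + 2 * x1 ^ 3) - 2 * \<nu> * (x1 * (x2 + 2 * x1) * w')) -
      2 * (h (x2 + x1) (y2 + x1 ^ 3) - 2 * \<nu> * (x1 * (x2 + x1) * w)) + h x2 y2 = \<nu> * ?D +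
          3 * x1 ^ 3 - x1 ^ 3"
    unfolding h_def w'_def w_def by (simp add: algebra_simps eval_nat_numeral)
  moreover have "?D = 0" by (simp add: x1 y2 char)
  ultimately show ?thesis unfolding hw hw' by (simp add: char)
qed

text \<open>The same scheme as \<open>second_difference_3\<close>, with C the cocycle for p = 5. The
  square now yields 4 x1^5 = 5 x1^5 - x1^5, and weight 5 + 24 = 29 without \<open>\<nu>\<close>
  admits the three correction terms in \<open>h\<close>.\<close>

lemma second_difference_5:
  fixes x1 x2 y2 \<nu> :: "'a::comm_ring_1"
  assumes char: "(5 :: 'a) = 0" and x1: "x1 ^ 25 = 0" and y2: "y2 ^ 5 = 0"
  defines "w \<equiv> (y2 * (x1 ^ 5) ^ 4 + 2 * y2 ^ 2 * (x1 ^ 5) ^ 3 + 2 * y2 ^ 3 * (x1 ^ 5) ^ 2 +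
      y2 ^ 4 * (x1 ^ 5))"
  defines "w' \<equiv> w + ((y2 + x1 ^ 5) * (x1 ^ 5) ^ 4 + 2 * (y2 + x1 ^ 5) ^ 2 * (x1 ^ 5) ^ 3 + 2 * (y2 +
      x1 ^ 5) ^ 3 * (x1 ^ 5) ^ 2 + (y2 + x1 ^ 5) ^ 4 * (x1 ^ 5))"
  defines "h \<equiv> \<lambda>x y. 2 * x1 ^ 3 * x ^ 2 + \<nu> * (4 * x1 ^ 7 * x ^ 2 * y ^ 4 +
      2 * x1 ^ 11 * x ^ 3 * y ^ 3 + 3 * x1 ^ 15 * x ^ 4 * y ^ 2)"
  shows "h (x2 + 2 * x1 - \<nu> * w') (y2 + 2 * x1 ^ 5) - 2 * h (x2 + x1 - \<nu> * w) (y2 + x1 ^ 5) +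
      h x2 y2 = - (x1 ^ 5)"
proof -
  have w0: "x1 ^ 3 * w ^ 2 = 0"
  proof -
    have "x1 ^ 3 * w ^ 2 = x1 ^ 25 * (10 * x1 ^ 3 * y2 ^ 5 + 8 * x1 ^ 8 * y2 ^ 4 + 4 * x1 ^ 13 * y2 ^ 3 +
        x1 ^ 18 * y2 ^ 2) + y2 ^ 5 * (x1 ^ 13 * y2 ^ 3 + 4 * x1 ^ 18 * y2 ^ 2 + 8 * x1 ^ 23 * y2) + 5 * (0)"
      unfolding w_def by (simp add: algebra_simps eval_nat_numeral)
    thus ?thesis by (simp add: x1 y2)
  qed
  have w1: "x1 ^ 7 * w * (y2 + x1 ^ 5) ^ 4 = 0"
  proof -
    have "x1 ^ 7 * w * (y2 + x1 ^ 5) ^ 4 = x1 ^ 25 * (25 * x1 ^ 2 * y2 ^ 5 + 25 * x1 ^ 7 * y2 ^ 4 +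
        16 * x1 ^ 12 * y2 ^ 3 + 6 * x1 ^ 17 * y2 ^ 2 + x1 ^ 22 * y2) + y2 ^ 5 * (x1 ^ 12 * y2 ^ 3 +
        6 * x1 ^ 17 * y2 ^ 2 + 16 * x1 ^ 22 * y2) + 5 * (0)"
      unfolding w_def by (simp add: algebra_simps eval_nat_numeral)
    thus ?thesis by (simp add: x1 y2)
  qed
  have w2: "x1 ^ 11 * w * (y2 + x1 ^ 5) ^ 3 = 0"
  proof -
    have "x1 ^ 11 * w * (y2 + x1 ^ 5) ^ 3 = x1 ^ 25 * (11 * x1 * y2 ^ 5 + 14 * x1 ^ 6 * y2 ^ 4 +
        11 * x1 ^ 11 * y2 ^ 3 + 5 * x1 ^ 16 * y2 ^ 2 + x1 ^ 21 * y2) + y2 ^ 5 * (x1 ^ 16 * y2 ^ 2 +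
        5 * x1 ^ 21 * y2) + 5 * (0)"
      unfolding w_def by (simp add: algebra_simps eval_nat_numeral)
    thus ?thesis by (simp add: x1 y2)
  qed
  have w3: "x1 ^ 15 * w * (y2 + x1 ^ 5) ^ 2 = 0"
  proof -
    have "x1 ^ 15 * w * (y2 + x1 ^ 5) ^ 2 = x1 ^ 25 * (4 * y2 ^ 5 + 7 * x1 ^ 5 * y2 ^ 4 +
        7 * x1 ^ 10 * y2 ^ 3 + 4 * x1 ^ 15 * y2 ^ 2 + x1 ^ 20 * y2) + y2 ^ 5 * (x1 ^ 20 * y2) + 5 * (0)"
      unfolding w_def by (simp add: algebra_simps eval_nat_numeral)
    thus ?thesis by (simp add: x1 y2)
  qed
  have hw: "h (x2 + x1 - \<nu> * w) (y2 + x1 ^ 5) = h (x2 + x1) (y2 + x1 ^ 5) - 4 * \<nu> * (x1 ^ 3 * (x2 +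
      x1) * w)"
  proof -
    have "h (x2 + x1 - \<nu> * w) (y2 + x1 ^ 5) = h (x2 + x1) (y2 + x1 ^ 5) - 4 * \<nu> * (x1 ^ 3 * (x2 +
        x1) * w) + 2 * \<nu> ^ 2 * (x1 ^ 3 * w ^ 2) + (- 4) * \<nu> ^ 2 * (x1 ^ 7 * w * (y2 +
        x1 ^ 5) ^ 4) * (2 * (x2 + x1) - \<nu> * w) + (- 2) * \<nu> ^ 2 * (x1 ^ 11 * w * (y2 +
        x1 ^ 5) ^ 3) * (3 * (x2 + x1) ^ 2 - 3 * (x2 + x1) * \<nu> * w + \<nu> ^ 2 * w ^ 2) +
        (- 3) * \<nu> ^ 2 * (x1 ^ 15 * w * (y2 + x1 ^ 5) ^ 2) * (4 * (x2 + x1) ^ 3 - 6 * (x2 +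
        x1) ^ 2 * \<nu> * w + 4 * (x2 + x1) * \<nu> ^ 2 * w ^ 2 - \<nu> ^ 3 * w ^ 3)"
      unfolding h_def by (simp add: algebra_simps eval_nat_numeral)
    thus ?thesis by (simp only: w0 w1 w2 w3 mult_zero_left mult_zero_right add_0_right)
  qed
  have w'0: "x1 ^ 3 * w' ^ 2 = 0"
  proof -
    have "x1 ^ 3 * w' ^ 2 = x1 ^ 25 * (320 * x1 ^ 3 * y2 ^ 5 + 536 * x1 ^ 8 * y2 ^ 4 +
        608 * x1 ^ 13 * y2 ^ 3 + 448 * x1 ^ 18 * y2 ^ 2 + 192 * x1 ^ 23 * y2 + 36 * x1 ^ 28) +
        y2 ^ 5 * (4 * x1 ^ 13 * y2 ^ 3 + 32 * x1 ^ 18 * y2 ^ 2 + 128 * x1 ^ 23 * y2) + 5 * (0)"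
      unfolding w'_def w_def by (simp add: algebra_simps eval_nat_numeral)
    thus ?thesis by (simp add: x1 y2)
  qed
  have w'1: "x1 ^ 7 * w' * (y2 + 2 * x1 ^ 5) ^ 4 = 0"
  proof -
    have "x1 ^ 7 * w' * (y2 + 2 * x1 ^ 5) ^ 4 = x1 ^ 25 * (400 * x1 ^ 2 * y2 ^ 5 + 806 * x1 ^ 7 * y2 ^ 4 +
        1072 * x1 ^ 12 * y2 ^ 3 + 912 * x1 ^ 17 * y2 ^ 2 + 448 * x1 ^ 22 * y2 + 96 * x1 ^ 27) +
        y2 ^ 5 * (2 * x1 ^ 12 * y2 ^ 3 + 24 * x1 ^ 17 * y2 ^ 2 + 128 * x1 ^ 22 * y2) + 5 * (0)"
      unfolding w'_def w_def by (simp add: algebra_simps eval_nat_numeral)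
    thus ?thesis by (simp add: x1 y2)
  qed
  have w'2: "x1 ^ 11 * w' * (y2 + 2 * x1 ^ 5) ^ 3 = 0"
  proof -
    have "x1 ^ 11 * w' * (y2 + 2 * x1 ^ 5) ^ 3 = x1 ^ 25 * (88 * x1 * y2 ^ 5 + 224 * x1 ^ 6 * y2 ^ 4 +
        358 * x1 ^ 11 * y2 ^ 3 + 356 * x1 ^ 16 * y2 ^ 2 + 200 * x1 ^ 21 * y2 + 48 * x1 ^ 26) +
        y2 ^ 5 * (2 * x1 ^ 16 * y2 ^ 2 + 20 * x1 ^ 21 * y2) + 5 * (0)"
      unfolding w'_def w_def by (simp add: algebra_simps eval_nat_numeral)
    thus ?thesis by (simp add: x1 y2)
  qed
  have w'3: "x1 ^ 15 * w' * (y2 + 2 * x1 ^ 5) ^ 2 = 0"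
  proof -
    have "x1 ^ 15 * w' * (y2 + 2 * x1 ^ 5) ^ 2 = x1 ^ 25 * (16 * y2 ^ 5 + 56 * x1 ^ 5 * y2 ^ 4 +
        112 * x1 ^ 10 * y2 ^ 3 + 134 * x1 ^ 15 * y2 ^ 2 + 88 * x1 ^ 20 * y2 + 24 * x1 ^ 25) +
        y2 ^ 5 * (2 * x1 ^ 20 * y2) + 5 * (0)"
      unfolding w'_def w_def by (simp add: algebra_simps eval_nat_numeral)
    thus ?thesis by (simp add: x1 y2)
  qed
  have hw': "h (x2 + 2 * x1 - \<nu> * w') (y2 + 2 * x1 ^ 5) = h (x2 + 2 * x1) (y2 + 2 * x1 ^ 5) -
      4 * \<nu> * (x1 ^ 3 * (x2 + 2 * x1) * w')"
  proof -
    have "h (x2 + 2 * x1 - \<nu> * w') (y2 + 2 * x1 ^ 5) = h (x2 + 2 * x1) (y2 + 2 * x1 ^ 5) -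
        4 * \<nu> * (x1 ^ 3 * (x2 + 2 * x1) * w') + 2 * \<nu> ^ 2 * (x1 ^ 3 * w' ^ 2) +
        (- 4) * \<nu> ^ 2 * (x1 ^ 7 * w' * (y2 + 2 * x1 ^ 5) ^ 4) * (2 * (x2 + 2 * x1) - \<nu> * w') +
        (- 2) * \<nu> ^ 2 * (x1 ^ 11 * w' * (y2 + 2 * x1 ^ 5) ^ 3) * (3 * (x2 + 2 * x1) ^ 2 - 3 * (x2 +
        2 * x1) * \<nu> * w' + \<nu> ^ 2 * w' ^ 2) + (- 3) * \<nu> ^ 2 * (x1 ^ 15 * w' * (y2 +
        2 * x1 ^ 5) ^ 2) * (4 * (x2 + 2 * x1) ^ 3 - 6 * (x2 + 2 * x1) ^ 2 * \<nu> * w' + 4 * (x2 +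
        2 * x1) * \<nu> ^ 2 * w' ^ 2 - \<nu> ^ 3 * w' ^ 3)"
      unfolding h_def by (simp add: algebra_simps eval_nat_numeral)
    thus ?thesis by (simp only: w'0 w'1 w'2 w'3 mult_zero_left mult_zero_right add_0_right)
  qed
  let ?D = "x1 ^ 25 * (6 * x2 ^ 4 + 84 * x1 * x2 ^ 3 + 392 * x1 ^ 2 * x2 ^ 2 + 756 * x1 ^ 3 * x2 +
      510 * x1 ^ 4) + y2 ^ 5 * (0) + 5 * (12 * x1 ^ 13 * x2 * y2 ^ 3 + 12 * x1 ^ 14 * y2 ^ 3 +
      24 * x1 ^ 17 * x2 ^ 2 * y2 ^ 2 + 84 * x1 ^ 18 * x2 * y2 ^ 2 + 70 * x1 ^ 19 * y2 ^ 2 +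
      12 * x1 ^ 21 * x2 ^ 3 * y2 + 84 * x1 ^ 22 * x2 ^ 2 * y2 + 196 * x1 ^ 23 * x2 * y2 +
      144 * x1 ^ 24 * y2)"
  have "(h (x2 + 2 * x1) (y2 + 2 * x1 ^ 5) - 4 * \<nu> * (x1 ^ 3 * (x2 + 2 * x1) * w')) -
      2 * (h (x2 + x1) (y2 + x1 ^ 5) - 4 * \<nu> * (x1 ^ 3 * (x2 + x1) * w)) + h x2 y2 = \<nu> * ?D +
          5 * x1 ^ 5 - x1 ^ 5"
    unfolding h_def w'_def w_def by (simp add: algebra_simps eval_nat_numeral)
  moreover have "?D = 0" by (simp add: x1 y2 char)
  ultimately show ?thesis unfolding hw hw' by (simp add: char)
qed

section \<open>The cocycle of the truncated formal group law\<close>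

text \<open>The integer polynomial \<open>((a + b)\<^sup>p - a\<^sup>p - b\<^sup>p) / p\<close>, and its quotient by \<open>a\<close>.\<close>

definition fgl_cocycle :: "nat \<Rightarrow> 'a::comm_ring_1 \<Rightarrow> 'a \<Rightarrow> 'a" where
  "fgl_cocycle p a b = (\<Sum>t=1..<p. of_nat ((p choose t) div p) * a ^ t * b ^ (p - t))"

definition fgl_cocycle_quot :: "nat \<Rightarrow> 'a::comm_ring_1 \<Rightarrow> 'a \<Rightarrow> 'a" where
  "fgl_cocycle_quot p a b = (\<Sum>t=1..<p. of_nat ((p choose t) div p) * a ^ (t - 1) * b ^ (p - t))"

text \<open>The middle binomial coefficients are multiples of \<open>p\<close>, so the division in
  \<open>fgl_cocycle\<close> is exact.\<close>

lemma power_add_prime: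
  assumes "prime p"
  shows "(a + b) ^ p = a ^ p + b ^ p + of_nat p * fgl_cocycle p a (b :: 'a::comm_ring_1)"
proof -
  have p: "p > 1" using assms by (rule prime_gt_1_nat)
  have "of_nat p * (of_nat ((p choose t) div p) * a ^ t * b ^ (p - t)) =
      of_nat (p choose t) * a ^ t * b ^ (p - t)" if "t \<in> {1..<p}" for t
  proof -
    have "p dvd (p choose t)" using that assms by (intro dvd_choose_prime) auto
    hence "of_nat p * of_nat ((p choose t) div p) = (of_nat (p choose t) :: 'a)"
      by (simp flip: of_nat_mult)
    thus ?thesis by (simp add: mult.assoc[symmetric])
  qed
  hence "of_nat p * fgl_cocycle p a b = (\<Sum>t=1..<p. of_nat (p choose t) * a ^ t * b ^ (p - t))"
    unfolding fgl_cocycle_def sum_distrib_left by (rule sum.cong[OF refl])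
  moreover have "{..p} = insert 0 (insert p {1..<p})" using p by auto
  ultimately show ?thesis using p by (simp add: binomial_ring)
qed

lemma fgl_cocycle_eq_mult: "fgl_cocycle p a b = a * fgl_cocycle_quot p a b"
  unfolding fgl_cocycle_def fgl_cocycle_quot_def sum_distrib_left
proof (rule sum.cong[OF refl])
  fix t assume "t \<in> {1..<p}"
  hence "a ^ t = a * a ^ (t - 1)" by (cases t) auto
  thus "of_nat ((p choose t) div p) * a ^ t * b ^ (p - t) =
      a * (of_nat ((p choose t) div p) * a ^ (t - 1) * b ^ (p - t))"
    by (simp add: mult_ac)
qed

lemma fgl_cocycle_0_left [simp]: "fgl_cocycle p 0 b = 0"
  by (simp add: fgl_cocycle_eq_mult)

lemma fgl_cocycle_commute: "fgl_cocycle p a b = fgl_cocycle p b a"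
  unfolding fgl_cocycle_def
  by (rule sum.reindex_bij_witness[of _ "\<lambda>t. p - t" "\<lambda>t. p - t"])
    (auto simp: binomial_symmetric[symmetric] mult_ac)

lemma fgl_cocycle_0_right [simp]: "fgl_cocycle p a 0 = 0"
  by (subst fgl_cocycle_commute) simp

lemma fgl_cocycle_scale: "fgl_cocycle p (c * a) (c * b) = c ^ p * fgl_cocycle p a b"
  unfolding fgl_cocycle_def sum_distrib_left
proof (rule sum.cong[OF refl])
  fix t assume "t \<in> {1..<p}"
  hence "c ^ p = c ^ t * c ^ (p - t)" by (simp flip: power_add)
  thus "of_nat ((p choose t) div p) * (c * a) ^ t * (c * b) ^ (p - t) =
      c ^ p * (of_nat ((p choose t) div p) * a ^ t * b ^ (p - t))"
    by (simp add: power_mult_distrib mult_ac)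
qed

lemma fgl_cocycle_3: "fgl_cocycle 3 a b = a * b ^ 2 + a ^ 2 * b"
proof -
  have "{1..<3} = {1, 2 :: nat}" by auto
  moreover have "3 choose 2 = (3::nat)" by (simp add: numeral_eq_Suc)
  ultimately show ?thesis by (simp add: fgl_cocycle_def)
qed

lemma fgl_cocycle_5:
  "fgl_cocycle 5 a b = a * b ^ 4 + 2 * a ^ 2 * b ^ 3 + 2 * a ^ 3 * b ^ 2 + a ^ 4 * b"
proof -
  have "{1..<5} = {1, 2, 3, 4 :: nat}" by auto
  moreover have "5 choose 2 = (10::nat)" "5 choose 3 = (10::nat)" "5 choose 4 = (5::nat)"
    by (simp_all add: numeral_eq_Suc)
  ultimately show ?thesis by (simp add: fgl_cocycle_def)
qed

text \<open>Up to sign, p C is the coboundary of x^p, which makes C a 2-cocycle over the integers.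
  In a ring where p is zero this factor cannot be cancelled, hence the expansion for each of the two
  primes.\<close>

lemma fgl_cocycle_assoc:
  assumes "p = 3 \<or> p = 5"
  shows "fgl_cocycle p a b + fgl_cocycle p (a + b) c = fgl_cocycle p b c + fgl_cocycle p a (b + c)"
  using assms
proof
  assume "p = 3"
  show ?thesis unfolding \<open>p = 3\<close> fgl_cocycle_3 by (simp add: algebra_simps eval_nat_numeral)
next
  assume "p = 5"
  show ?thesis unfolding \<open>p = 5\<close> fgl_cocycle_5 by (simp add: algebra_simps eval_nat_numeral)
qed

lemma ring_hom_of_nat:
  fixes f :: "'a::comm_ring_1 \<Rightarrow> 'b::comm_ring_1"
  assumes "\<And>x y. f (x + y) = f x + f y" "f 1 = 1"
  shows "f (of_nat n) = of_nat n"
proof (induction n)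
  case 0
  show ?case using assms(1)[of 0 0] by simp
qed (simp add: assms)

lemma
  fixes f :: "'a::comm_ring_1 \<Rightarrow> 'b::comm_ring_1"
  assumes f: "\<And>x y. f (x + y) = f x + f y" "\<And>x y. f (x * y) = f x * f y" "f 1 = 1"
  shows ring_hom_fgl_cocycle: "f (fgl_cocycle p a b) = fgl_cocycle p (f a) (f b)"
    and ring_hom_fgl_cocycle_quot: "f (fgl_cocycle_quot p a b) = fgl_cocycle_quot p (f a) (f b)"
proof -
  have "f 0 = 0" using f(1)[of 0 0] by simp
  hence "f (sum g X) = (\<Sum>x\<in>X. f (g x))" for g :: "nat \<Rightarrow> 'a" and X
    by (induction X rule: infinite_finite_induct) (simp_all add: f)
  moreover have "f (x ^ n) = f x ^ n" for x n by (induction n) (simp_all add: f)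
  ultimately show "f (fgl_cocycle p a b) = fgl_cocycle p (f a) (f b)"
    and "f (fgl_cocycle_quot p a b) = fgl_cocycle_quot p (f a) (f b)"
    by (simp_all add: fgl_cocycle_def fgl_cocycle_quot_def f ring_hom_of_nat[of f])
qed

section \<open>The truncated formal group law in characteristic p\<close>

text \<open>Modulo \<open>p\<close> and \<open>p\<^sup>2\<close>-nd powers, only two terms of the height 2 formal group law survive.\<close>

definition fgl :: "nat \<Rightarrow> 'a::comm_ring_1 \<Rightarrow> 'a \<Rightarrow> 'a \<Rightarrow> 'a" where
  "fgl p \<nu> x y = x + y - \<nu> * fgl_cocycle p (x ^ p) (y ^ p)"

text \<open>The coefficients were found by linear algebra, so as to make the second difference along
  \<open>y \<mapsto> fgl p \<nu> y x\<close> equal to \<open>- x\<^sup>p\<close>.\<close>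

definition fgl_quadratic :: "nat \<Rightarrow> 'a::comm_ring_1 \<Rightarrow> 'a \<Rightarrow> 'a \<Rightarrow> 'a" where
  "fgl_quadratic p \<nu> x y =
     (if p = 3 then x * y ^ 2 + \<nu> * (2 * x ^ 3 * y ^ 2 * (y ^ p) ^ 2)
      else 2 * x ^ 3 * y ^ 2 + \<nu> * (4 * x ^ 7 * y ^ 2 * (y ^ p) ^ 4 +
        2 * x ^ 11 * y ^ 3 * (y ^ p) ^ 3 + 3 * x ^ 15 * y ^ 4 * (y ^ p) ^ 2))"

lemma fgl_0_left [simp]: "p > 0 \<Longrightarrow> fgl p \<nu> 0 x = x"
  and fgl_0_right [simp]: "p > 0 \<Longrightarrow> fgl p \<nu> x 0 = x"
  by (simp_all add: fgl_def power_0_left)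

lemma fgl_commute: "fgl p \<nu> x y = fgl p \<nu> y x"
  by (simp add: fgl_def add.commute fgl_cocycle_commute)

lemma ring_hom_fgl:
  fixes f :: "'a::comm_ring_1 \<Rightarrow> 'b::comm_ring_1"
  assumes f: "\<And>x y. f (x + y) = f x + f y" "\<And>x y. f (x * y) = f x * f y" "f 1 = 1"
  shows "f (fgl p \<nu> x y) = fgl p (f \<nu>) (f x) (f y)"
proof -
  have "f (x ^ n) = f x ^ n" for x n by (induction n) (simp_all add: f)
  moreover have "f (x - y) = f x - f y" for x y
    using f(1)[of "x - y" y] by (simp add: algebra_simps)
  ultimately show ?thesis by (simp add: fgl_def f ring_hom_fgl_cocycle[of f])
qed

lemma ring_hom_fgl_quadratic:
  fixes f :: "'a::comm_ring_1 \<Rightarrow> 'b::comm_ring_1"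
  assumes f: "\<And>x y. f (x + y) = f x + f y" "\<And>x y. f (x * y) = f x * f y" "f 1 = 1"
  shows "f (fgl_quadratic p \<nu> x y) = fgl_quadratic p (f \<nu>) (f x) (f y)"
proof -
  have "f (x ^ n) = f x ^ n" for x n by (induction n) (simp_all add: f)
  moreover have "f (numeral k) = numeral k" for k
    using ring_hom_of_nat[of f "numeral k"] f by simp
  ultimately show ?thesis by (simp add: fgl_quadratic_def f)
qed

locale truncated_fgl =
  fixes p :: nat and \<nu> :: "'a::comm_ring_1"
  assumes char: "CHAR('a) = p" and p35: "p = 3 \<or> p = 5"
begin

lemma prime_p: "prime p"
  using p35 by auto

lemma p_pos: "p > 0"
  using p35 by auto

lemma of_nat_p: "of_nat p = (0 :: 'a)"
  using of_nat_CHAR[where 'a = 'a] by (simp add: char)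

lemma frobenius_add: "(x + y) ^ p = x ^ p + (y ^ p :: 'a)"
  using power_add_prime[OF prime_p, of x y] by (simp add: of_nat_p)

lemma frobenius_diff: "(x - y) ^ p = x ^ p - (y ^ p :: 'a)"
  using frobenius_add[of "x - y" y] by (simp add: algebra_simps)

lemma of_int_power_p: "of_int c ^ p = (of_int c :: 'a)"
proof -
  have nat: "of_nat n ^ p = (of_nat n :: 'a)" for n
  proof (induction n)
    case 0
    show ?case using p_pos by (simp add: power_0_left)
  next
    case (Suc m)
    show ?case using frobenius_add[of 1 "of_nat m"] Suc.IH by simp
  qed
  have "(of_int c :: 'a) = of_int (c mod int p + int p * (c div int p))"
    by (simp only: mod_mult_div_eq)
  also have "\<dots> = of_int (int (nat (c mod int p))) + of_nat p * of_int (c div int p)"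
    using p_pos by (simp only: of_int_add of_int_mult of_int_of_nat_eq) simp
  finally have "(of_int c :: 'a) = of_nat (nat (c mod int p)) + of_nat p * of_int (c div int p)"
    by (simp only: of_int_of_nat_eq)
  hence "(of_int c :: 'a) = of_nat (nat (c mod int p))" by (simp add: of_nat_p)
  thus ?thesis by (simp add: nat)
qed

text \<open>Frobenius is a ring homomorphism, so it commutes with the cocycle and turns its
  arguments into p^2-nd powers of \<open>x\<close> and \<open>y\<close>, which are zero.\<close>

lemma fgl_power_p:
  assumes "x ^ p\<^sup>2 = 0" "y ^ p\<^sup>2 = 0"
  shows "fgl p \<nu> x y ^ p = x ^ p + y ^ p"
proof -
  have "fgl_cocycle p (x ^ p) (y ^ p) ^ p = fgl_cocycle p ((x ^ p) ^ p) ((y ^ p) ^ p)"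
    by (rule ring_hom_fgl_cocycle) (simp_all add: frobenius_add power_mult_distrib)
  also have "\<dots> = 0" using assms by (simp add: power2_eq_square flip: power_mult)
  finally show ?thesis by (simp add: fgl_def frobenius_add frobenius_diff power_mult_distrib)
qed

lemma fgl_nilpotent:
  assumes "x ^ p\<^sup>2 = 0" "y ^ p\<^sup>2 = 0"
  shows "fgl p \<nu> x y ^ p\<^sup>2 = 0"
proof -
  have "fgl p \<nu> x y ^ p\<^sup>2 = (x ^ p + y ^ p) ^ p"
    using fgl_power_p[OF assms] by (simp add: power2_eq_square power_mult)
  also have "\<dots> = 0"
    using assms by (simp add: frobenius_add power2_eq_square flip: power_mult)
  finally show ?thesis .
qed

lemma mult_nilpotent: "x ^ p\<^sup>2 = 0 \<Longrightarrow> (c * x) ^ p\<^sup>2 = (0 :: 'a)"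
  by (simp add: power_mult_distrib)

text \<open>Since p-th powers add, iterated formal sums only accumulate cocycle values.
  Associativity thereby reduces to the cocycle identity.\<close>

lemma fgl_fgl:
  assumes "x ^ p\<^sup>2 = 0" "y ^ p\<^sup>2 = 0"
  shows "fgl p \<nu> (fgl p \<nu> x y) z = x + y + z -
    \<nu> * (fgl_cocycle p (x ^ p) (y ^ p) + fgl_cocycle p (x ^ p + y ^ p) (z ^ p))"
  unfolding fgl_def[of _ _ "fgl p \<nu> x y" z] fgl_power_p[OF assms]
  by (simp add: fgl_def algebra_simps)

lemma fgl_assoc:
  assumes "x ^ p\<^sup>2 = 0" "y ^ p\<^sup>2 = 0" "z ^ p\<^sup>2 = 0"
  shows "fgl p \<nu> (fgl p \<nu> x y) z = fgl p \<nu> x (fgl p \<nu> y z)"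
  unfolding fgl_fgl[OF assms(1,2)] fgl_cocycle_assoc[OF p35]
  unfolding fgl_def[of _ _ x "fgl p \<nu> y z"] fgl_power_p[OF assms(2,3)]
  by (simp add: fgl_def algebra_simps)

lemma fgl_interchange:
  assumes "x ^ p\<^sup>2 = 0" "y ^ p\<^sup>2 = 0" "z ^ p\<^sup>2 = 0" "w ^ p\<^sup>2 = 0"
  shows "fgl p \<nu> (fgl p \<nu> x y) (fgl p \<nu> z w) = fgl p \<nu> (fgl p \<nu> x z) (fgl p \<nu> y w)"
proof -
  have "fgl p \<nu> (fgl p \<nu> x y) (fgl p \<nu> z w) = fgl p \<nu> x (fgl p \<nu> (fgl p \<nu> y z) w)"
    unfolding fgl_assoc[OF assms(1,2) fgl_nilpotent[OF assms(3,4)]] fgl_assoc[OF assms(2-4)] ..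
  also have "fgl p \<nu> y z = fgl p \<nu> z y" by (rule fgl_commute)
  also have "fgl p \<nu> x (fgl p \<nu> (fgl p \<nu> z y) w) = fgl p \<nu> (fgl p \<nu> x z) (fgl p \<nu> y w)"
    unfolding fgl_assoc[OF assms(1,3) fgl_nilpotent[OF assms(2,4)]] fgl_assoc[OF assms(3,2,4)] ..
  finally show ?thesis .
qed

text \<open>The cocycle is homogeneous of degree \<open>p\<close> and integers equal their p-th
  powers, so multiplication by an integer is an endomorphism of F.\<close>

lemma of_int_fgl: "of_int c * fgl p \<nu> x y = fgl p \<nu> (of_int c * x) (of_int c * y)"
  by (simp add: fgl_def power_mult_distrib fgl_cocycle_scale of_int_power_p algebra_simps)

text \<open>Both arguments of the cocycle are integer multiples of x^p, so its value is a multiple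
  of x^(p^2) = 0. In particular the k-fold formal sum of \<open>x\<close> is k x.\<close>

lemma fgl_of_int:
  assumes "x ^ p\<^sup>2 = 0"
  shows "fgl p \<nu> (of_int c * x) (of_int d * x) = of_int (c + d) * x"
proof -
  have "fgl_cocycle p ((of_int c * x) ^ p) ((of_int d * x) ^ p) =
      fgl_cocycle p (x ^ p * of_int c) (x ^ p * of_int d)"
    by (simp add: power_mult_distrib of_int_power_p mult.commute)
  also have "\<dots> = 0"
    using assms unfolding fgl_cocycle_scale
    by (simp add: power2_eq_square flip: power_mult)
  finally show ?thesis by (simp add: fgl_def algebra_simps)
qed

text \<open>The polynomial identities apply with \<open>y2\<close> the p-th power of
  \<open>y\<close>: by \<open>fgl_power_p\<close> each formal translation of \<open>y\<close> by
  \<open>x\<close> moves it by x^p.\<close>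

lemma fgl_quadratic_second_difference:
  assumes x: "x ^ p\<^sup>2 = 0" and y: "y ^ p\<^sup>2 = 0"
  shows "fgl_quadratic p \<nu> x (fgl p \<nu> (fgl p \<nu> y x) x) -
    2 * fgl_quadratic p \<nu> x (fgl p \<nu> y x) + fgl_quadratic p \<nu> x y = - (x ^ p)"
proof -
  have 1: "fgl p \<nu> y x = y + x - \<nu> * fgl_cocycle p (y ^ p) (x ^ p)" by (simp add: fgl_def)
  have 2: "fgl p \<nu> (fgl p \<nu> y x) x = y + 2 * x -
      \<nu> * (fgl_cocycle p (y ^ p) (x ^ p) + fgl_cocycle p (y ^ p + x ^ p) (x ^ p))"
    by (simp only: fgl_fgl[OF y x] mult_2 add.assoc)
  have 3: "fgl p \<nu> y x ^ p = y ^ p + x ^ p" by (rule fgl_power_p[OF y x])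
  have 4: "fgl p \<nu> (fgl p \<nu> y x) x ^ p = y ^ p + 2 * x ^ p"
    by (simp only: fgl_power_p[OF fgl_nilpotent[OF y x] x] 3 mult_2 add.assoc)
  have y': "(y ^ p) ^ p = 0" using y by (simp add: power2_eq_square flip: power_mult)
  show ?thesis
    using p35
  proof
    assume p: "p = 3"
    have "(3 :: 'a) = 0" using of_nat_p by (simp add: p)
    moreover have "x ^ 9 = 0" using x by (simp add: p)
    moreover have "(y ^ 3) ^ 3 = 0" using y' by (simp only: p)
    ultimately show ?thesis
      using second_difference_3[of x "y ^ 3" y \<nu>]
      unfolding fgl_quadratic_def 4 3 unfolding 2 unfolding 1
      by (simp only: p fgl_cocycle_3 if_True if_False numeral_eq_iff num.inject num.distinct simp_thms
          triv_forall_equality True_implies_equals)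
  next
    assume p: "p = 5"
    have "(5 :: 'a) = 0" using of_nat_p by (simp add: p)
    moreover have "x ^ 25 = 0" using x by (simp add: p)
    moreover have "(y ^ 5) ^ 5 = 0" using y' by (simp only: p)
    ultimately show ?thesis
      using second_difference_5[of x "y ^ 5" y \<nu>]
      unfolding fgl_quadratic_def 4 3 unfolding 2 unfolding 1
      by (simp only: p fgl_cocycle_5 if_True if_False numeral_eq_iff num.inject num.distinct simp_thms
          triv_forall_equality True_implies_equals)
  qed
qed

end

section \<open>Coefficients of the exponential\<close>

lemma morava_log_coeff:
  assumes "p > 1" "k < p ^ 4"
  shows "fps_nth (morava_log p 2) k =
    (if k = 1 then 1 else if k = p\<^sup>2 then Polynomial.monom (1 / of_nat p) 1 else 0)"
proof -
  have p2: "p\<^sup>2 > 1" using assms(1) by (rule one_less_power) simp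
  have pow: "i = 0 \<and> k = 1 \<or> i = 1 \<and> k = p\<^sup>2" if "k = p ^ (2 * i)" for i
  proof -
    have "2 * i < 4" using assms that by simp
    hence "i = 0 \<or> i = 1" by auto
    thus ?thesis using that by auto
  qed
  have "{i. k = p ^ (2 * i)} = {i. i = 0 \<and> k = 1 \<or> i = 1 \<and> k = p\<^sup>2}"
    by (rule Collect_cong, rule iffI, erule pow) auto
  hence "{i. k = p ^ (2 * i)} = (if k = 1 then {0} else if k = p\<^sup>2 then {1} else {})"
    using p2 by auto
  thus ?thesis using p2 by (auto simp: morava_log_def monom_0 one_pCons)
qed

lemma one_plus_power_second_order:
  "\<exists>w. (1 + z) ^ n = 1 + of_nat n * z + z\<^sup>2 * (w :: 'a::comm_ring_1)"
proof (induction n)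
  case 0
  show ?case by (rule exI[of _ 0]) simp
next
  case (Suc n)
  then obtain w where "(1 + z) ^ n = 1 + of_nat n * z + z\<^sup>2 * w" by blast
  hence "(1 + z) ^ Suc n = 1 + of_nat (Suc n) * z + z\<^sup>2 * (of_nat n + w + z * w)"
    by (simp add: algebra_simps power2_eq_square)
  thus ?case by blast
qed

text \<open>Put q = p^2 and c = v / p. In low degrees l(e(X)) = X reads e = X - c e^q. Writing e = X
  (1 + z) with z divisible by X^(q-1) gives e^q = X^q (1 + q z + O(z^2)), hence e = X - c X^q + q
  c^2 X^(2q-1) + O(X^(3q-2)), and q c^2 = v^2 is integral. The bound is exactly what is required:
  monomials in three variables with exponents below q have degree at most 3 q - 3.\<close>

lemma morava_exp_coeff:
  assumes p: "p > 1" and k: "k < 3 * p\<^sup>2 - 2"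
  shows "fps_nth (morava_exp p 2) k = (if k = 1 then 1 else if k = p\<^sup>2 then - Polynomial.monom (1 / of_nat p) 1
    else if k = 2 * p\<^sup>2 - 1 then Polynomial.monom 1 2 else 0)"
proof -
  define q where "q = p\<^sup>2"
  define c :: "rat poly" where "c = Polynomial.monom (1 / of_nat p) 1"
  define e where "e = morava_exp p 2"
  have "2 * 2 \<le> p * p" using p by (intro mult_le_mono) auto
  hence q4: "q \<ge> 4" by (simp add: q_def power2_eq_square)
  \<comment> \<open>All degrees considered stay below p^4, where the next term of the logarithm
    appears.\<close>
  have "3 * q - 2 \<le> 4 * q" by simp
  also have "\<dots> \<le> q * q" using q4 by (rule mult_le_mono1)
  also have "q * q = p ^ 4" by (simp add: q_def flip: power_add)
  finally have q3: "3 * q - 2 \<le> p ^ 4" .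
  have log_1: "fps_nth (morava_log p 2) (Suc 0) = 1"
    using morava_log_coeff[OF p, of 1] q3 q4 by simp
  have log_q: "fps_nth (morava_log p 2) q = c"
    using morava_log_coeff[OF p, of q] q3 q4 by (simp add: c_def flip: q_def)
  have e0: "fps_nth e 0 = 0" unfolding e_def using p by (intro morava_exp) auto
  have rec: "fps_nth e j = fps_nth fps_X j - c * fps_nth (e ^ q) j" if "j < p ^ 4" for j
  proof -
    have "fps_nth fps_X j = fps_nth (fps_compose (morava_log p 2) e) j"
      using morava_log_compose_exp[of p 2] p by (simp add: e_def)
    also have "\<dots> = (\<Sum>i=0..j. fps_nth (morava_log p 2) i * fps_nth (e ^ i) j)"
      by (rule fps_compose_nth)
    also have "\<dots> = (\<Sum>i\<in>{1, q}. fps_nth (morava_log p 2) i * fps_nth (e ^ i) j)"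
    proof (rule sum.mono_neutral_cong)
      show "fps_nth (morava_log p 2) i * fps_nth (e ^ i) j = 0" if "i \<in> {1, q} - {0..j}" for i
        using that startsby_zero_power_prefix[OF e0, of i] by auto
      show "fps_nth (morava_log p 2) i * fps_nth (e ^ i) j = 0" if "i \<in> {0..j} - {1, q}" for i
        using that \<open>j < p ^ 4\<close> morava_log_coeff[OF p, of i] by (auto simp: q_def)
    qed auto
    also have "\<dots> = fps_nth e j + c * fps_nth (e ^ q) j"
      using q4 by (simp add: log_1 log_q)
    finally show ?thesis by simp
  qed
  have low: "fps_nth e j = (if j = 1 then 1 else 0)" if "j < q" for j
  proof -
    have "fps_nth (e ^ q) j = 0" using startsby_zero_power_prefix[OF e0, of q] that by auto
    thus ?thesis using rec[of j] that q3 q4 by simp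
  qed
  define r where "r = fps_shift q e"
  define z where "z = fps_X ^ (q - 1) * r"
  have "fps_nth e j = fps_nth (fps_X * (1 + z)) j" for j
  proof -
    have "fps_X * (1 + z) = fps_X + fps_X ^ q * r"
      using q4 by (simp add: z_def algebra_simps power_eq_if[of _ q])
    moreover have "fps_nth (fps_X ^ q * r) j = (if j < q then 0 else fps_nth e j)"
      by (simp add: fps_X_power_mult_nth r_def)
    ultimately show ?thesis using low[of j] q4 by simp
  qed
  hence "e = fps_X * (1 + z)" by (rule fps_ext)
  hence eq: "e ^ q = fps_X ^ q * (1 + z) ^ q" by (simp add: power_mult_distrib)
  obtain w where w: "(1 + z) ^ q = 1 + of_nat q * z + z\<^sup>2 * w"
    using one_plus_power_second_order by blast
  have high: "fps_nth e j = - c * ((if j = q then 1 else 0) +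
      (if j < 2 * q - 1 then 0 else of_nat q * fps_nth e (j - q + 1)))"
    if j: "q \<le> j" "j < 3 * q - 2" for j
  proof -
    have "z\<^sup>2 * w = fps_X ^ (2 * (q - 1)) * (r\<^sup>2 * w)"
      by (simp add: z_def power_mult_distrib mult.assoc power_mult[symmetric] mult.commute[of 2])
    hence "fps_nth (z\<^sup>2 * w) (j - q) = fps_nth (fps_X ^ (2 * (q - 1)) * (r\<^sup>2 * w)) (j - q)"
      by (rule arg_cong)
    also have "\<dots> = 0" using j by (simp add: fps_X_power_mult_nth)
    finally have "fps_nth (z\<^sup>2 * w) (j - q) = 0" .
    moreover have "fps_nth z (j - q) = (if j < 2 * q - 1 then 0 else fps_nth e (j - q + 1))"
      using j q4 by (auto simp: z_def fps_X_power_mult_nth r_def intro!: arg_cong[of _ _ "fps_nth e"])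
    ultimately have "fps_nth ((1 + z) ^ q) (j - q) = (if j = q then 1 else 0) +
        of_nat q * (if j < 2 * q - 1 then 0 else fps_nth e (j - q + 1))"
      using j unfolding w by (simp add: fps_of_nat[symmetric] del: fps_of_nat)
    moreover have "fps_nth (e ^ q) j = fps_nth ((1 + z) ^ q) (j - q)"
      unfolding eq using j by (simp add: fps_X_power_mult_nth)
    ultimately show ?thesis using rec[of j] j q3 q4 by (simp split: if_splits)
  qed
  have eq_q: "fps_nth e q = - c" using high[of q] q4 by simp
  have mid: "fps_nth e j = 0" if "q < j" "j < 2 * q - 1" for j
    using high[of j] that by simp
  have "c * (of_nat q * c) = Polynomial.monom 1 2"
    using p by (simp add: c_def q_def mult_monom of_nat_monom power2_eq_square numeral_2_eq_2)
  moreover have "2 * q - 1 \<noteq> q" "2 * q - 1 - q + 1 = q" using q4 by auto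
  ultimately have top: "fps_nth e (2 * q - 1) = Polynomial.monom 1 2"
    using high[of "2 * q - 1"] q4 eq_q \<open>2 * q - 1 \<noteq> q\<close> \<open>2 * q - 1 - q + 1 = q\<close> by simp
  have above: "fps_nth e j = 0" if "2 * q - 1 < j" "j < 3 * q - 2" for j
    using high[of j] mid[of "j - q + 1"] that q4 by simp
  consider "k < q" | "k = q" | "q < k" "k < 2 * q - 1" | "k = 2 * q - 1" | "2 * q - 1 < k" "k < 3 * q - 2"
    using k unfolding q_def by linarith
  thus ?thesis
    unfolding e_def[symmetric] c_def[symmetric] q_def[symmetric]
    by cases (use low[of k] mid[of k] above[of k] eq_q top q4 in auto)
qed

section \<open>Truncation of power series\<close>

definition K2BV_const :: "'p::prime_card K2 \<Rightarrow> ('p, 'd::finite) K2BV" where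
  "K2BV_const c = K2BV_class (Poly_Mapping.single 0 c)"

definition K2BV_monom :: "('d::finite \<Rightarrow>\<^sub>0 nat) \<Rightarrow> ('p::prime_card, 'd) K2BV" where
  "K2BV_monom m = K2BV_class (Poly_Mapping.single m 1)"

lemma K2BV_scale_eq_mult: "K2BV_scale c x = K2BV_const c * x"
  by (simp add: K2BV_scale_def K2BV_const_def)

lemma K2BV_const_hom:
  "K2BV_const (a + b) = K2BV_const a + (K2BV_const b :: ('p::prime_card, 'd::finite) K2BV)"
  "K2BV_const (a * b) = K2BV_const a * (K2BV_const b :: ('p, 'd) K2BV)"
  "K2BV_const 1 = (1 :: ('p, 'd) K2BV)"
  "K2BV_const 0 = (0 :: ('p, 'd) K2BV)"
  by (simp_all add: K2BV_const_def single_add plus_K2BV.abs_eq times_K2BV.abs_eq mult_single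
      one_K2BV.abs_eq zero_K2BV.abs_eq)

lemma ring_hom_of_int:
  fixes f :: "'a::comm_ring_1 \<Rightarrow> 'b::comm_ring_1"
  assumes f: "\<And>x y. f (x + y) = f x + f y" "f 1 = 1"
  shows "f (of_int k) = of_int k"
proof -
  have "f (- x) = - f x" for x
    using f(1)[of x "- x"] f(1)[of 0 0] by (simp add: eq_neg_iff_add_eq_0 add.commute)
  thus ?thesis by (cases k rule: int_cases2) (simp_all add: ring_hom_of_nat[of f, OF f])
qed

lemma K2BV_const_of_int: "K2BV_const (of_int k) = (of_int k :: ('p::prime_card, 'd::finite) K2BV)"
  by (rule ring_hom_of_int) (simp_all add: K2BV_const_hom)

lemma K2BV_class_single:
  "K2BV_class (Poly_Mapping.single m c) = K2BV_const c * (K2BV_monom m :: ('p::prime_card, 'd::finite) K2BV)"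
  by (simp add: K2BV_const_def K2BV_monom_def times_K2BV.abs_eq mult_single)

lemma K2BV_monom_add:
  "K2BV_monom (a + b) = K2BV_monom a * (K2BV_monom b :: ('p::prime_card, 'd::finite) K2BV)"
  by (simp add: K2BV_monom_def times_K2BV.abs_eq mult_single)

lemma K2BV_monom_single: "K2BV_monom (Poly_Mapping.single j 1) = K2BV_var j"
  by (simp add: K2BV_monom_def K2BV_var_def pvar_def)

lemma K2BV_monom_0: "K2BV_monom 0 = 1"
  by (simp add: K2BV_monom_def one_K2BV.abs_eq)

lemma K2BV_monom_single_power:
  "K2BV_monom (Poly_Mapping.single j k) = (K2BV_var j :: ('p::prime_card, 'd::finite) K2BV) ^ k"
proof (induction k)
  case (Suc k)
  have "Poly_Mapping.single j (Suc k) = Poly_Mapping.single j 1 + Poly_Mapping.single j k"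
    by (simp flip: single_add)
  thus ?case using Suc by (simp only: K2BV_monom_add K2BV_monom_single power_Suc)
qed (simp add: K2BV_monom_0)

lemma K2BV_monom_sum:
  "K2BV_monom (sum h S) = (\<Prod>x\<in>S. K2BV_monom (h x) :: ('p::prime_card, 'd::finite) K2BV)"
  by (induction S rule: infinite_finite_induct) (simp_all add: K2BV_monom_0 K2BV_monom_add)

lemma K2BV_monom_eq_prod:
  "K2BV_monom m = (\<Prod>j\<in>UNIV. (K2BV_var j :: ('p::prime_card, 'd::finite) K2BV) ^ Poly_Mapping.lookup m j)"
proof -
  have "m = (\<Sum>j\<in>UNIV. Poly_Mapping.single j (Poly_Mapping.lookup m j))"
    by (rule poly_mapping_eqI) (simp add: lookup_sum lookup_single when_def)
  hence "K2BV_monom m =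
      (K2BV_monom (\<Sum>j\<in>UNIV. Poly_Mapping.single j (Poly_Mapping.lookup m j)) :: ('p, 'd) K2BV)"
    by (rule arg_cong)
  thus ?thesis by (simp only: K2BV_monom_sum K2BV_monom_single_power)
qed

lemma K2BV_monom_eq_0:
  assumes "Poly_Mapping.lookup m j \<ge> CARD('p) ^ 2"
  shows "K2BV_monom m = (0 :: ('p::prime_card, 'd::finite) K2BV)"
proof -
  define m' where "m' = m - Poly_Mapping.single j (CARD('p) ^ 2)"
  have "m = Poly_Mapping.single j (CARD('p) ^ 2) + m'"
    using assms by (intro poly_mapping_eqI) (auto simp: m'_def lookup_add lookup_minus lookup_single when_def)
  thus ?thesis by (simp add: K2BV_monom_add K2BV_monom_single_power K2BV_var_power)
qed

definition exponent_box :: "nat \<Rightarrow> ('d::finite \<Rightarrow>\<^sub>0 nat) set" where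
  "exponent_box q = {m. \<forall>i. Poly_Mapping.lookup m i < q}"

lemma finite_exponent_box: "finite (exponent_box q)"
  by (rule finite_subset[OF _ finite_bounded_monomials[of "\<lambda>_. q"]]) (auto simp: exponent_box_def less_imp_le)

lemma exponent_box_add: "a + b \<in> exponent_box q \<Longrightarrow> a \<in> exponent_box q \<and> b \<in> exponent_box q"
  by (auto simp: exponent_box_def lookup_add intro: le_less_trans[OF le_add1] le_less_trans[OF le_add2])

lemma K2BV_monom_not_exponent_box:
  "m \<notin> exponent_box (CARD('p) ^ 2) \<Longrightarrow> K2BV_monom m = (0 :: ('p::prime_card, 'd::finite) K2BV)"
  by (auto simp: exponent_box_def not_less intro: K2BV_monom_eq_0)

text \<open>This is reduction modulo p followed by evaluation at the nilpotent generators. It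
  carries identities between integral power series, where p can be cancelled, into the ring of
  characteristic p.\<close>

definition K2BV_trunc :: "('d::finite, int) mfps \<Rightarrow> ('p::prime_card, 'd) K2BV" where
  "K2BV_trunc f = (\<Sum>m\<in>exponent_box (CARD('p) ^ 2). of_int (mcoeff f m) * K2BV_monom m)"

lemma mcoeff_simps:
  "mcoeff (f + g) m = mcoeff f m + mcoeff g m"
  "mcoeff (f - g) m = mcoeff f m - mcoeff g m"
  "mcoeff 0 m = 0"
  "mcoeff 1 m = (if m = 0 then 1 else 0)"
  "mcoeff (mfps_var i) m = (if m = Poly_Mapping.single i 1 then 1 else 0)"
  by (simp_all add: plus_mfps.rep_eq minus_mfps.rep_eq zero_mfps.rep_eq
      one_mfps.rep_eq mfps_var.rep_eq)

lemma mcoeff_mult: "mcoeff (f * g) m = (\<Sum>(a, b) | a + b = m. mcoeff f a * mcoeff g b)"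
  by (simp add: times_mfps.rep_eq)

lemma mcoeff_uminus: "mcoeff (- f) m = - mcoeff f m"
  by (simp add: uminus_mfps.rep_eq)

lemma mcoeff_of_int_mult: "mcoeff (of_int k * f) m = of_int k * mcoeff f m"
proof -
  have nat: "mcoeff (of_nat n * f) m = of_nat n * mcoeff f m" for n
    by (induction n) (simp_all add: mcoeff_simps algebra_simps)
  show ?thesis
    by (cases k rule: int_cases2) (simp_all add: nat mcoeff_uminus)
qed

lemma K2BV_trunc_add: "K2BV_trunc (f + g) = K2BV_trunc f + K2BV_trunc g"
  by (simp add: K2BV_trunc_def mcoeff_simps algebra_simps sum.distrib)

lemma K2BV_trunc_monom:
  assumes "\<And>m. mcoeff f m = (if m = a then 1 else 0)" "a \<in> exponent_box (CARD('p) ^ 2)"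
  shows "K2BV_trunc f = (K2BV_monom a :: ('p::prime_card, 'd::finite) K2BV)"
proof -
  have "K2BV_trunc f = (\<Sum>m\<in>exponent_box (CARD('p) ^ 2). if m = a then K2BV_monom m else (0 :: ('p, 'd) K2BV))"
    unfolding K2BV_trunc_def by (rule sum.cong) (simp_all add: assms(1))
  also have "\<dots> = K2BV_monom a" using assms(2) by (simp add: finite_exponent_box)
  finally show ?thesis .
qed

lemma K2BV_trunc_1: "K2BV_trunc 1 = (1 :: ('p::prime_card, 'd::finite) K2BV)"
  by (subst K2BV_trunc_monom[of _ 0]) (auto simp: mcoeff_simps exponent_box_def K2BV_monom_0)

text \<open>Pairs of exponents in the box whose sum leaves it contribute zero in the quotient ring,
  so the convolution may be completed to the full product of the two finite sums.\<close>

lemma K2BV_trunc_mult: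
  "K2BV_trunc (f * g) = K2BV_trunc f * (K2BV_trunc g :: ('p::prime_card, 'd::finite) K2BV)"
proof -
  let ?B = "exponent_box (CARD('p) ^ 2) :: ('d \<Rightarrow>\<^sub>0 nat) set"
  let ?S = "\<lambda>m :: 'd \<Rightarrow>\<^sub>0 nat. {(a, b). a + b = m}"
  let ?h = "\<lambda>x. of_int (mcoeff f (fst x) * mcoeff g (snd x)) * (K2BV_monom (fst x + snd x) :: ('p, 'd) K2BV)"
  have "K2BV_trunc (f * g) = (\<Sum>m\<in>?B. \<Sum>x\<in>?S m. ?h x)"
    unfolding K2BV_trunc_def mcoeff_mult of_int_sum sum_distrib_right
    by (intro sum.cong refl) auto
  also have "\<dots> = (\<Sum>x\<in>(\<Union>m\<in>?B. ?S m). ?h x)"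
    by (rule sum.UNION_disjoint[symmetric]) (auto simp: finite_exponent_box finite_monomial_splits)
  also have "\<dots> = (\<Sum>x\<in>?B \<times> ?B. ?h x)"
  proof (rule sum.mono_neutral_left)
    show "\<forall>x\<in>?B \<times> ?B - (\<Union>m\<in>?B. ?S m). ?h x = 0"
      by (auto simp: K2BV_monom_not_exponent_box)
  qed (auto simp: finite_exponent_box dest: exponent_box_add)
  also have "\<dots> = K2BV_trunc f * K2BV_trunc g"
    unfolding K2BV_trunc_def sum_product sum.cartesian_product case_prod_unfold
    by (rule sum.cong[OF refl]) (simp only: of_int_mult K2BV_monom_add mult_ac)
  finally show ?thesis .
qed

lemma K2BV_trunc_var: "K2BV_trunc (mfps_var i) = (K2BV_var i :: ('p::prime_card, 'd::finite) K2BV)"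
proof -
  have "CARD('p) ^ 2 > 1" by (rule one_less_power[OF prime_gt_1_nat[OF prime_card]]) simp
  hence "Poly_Mapping.single i 1 \<in> exponent_box (CARD('p) ^ 2)" by (auto simp: exponent_box_def lookup_single when_def)
  thus ?thesis
    by (subst K2BV_trunc_monom[of _ "Poly_Mapping.single i 1"])
      (simp_all only: mcoeff_simps K2BV_monom_single)
qed

lemma K2BV_trunc_of_int: "K2BV_trunc (of_int k) = of_int k"
  by (rule ring_hom_of_int) (simp_all add: K2BV_trunc_add K2BV_trunc_1)

lemma K2BV_trunc_power: "K2BV_trunc (f ^ k) = K2BV_trunc f ^ k"
  by (induction k) (simp_all add: K2BV_trunc_1 K2BV_trunc_mult)

section \<open>The images of the generators\<close>

definition total_degree :: "('d::finite \<Rightarrow>\<^sub>0 nat) \<Rightarrow> nat" where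
  "total_degree m = (\<Sum>i\<in>UNIV. Poly_Mapping.lookup m i)"

lemma total_degree_add: "total_degree (a + b) = total_degree a + total_degree b"
  by (simp add: total_degree_def lookup_add sum.distrib)

lemma total_degree_single: "total_degree (Poly_Mapping.single i k) = k"
  by (simp add: total_degree_def lookup_single when_def)

lemma mcoeff_mult_monom:
  assumes "\<And>m. mcoeff f m = (if m = a then 1 else 0)" "\<And>m. mcoeff g m = (if m = b then 1 else 0)"
  shows "mcoeff (f * g) m = (if m = a + b then 1 else (0 :: 'a::comm_ring_1))"
proof -
  have "mcoeff (f * g) m = (\<Sum>z | fst z + snd z = m. if z = (a, b) then 1 else 0)"
    unfolding mcoeff_mult by (rule sum.cong) (auto simp: assms split: if_splits)
  also have "\<dots> = (if m = a + b then 1 else 0)"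
    using finite_monomial_splits[of m] by (auto simp: case_prod_unfold)
  finally show ?thesis .
qed

lemma mcoeff_var_power:
  "mcoeff (mfps_var i ^ k) m = (if m = Poly_Mapping.single i k then 1 else (0 :: 'a::comm_ring_1))"
proof (induction k arbitrary: m)
  case (Suc k)
  have "Poly_Mapping.single i (Suc k) = Poly_Mapping.single i 1 + Poly_Mapping.single i k"
    by (simp flip: single_add)
  thus ?case
    unfolding power_Suc
    by (subst mcoeff_mult_monom[of _ "Poly_Mapping.single i 1" _ "Poly_Mapping.single i k"])
      (simp_all only: Suc.IH mcoeff_simps)
qed (simp add: mcoeff_simps)

definition homogeneous :: "nat \<Rightarrow> ('d::finite, 'a::comm_ring_1) mfps \<Rightarrow> bool" where
  "homogeneous k f \<longleftrightarrow> (\<forall>m. mcoeff f m \<noteq> 0 \<longrightarrow> total_degree m = k)"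

lemma homogeneous_mult:
  assumes "homogeneous j f" "homogeneous k g"
  shows "homogeneous (j + k) (f * g)"
  unfolding homogeneous_def
proof (intro allI impI)
  fix m assume "mcoeff (f * g) m \<noteq> 0"
  then obtain z where "z \<in> {(a, b). a + b = m}" "(case z of (a, b) \<Rightarrow> mcoeff f a * mcoeff g b) \<noteq> 0"
    unfolding mcoeff_mult by (rule sum.not_neutral_contains_not_neutral)
  then obtain a b where m: "a + b = m" and "mcoeff f a * mcoeff g b \<noteq> 0" by auto
  hence "mcoeff f a \<noteq> 0" "mcoeff g b \<noteq> 0" by auto
  hence "total_degree a = j" "total_degree b = k" using assms by (auto simp: homogeneous_def)
  thus "total_degree m = j + k" by (simp add: total_degree_add flip: m)
qed

lemma homogeneous_power: "homogeneous 1 f \<Longrightarrow> homogeneous k (f ^ k)"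
proof (induction k)
  case 0
  show ?case by (simp add: homogeneous_def mcoeff_simps total_degree_def)
next
  case (Suc k)
  thus ?case using homogeneous_mult[of 1 f k "f ^ k"] by simp
qed

text \<open>The box contains the divisors of its monomials, so coefficients of a product inside the
  box depend only on coefficients inside the box. Series may be truncated before powers are
  formed.\<close>

lemma mcoeff_eq_mult:
  assumes "\<And>m. m \<in> exponent_box q \<Longrightarrow> mcoeff f m = mcoeff f' m" "\<And>m. m \<in> exponent_box q \<Longrightarrow> mcoeff g m = mcoeff g' m"
    and "m \<in> exponent_box q"
  shows "mcoeff (f * g) m = mcoeff (f' * g') m"
  unfolding mcoeff_mult
  by (rule sum.cong) (use assms in \<open>auto dest: exponent_box_add\<close>)

lemma mcoeff_eq_power:
  assumes "\<And>m. m \<in> exponent_box q \<Longrightarrow> mcoeff f m = mcoeff f' m" "m \<in> exponent_box q"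
  shows "mcoeff (f ^ k) m = mcoeff (f' ^ k) m"
  using assms(2)
proof (induction k arbitrary: m)
  case (Suc k)
  show ?case unfolding power_Suc by (rule mcoeff_eq_mult[of q]) (use assms(1) Suc in auto)
qed simp

lemma mcoeff_compose:
  "mcoeff (mfps_compose f s) m = (\<Sum>k\<le>total_degree m. fps_nth f k * mcoeff (s ^ k) m)"
  by (simp add: mfps_compose_def Abs_mfps_inverse total_degree_def)

definition mfps_of_int :: "('d::finite, int) mfps \<Rightarrow> ('d, 'a::comm_ring_1) mfps" where
  "mfps_of_int f = Abs_mfps (\<lambda>m. of_int (mcoeff f m))"

lemma mcoeff_of_int: "mcoeff (mfps_of_int f) m = of_int (mcoeff f m)"
  by (simp add: mfps_of_int_def Abs_mfps_inverse)

lemma mfps_of_int_power: "mfps_of_int (f ^ k) = (mfps_of_int f ^ k :: ('d::finite, 'a::comm_ring_1) mfps)"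
proof (induction k)
  case 0
  show ?case by (rule mfps_eqI) (simp add: mcoeff_of_int mcoeff_simps)
next
  case (Suc k)
  have "mfps_of_int (f * g) = mfps_of_int f * (mfps_of_int g :: ('d, 'a) mfps)" for f g
    by (rule mfps_eqI) (simp add: mcoeff_of_int mcoeff_mult case_prod_unfold)
  thus ?case by (simp add: Suc)
qed

text \<open>After the linear term, the logarithm of a single variable starts with its p^2-nd power,
  outside the box. All corrections in the image of a generator therefore come from the
  exponential.\<close>

lemma mcoeff_morava_log_var:
  assumes p: "p > 1" and m: "m \<in> exponent_box (p\<^sup>2)"
  shows "mcoeff (mfps_compose (morava_log p 2) (mfps_var i)) m = mcoeff (mfps_var i) m"
proof -
  have "fps_nth (morava_log p 2) k * mcoeff (mfps_var i ^ k) m =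
      (if k = 1 then mcoeff (mfps_var i) m else 0)" for k
  proof (cases "m = Poly_Mapping.single i k")
    case True
    hence "k < p\<^sup>2" using m by (auto simp: exponent_box_def lookup_single when_def dest: spec[of _ i])
    moreover have "p\<^sup>2 \<le> p ^ 4" using p by (intro power_increasing) auto
    ultimately show ?thesis
      using morava_log_coeff[OF p, of k] by (auto simp: mcoeff_var_power mcoeff_simps)
  next
    case False
    thus ?thesis by (auto simp: mcoeff_var_power mcoeff_simps)
  qed
  hence "mcoeff (mfps_compose (morava_log p 2) (mfps_var i)) m =
      (\<Sum>k\<le>total_degree m. if k = 1 then mcoeff (mfps_var i) m else 0)"
    unfolding mcoeff_compose by (intro sum.cong refl) blast
  also have "\<dots> = (if 1 \<le> total_degree m then mcoeff (mfps_var i) m else 0)" by simp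
  also have "\<dots> = mcoeff (mfps_var i) m"
    using total_degree_single[of i 1] by (auto simp: mcoeff_simps)
  finally show ?thesis .
qed

lemma rat_mod_of_int: "rat_mod (of_int k) = of_int k"
  by (simp add: rat_mod_def)

lemma K2_reduce_monom:
  "K2_reduce (Polynomial.monom (of_int k) n) = Poly_Mapping.single (int n) (of_int k)"
proof (cases "k = 0")
  case False
  have "K2_reduce (Polynomial.monom (of_int k) n) =
      (\<Sum>j\<le>n. if j = n then Poly_Mapping.single (int n) (of_int k) else 0)"
    unfolding K2_reduce_def using False
    by (intro sum.cong) (auto simp: degree_monom_eq rat_mod_of_int)
  thus ?thesis by simp
qed simp

lemma monom_mult_of_int:
  "Polynomial.monom a n * of_int k = Polynomial.monom (a * of_int k) n"
  by (simp add: of_int_monom mult_monom)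

definition K2BV_v :: "('p::prime_card, 'd::finite) K2BV" where
  "K2BV_v = K2BV_const (Poly_Mapping.single 1 1)"

text \<open>The formal linear combination of the generators with coefficients \<open>c\<close>: on
  these elements the [k]-series of F is ordinary multiplication by k, as \<open>fgl_of_int\<close>
  shows.\<close>

definition K2BV_lin :: "'p::prime_card mod_ring ^ 3 \<Rightarrow> ('p, 3) K2BV" where
  "K2BV_lin c = fgl CARD('p) K2BV_v
     (fgl CARD('p) K2BV_v (of_int (to_int_mod_ring (c $ 1)) * K2BV_var 1)
       (of_int (to_int_mod_ring (c $ 2)) * K2BV_var 2))
     (of_int (to_int_mod_ring (c $ 3)) * K2BV_var 3)"

locale small_prime =
  fixes P :: "'p::prime_card itself"
  assumes small: "CARD('p) = 3 \<or> CARD('p) = 5"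

sublocale small_prime \<subseteq> truncated_fgl "CARD('p)" "K2BV_v :: ('p, 3) K2BV"
  by unfold_locales (simp_all add: CHAR_K2BV small)

context small_prime
begin

lemma var_nilpotent: "(K2BV_var j :: ('p, 3) K2BV) ^ (CARD('p))\<^sup>2 = 0"
  by (rule K2BV_var_power)

text \<open>Only the coefficients of the exponential in degrees \<open>1\<close>, \<open>p\<^sup>2\<close> and \<open>2 p\<^sup>2 - 1\<close> matter,
  since all exponents are less than \<open>p\<^sup>2\<close>.  The multinomial coefficients of degree \<open>p\<^sup>2\<close> are
  divided by \<open>p\<close>, and the contribution of degree \<open>2 p\<^sup>2 - 1\<close> is a multiple of the
  \<open>p\<^sup>2\<close>-nd power of a linear form, hence zero.\<close>

lemma K2BV_image_eq: "K2BV_image A j = K2BV_lin (column j (A :: 'p mod_ring ^ 3 ^ 3))"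
proof -
  define p where "p = CARD('p)"
  define q where "q = p\<^sup>2"
  define c where "c i = to_int_mod_ring (A $ i $ j)" for i
  define a b d where "a = of_int (c 1) * (mfps_var 1 :: (3, int) mfps)"
    and "b = of_int (c 2) * (mfps_var 2 :: (3, int) mfps)"
    and "d = of_int (c 3) * (mfps_var 3 :: (3, int) mfps)"
  define s where "s = a + b + d"
  define L :: "(3, rat poly) mfps"
    where "L = (\<Sum>i\<in>UNIV. of_int (c i) * mfps_compose (morava_log p 2) (mfps_var i))"
  have p1: "p > 1" and p0: "p > 0" using small by (auto simp: p_def)
  have q4: "q \<ge> 4" using small by (auto simp: q_def p_def)
  have prime: "prime p" using prime_p by (simp add: p_def)
  \<comment> \<open>Three exponents of at most q - 1 stay in the range of
    \<open>morava_exp_coeff\<close>.\<close>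
  have box_deg: "total_degree m < 3 * q - 2" if "m \<in> exponent_box q" for m :: "3 \<Rightarrow>\<^sub>0 nat"
  proof -
    have "Poly_Mapping.lookup m i < q" for i using that by (simp add: exponent_box_def)
    from this[of 1] this[of 2] this[of 3] show ?thesis
      unfolding total_degree_def sum_3 using q4 by linarith
  qed
  have L: "mcoeff L m = mcoeff (mfps_of_int s) m" if "m \<in> exponent_box q" for m
  proof -
    have log: "mcoeff (mfps_compose (morava_log p 2) (mfps_var i)) m = mcoeff (mfps_var i) m" for i
      using that by (intro mcoeff_morava_log_var[OF p1]) (simp only: q_def)
    have var: "mcoeff (mfps_var i) m = (of_int (mcoeff (mfps_var i) m) :: rat poly)" for i
      by (simp only: mcoeff_simps if_distrib[of of_int] of_int_0 of_int_1)
    show ?thesis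
      unfolding L_def sum_3 s_def a_def b_def d_def mcoeff_of_int mcoeff_simps(1) mcoeff_of_int_mult log
      unfolding var by simp
  qed
  have hom_s: "homogeneous 1 s"
    unfolding homogeneous_def s_def a_def b_def d_def mcoeff_simps(1) mcoeff_of_int_mult mcoeff_simps(5)
    by (intro allI impI) (simp add: total_degree_single split: if_split_asm)
  have coeff: "mcoeff (mfps_compose (morava_exp p 2) L) m =
      fps_nth (morava_exp p 2) (total_degree m) * of_int (mcoeff (s ^ total_degree m) m)"
    if m: "m \<in> exponent_box q" for m
  proof -
    have "mcoeff (L ^ k) m = of_int (mcoeff (s ^ k) m)" for k
      using mcoeff_eq_power[OF L m, of k] by (simp flip: mfps_of_int_power add: mcoeff_of_int)
    moreover have "mcoeff (s ^ k) m = 0" if "k \<noteq> total_degree m" for k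
      using homogeneous_power[OF hom_s, of k] that by (auto simp: homogeneous_def)
    ultimately have "fps_nth (morava_exp p 2) k * mcoeff (L ^ k) m =
      (if k = total_degree m then fps_nth (morava_exp p 2) k * of_int (mcoeff (s ^ k) m) else 0)" for k
      by simp
    thus ?thesis unfolding mcoeff_compose by simp
  qed
  define R where "R = fgl_cocycle p a b + fgl_cocycle p (a + b) d"
  define \<sigma> where "\<sigma> = a ^ p + b ^ p + d ^ p"
  \<comment> \<open>G is (s^q - a^q - b^q - d^q) / p, computed over the integers by expanding the
    p-th power twice. The summand with the extra factor p vanishes upon reduction.\<close>
  define G where "G = fgl_cocycle p (a ^ p) (b ^ p) + fgl_cocycle p (a ^ p + b ^ p) (d ^ p) +
    of_nat p * (of_nat p ^ (p - 2) * R ^ p + R * fgl_cocycle_quot p (of_nat p * R) \<sigma>)"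
  have sp: "s ^ p = of_nat p * R + \<sigma>"
    unfolding s_def power_add_prime[OF prime] R_def \<sigma>_def by (simp add: algebra_simps)
  have "s ^ q = (of_nat p * R + \<sigma>) ^ p"
    unfolding q_def power2_eq_square power_mult sp ..
  also have "\<dots> = (of_nat p * R) ^ p + \<sigma> ^ p + of_nat p * fgl_cocycle p (of_nat p * R) \<sigma>"
    by (rule power_add_prime[OF prime])
  also have "(of_nat p * R) ^ p = of_nat p * (of_nat p * (of_nat p ^ (p - 2) * R ^ p))"
  proof -
    have "of_nat p ^ (2 + (p - 2)) = of_nat p * (of_nat p * (of_nat p ^ (p - 2) :: (3, int) mfps))"
      by (simp only: power_add power2_eq_square mult.assoc)
    moreover have "2 + (p - 2) = p" using p1 by simp
    ultimately have "of_nat p ^ p = of_nat p * (of_nat p * (of_nat p ^ (p - 2) :: (3, int) mfps))"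
      by (simp only:)
    thus ?thesis by (simp only: power_mult_distrib mult.assoc)
  qed
  also have "\<sigma> ^ p = a ^ q + b ^ q + d ^ q +
      of_nat p * (fgl_cocycle p (a ^ p) (b ^ p) + fgl_cocycle p (a ^ p + b ^ p) (d ^ p))"
    unfolding \<sigma>_def power_add_prime[OF prime] q_def power2_eq_square power_mult
    by (simp add: algebra_simps)
  finally have sq: "s ^ q = a ^ q + b ^ q + d ^ q + of_nat p * G"
    unfolding G_def fgl_cocycle_eq_mult[of p "of_nat p * R"] by (simp add: algebra_simps)
  \<comment> \<open>Inside the box the pure powers a^q, b^q, d^q are invisible, and the factor p
    left over cancels the denominator in the exponential.\<close>
  have "mcoeff (s ^ q) m = int p * mcoeff G m" if m: "m \<in> exponent_box q" for m
  proof -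
    have "mcoeff ((of_int k * mfps_var i) ^ q :: (3, int) mfps) m = 0" for k i
    proof -
      have "m \<noteq> Poly_Mapping.single i q" using m by (auto simp: exponent_box_def dest: spec[of _ i])
      moreover have "(of_int k * mfps_var i) ^ q = (of_int (k ^ q) * mfps_var i ^ q :: (3, int) mfps)"
        by (simp add: power_mult_distrib)
      ultimately show ?thesis by (simp only: mcoeff_of_int_mult mcoeff_var_power if_False mult_zero_right)
    qed
    thus ?thesis
      using mcoeff_of_int_mult[of "int p" G m]
      unfolding sq by (simp add: mcoeff_simps a_def b_def d_def)
  qed
  note G = this
  have hom_G: "mcoeff G m = 0" if "m \<in> exponent_box q" "total_degree m \<noteq> q" for m
  proof -
    have "mcoeff (s ^ q) m = 0"
      using homogeneous_power[OF hom_s, of q] that(2) by (auto simp: homogeneous_def)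
    thus ?thesis using G[OF that(1)] p0 by simp
  qed
  have hom_k: "mcoeff (s ^ k) m = 0" if "total_degree m \<noteq> k" for k m
    using homogeneous_power[OF hom_s, of k] that by (auto simp: homogeneous_def)
  let ?v = "Poly_Mapping.single 1 1 :: 'p K2"
  \<comment> \<open>Inside the box s, G and s^(2q-1) live in the distinct total degrees 1, q and 2 q
    - 1, so at most one of the three summands is nonzero.\<close>
  have reduce: "K2_reduce (mcoeff (mfps_compose (morava_exp p 2) L) m) =
      of_int (mcoeff s m) - ?v * of_int (mcoeff G m) + ?v ^ 2 * of_int (mcoeff (s ^ (2 * q - 1)) m)"
    if m: "m \<in> exponent_box q" for m
  proof -
    have red: "K2_reduce (Polynomial.monom (of_int k) n) =
        Poly_Mapping.single (int n) 1 * (of_int k :: 'p K2)" for k n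
      unfolding K2_reduce_monom by (simp only: mult_single single_of_int[symmetric] add_0_right mult_1_left)
    have v2: "?v ^ 2 = Poly_Mapping.single (int 2) 1" by (simp add: power2_eq_square mult_single)
    have e_1: "fps_nth (morava_exp p 2) 1 = 1"
      using morava_exp_coeff[OF p1, of 1] q4 by (simp flip: q_def)
    have e_q: "fps_nth (morava_exp p 2) q = - Polynomial.monom (1 / of_nat p) 1"
      using morava_exp_coeff[OF p1, of q] q4 by (simp flip: q_def)
    have "2 * q - 1 \<noteq> 1" "2 * q - 1 \<noteq> q" "2 * q - 1 < 3 * q - 2" using q4 by auto
    hence e_top: "fps_nth (morava_exp p 2) (2 * q - 1) = Polynomial.monom 1 2"
      using morava_exp_coeff[OF p1, of "2 * q - 1"] unfolding q_def[symmetric] by (simp only: if_False if_True refl)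
    have s1: "mcoeff s m = 0" if "total_degree m \<noteq> 1"
      using hom_k[of m 1] that by simp
    consider "total_degree m = 1" | "total_degree m = q" | "total_degree m = 2 * q - 1" |
      "total_degree m \<notin> {1, q, 2 * q - 1}" by blast
    thus ?thesis
    proof cases
      case 1
      have "mcoeff (mfps_compose (morava_exp p 2) L) m = Polynomial.monom (of_int (mcoeff s m)) 0"
        unfolding coeff[OF m] 1 e_1 by (simp add: of_int_monom)
      hence "K2_reduce (mcoeff (mfps_compose (morava_exp p 2) L) m) = (of_int (mcoeff s m) :: 'p K2)"
        by (simp add: red)
      moreover have "mcoeff G m = 0" using hom_G[OF m] 1 q4 by simp
      moreover have "mcoeff (s ^ (2 * q - 1)) m = 0" using hom_k[of m "2 * q - 1"] 1 q4 by simp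
      ultimately show ?thesis by simp
    next
      case 2
      have "mcoeff (mfps_compose (morava_exp p 2) L) m = Polynomial.monom (of_int (- mcoeff G m)) 1"
        unfolding coeff[OF m] 2 e_q G[OF m] mult_minus_left monom_mult_of_int using p0
        by (simp add: minus_monom)
      hence "K2_reduce (mcoeff (mfps_compose (morava_exp p 2) L) m) = ?v * (of_int (- mcoeff G m) :: 'p K2)"
        by (simp only: red of_nat_1)
      moreover have "mcoeff s m = 0" using s1 2 q4 by simp
      moreover have "mcoeff (s ^ (2 * q - 1)) m = 0" using hom_k[of m "2 * q - 1"] 2 q4 by simp
      ultimately show ?thesis by simp
    next
      case 3
      have "mcoeff (mfps_compose (morava_exp p 2) L) m =
          Polynomial.monom (of_int (mcoeff (s ^ (2 * q - 1)) m)) 2"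
        unfolding coeff[OF m] 3 e_top monom_mult_of_int by (simp only: mult_1_left)
      hence "K2_reduce (mcoeff (mfps_compose (morava_exp p 2) L) m) =
          ?v ^ 2 * (of_int (mcoeff (s ^ (2 * q - 1)) m) :: 'p K2)"
        by (simp only: red v2)
      moreover have "mcoeff s m = 0" using s1 3 q4 by simp
      moreover have "mcoeff G m = 0" using hom_G[OF m] 3 q4 by simp
      ultimately show ?thesis by simp
    next
      case 4
      have "fps_nth (morava_exp p 2) (total_degree m) = 0"
        using morava_exp_coeff[OF p1, of "total_degree m"] box_deg[OF m] 4 by (simp flip: q_def)
      hence "K2_reduce (mcoeff (mfps_compose (morava_exp p 2) L) m) = (0 :: 'p K2)"
        unfolding coeff[OF m] by (simp only: mult_zero_left K2_reduce_0)
      moreover have "mcoeff s m = 0" using s1 4 by simp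
      moreover have "mcoeff G m = 0" using hom_G[OF m] 4 by simp
      moreover have "mcoeff (s ^ (2 * q - 1)) m = 0" using hom_k[of m "2 * q - 1"] 4 by simp
      ultimately show ?thesis by simp
    qed
  qed
  let ?T = "K2BV_trunc :: _ \<Rightarrow> ('p, 3) K2BV"
  have "K2BV_image A j = K2BV_of_series (mfps_compose (morava_exp p 2) L)"
    unfolding K2BV_image_def L_def p_def c_def ..
  also have "\<dots> = (\<Sum>m\<in>exponent_box q. K2BV_const (K2_reduce (mcoeff (mfps_compose (morava_exp p 2) L) m)) * K2BV_monom m)"
    unfolding K2BV_of_series_def K2BV_class_sum K2BV_class_single exponent_box_def q_def p_def ..
  also have "\<dots> = (\<Sum>m\<in>exponent_box q. (of_int (mcoeff s m) - K2BV_v * of_int (mcoeff G m) +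
      K2BV_v ^ 2 * of_int (mcoeff (s ^ (2 * q - 1)) m)) * K2BV_monom m)"
  proof (rule sum.cong[OF refl])
    fix m :: "3 \<Rightarrow>\<^sub>0 nat" assume m: "m \<in> exponent_box q"
    have "K2BV_const (x - y) = K2BV_const x - (K2BV_const y :: ('p, 3) K2BV)" for x y
      using K2BV_const_hom(1)[of "x - y" y, where 'd = 3] by (simp add: algebra_simps)
    thus "K2BV_const (K2_reduce (mcoeff (mfps_compose (morava_exp p 2) L) m)) * K2BV_monom m =
        (of_int (mcoeff s m) - K2BV_v * of_int (mcoeff G m) +
          K2BV_v ^ 2 * of_int (mcoeff (s ^ (2 * q - 1)) m)) * (K2BV_monom m :: ('p, 3) K2BV)"
      unfolding reduce[OF m] by (simp add: K2BV_const_hom K2BV_const_of_int K2BV_v_def power2_eq_square)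
  qed
  also have "\<dots> = ?T s - K2BV_v * ?T G + K2BV_v ^ 2 * ?T (s ^ (2 * q - 1))"
    unfolding K2BV_trunc_def p_def[symmetric] q_def[symmetric]
    by (simp only: left_diff_distrib distrib_right sum.distrib sum_subtractf mult.assoc sum_distrib_left)
  also have "?T (s ^ (2 * q - 1)) = 0"
  proof -
    have "?T a ^ q = 0" "?T b ^ q = 0" "?T d ^ q = 0"
      using mult_nilpotent[OF var_nilpotent]
      by (simp_all add: a_def b_def d_def K2BV_trunc_mult K2BV_trunc_of_int K2BV_trunc_var q_def p_def)
    hence "?T s ^ q = 0"
      unfolding s_def K2BV_trunc_add
      by (simp add: q_def p_def power2_eq_square power_mult frobenius_add)
    moreover have "2 * q - 1 = q + (q - 1)" using q4 by simp
    ultimately show ?thesis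
      unfolding \<open>2 * q - 1 = q + (q - 1)\<close> power_add K2BV_trunc_mult K2BV_trunc_power by simp
  qed
  also have "?T G = fgl_cocycle p (?T a ^ p) (?T b ^ p) + fgl_cocycle p (?T a ^ p + ?T b ^ p) (?T d ^ p)"
  proof -
    have char: "?T (of_nat p * f) = 0" for f
    proof -
      have "?T (of_int (int p)) = of_int (int p)" by (rule K2BV_trunc_of_int)
      hence "?T (of_nat p) = 0" using of_nat_p by (simp add: p_def)
      thus ?thesis by (simp add: K2BV_trunc_mult)
    qed
    thus ?thesis
      unfolding G_def K2BV_trunc_add char
      by (simp add: ring_hom_fgl_cocycle[of ?T] K2BV_trunc_add K2BV_trunc_mult K2BV_trunc_1 K2BV_trunc_power)
  qed
  also have "?T s - K2BV_v * (fgl_cocycle p (?T a ^ p) (?T b ^ p) +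
      fgl_cocycle p (?T a ^ p + ?T b ^ p) (?T d ^ p)) + K2BV_v ^ 2 * 0 =
      fgl p K2BV_v (fgl p K2BV_v (?T a) (?T b)) (?T d)"
    unfolding p_def
    by (subst fgl_fgl)
      (simp_all add: a_def b_def d_def s_def K2BV_trunc_add K2BV_trunc_mult K2BV_trunc_of_int K2BV_trunc_var mult_nilpotent var_nilpotent)
  also have "\<dots> = K2BV_lin (column j A)"
    by (simp add: K2BV_lin_def a_def b_def d_def K2BV_trunc_mult K2BV_trunc_of_int K2BV_trunc_var
        p_def c_def column_def)
  finally show ?thesis .
qed

end

section \<open>Functoriality of the action\<close>

lemma of_int_mod_card:
  assumes "of_nat CARD('p) = (0 :: 'a::comm_ring_1)"
  shows "of_int (k mod int CARD('p)) = (of_int k :: 'a)"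
proof -
  have "(of_int k :: 'a) = of_int (k mod int CARD('p) + int CARD('p) * (k div int CARD('p)))"
    by (simp only: mod_mult_div_eq)
  also have "\<dots> = of_int (k mod int CARD('p)) + of_nat CARD('p) * of_int (k div int CARD('p))"
    by (simp only: of_int_add of_int_mult of_int_of_nat_eq)
  finally show ?thesis by (simp only: assms mult_zero_left add_0_right)
qed

lemma of_int_to_int_of_nat:
  assumes "of_nat CARD('p) = (0 :: 'a::comm_ring_1)"
  shows "of_int (to_int_mod_ring (of_nat n :: 'p::prime_card mod_ring)) = (of_nat n :: 'a)"
proof (induction n)
  case (Suc n)
  thus ?case
    by (simp only: of_nat_Suc to_int_mod_ring_add of_int_mod_card[OF assms] of_int_add
        to_int_mod_ring_hom.hom_one of_int_1)
qed simp

context small_prime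
begin

lemmas of_int_mod_p = of_int_mod_card[OF of_nat_p]

lemma of_int_to_int_add:
  "of_int (to_int_mod_ring (a + b)) =
    (of_int (to_int_mod_ring a + to_int_mod_ring (b :: 'p mod_ring)) :: ('p, 3) K2BV)"
  by (simp only: to_int_mod_ring_add of_int_mod_p)

lemma of_int_to_int_mult:
  "of_int (to_int_mod_ring (a * b)) =
    (of_int (to_int_mod_ring a) * of_int (to_int_mod_ring (b :: 'p mod_ring)) :: ('p, 3) K2BV)"
  by (simp only: to_int_mod_ring_mult of_int_mod_p of_int_mult)

lemma term_nilpotent: "(of_int k * K2BV_var j :: ('p, 3) K2BV) ^ (CARD('p))\<^sup>2 = 0"
  by (rule mult_nilpotent[OF var_nilpotent])

text \<open>For multiples of one generator the formal sum is the ordinary sum, and two applications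
  of the interchange law regroup the three coordinates.\<close>

lemma K2BV_lin_add:
  "K2BV_lin (c + d) = fgl CARD('p) K2BV_v (K2BV_lin c) (K2BV_lin d :: ('p, 3) K2BV)"
proof -
  let ?a = "\<lambda>i. of_int (to_int_mod_ring (c $ i)) * K2BV_var i :: ('p, 3) K2BV"
  let ?b = "\<lambda>i. of_int (to_int_mod_ring (d $ i)) * K2BV_var i :: ('p, 3) K2BV"
  let ?F = "fgl CARD('p) (K2BV_v :: ('p, 3) K2BV)"
  have "of_int (to_int_mod_ring ((c + d) $ i)) * K2BV_var i = ?F (?a i) (?b i)" for i
    unfolding fgl_of_int[OF var_nilpotent] by (simp only: of_int_to_int_add vector_add_component)
  hence "K2BV_lin (c + d) = ?F (?F (?F (?a 1) (?b 1)) (?F (?a 2) (?b 2))) (?F (?a 3) (?b 3))"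
    by (simp only: K2BV_lin_def)
  also have "\<dots> = ?F (?F (?F (?a 1) (?a 2)) (?F (?b 1) (?b 2))) (?F (?a 3) (?b 3))"
    unfolding fgl_interchange[OF term_nilpotent term_nilpotent term_nilpotent term_nilpotent] ..
  also have "\<dots> = ?F (?F (?F (?a 1) (?a 2)) (?a 3)) (?F (?F (?b 1) (?b 2)) (?b 3))"
    by (rule fgl_interchange) (intro fgl_nilpotent term_nilpotent)+
  also have "\<dots> = ?F (K2BV_lin c) (K2BV_lin d)" by (simp only: K2BV_lin_def)
  finally show ?thesis .
qed

lemma K2BV_lin_scale:
  "K2BV_lin (k *s c) = of_int (to_int_mod_ring k) * (K2BV_lin c :: ('p, 3) K2BV)"
  unfolding K2BV_lin_def of_int_fgl vector_smult_component of_int_to_int_mult mult.assoc ..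

lemma K2BV_lin_axis: "K2BV_lin (axis j 1) = (K2BV_var j :: ('p, 3) K2BV)"
  using exhaust_3[of j] unfolding K2BV_lin_def by (elim disjE) (simp_all add: axis_def)

lemma K2BV_lin_0: "K2BV_lin 0 = (0 :: ('p, 3) K2BV)"
  by (simp add: K2BV_lin_def)

lemma K2BV_act_of_int: "K2BV_act A (of_int k) = of_int k"
  by (rule ring_hom_of_int) (simp_all add: K2BV_act_algebra_hom)

lemma K2BV_act_v: "K2BV_act A K2BV_v = K2BV_v"
  using K2BV_act_algebra_hom(4)[of A "Poly_Mapping.single 1 1" 1]
  by (simp add: K2BV_v_def K2BV_scale_eq_mult K2BV_act_algebra_hom(3))

lemma K2BV_act_fgl:
  "K2BV_act A (fgl p K2BV_v x y) = fgl p K2BV_v (K2BV_act A x) (K2BV_act A y)"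
  by (subst ring_hom_fgl[of "K2BV_act A"]) (simp_all add: K2BV_act_algebra_hom K2BV_act_v)

text \<open>Algebra endomorphisms fixing v commute with F and with integer multiples, so a formal
  linear combination of generators goes to the same combination of the columns of
  \<open>A\<close>.\<close>

lemma K2BV_act_lin: "K2BV_act A (K2BV_lin c) = (K2BV_lin (A *v c) :: ('p, 3) K2BV)"
proof -
  have "K2BV_act A (of_int (to_int_mod_ring k) * K2BV_var j) = K2BV_lin (k *s column j A)" for k j
    by (simp only: K2BV_act_algebra_hom(2) K2BV_act_of_int K2BV_act_var K2BV_image_eq K2BV_lin_scale)
  hence "K2BV_act A (K2BV_lin c) =
      K2BV_lin (c $ 1 *s column 1 A + c $ 2 *s column 2 A + c $ 3 *s column 3 A)"
    unfolding K2BV_lin_add by (simp only: K2BV_lin_def[of c] K2BV_act_fgl)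
  also have "c $ 1 *s column 1 A + c $ 2 *s column 2 A + c $ 3 *s column 3 A = A *v c"
    by (simp add: matrix_mult_sum sum_3)
  finally show ?thesis .
qed

end

lemma K2BV_hom_class:
  fixes f :: "('p::prime_card, 'd::finite) K2BV \<Rightarrow> ('p, 'd) K2BV"
  assumes f: "\<And>x y. f (x + y) = f x + f y" "\<And>x y. f (x * y) = f x * f y" "f 1 = 1"
    "\<And>c x. f (K2BV_scale c x) = K2BV_scale c (f x)"
  shows "f (K2BV_class g) = K2BV_eval (\<lambda>j. f (K2BV_var j)) g"
proof -
  have f0: "f 0 = 0" using f(1)[of 0 0] by simp
  have f_sum: "f (sum h S) = (\<Sum>x\<in>S. f (h x))" for h :: "('d \<Rightarrow>\<^sub>0 nat) \<Rightarrow> _" and S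
    by (induction S rule: infinite_finite_induct) (simp_all add: f f0)
  have f_prod: "f (prod h S) = (\<Prod>x\<in>S. f (h x))" for h :: "'d \<Rightarrow> _" and S
    by (induction S rule: infinite_finite_induct) (simp_all add: f)
  have f_power: "f (x ^ k) = f x ^ k" for x k by (induction k) (simp_all add: f)
  have f_monom: "f (K2BV_monom m) = (\<Prod>j\<in>UNIV. f (K2BV_var j) ^ Poly_Mapping.lookup m j)" for m
    by (simp only: K2BV_monom_eq_prod f_prod f_power)
  have "K2BV_class g = (\<Sum>m\<in>Poly_Mapping.keys g. K2BV_scale (Poly_Mapping.lookup g m) (K2BV_monom m))"
    by (subst poly_mapping_sum_single[of g])
      (simp only: K2BV_class_sum K2BV_class_single K2BV_scale_eq_mult)
  thus ?thesis by (simp only: f_sum f(4) f_monom K2BV_eval_def)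
qed

context small_prime
begin

text \<open>Both sides are algebra endomorphisms, and on generators \<open>K2BV_act_lin\<close>
  turns composition into the matrix product. Singular matrices are included; they serve later as
  substitutions that isolate coefficients.\<close>

lemma K2BV_act_mult: "K2BV_act (A ** B) x = K2BV_act A (K2BV_act B (x :: ('p, 3) K2BV))"
proof -
  obtain g where g: "x = K2BV_class g" by (metis Quotient3_abs_rep[OF Quotient3_K2BV])
  have "K2BV_act A (K2BV_act B (K2BV_class g)) =
      K2BV_eval (\<lambda>j. K2BV_act A (K2BV_act B (K2BV_var j))) g"
    by (rule K2BV_hom_class) (simp_all add: K2BV_act_algebra_hom)
  also have "(\<lambda>j. K2BV_act A (K2BV_act B (K2BV_var j))) = K2BV_image (A ** B)"
  proof
    fix j
    have "A *v column j B = column j (A ** B)"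
      by (simp add: vec_eq_iff column_def matrix_matrix_mult_def matrix_vector_mult_def)
    thus "K2BV_act A (K2BV_act B (K2BV_var j)) = K2BV_image (A ** B) j"
      by (simp add: K2BV_act_var K2BV_image_eq K2BV_act_lin)
  qed
  finally show ?thesis by (simp add: g K2BV_act_class)
qed

lemma K2BV_act_one: "K2BV_act (mat 1) x = (x :: ('p, 3) K2BV)"
proof -
  obtain g where g: "x = K2BV_class g" by (metis Quotient3_abs_rep[OF Quotient3_K2BV])
  have "column j (mat 1) = (axis j 1 :: 'p mod_ring ^ 3)" for j
    by (auto simp: vec_eq_iff column_def mat_def axis_def)
  hence "K2BV_image (mat 1) = (K2BV_var :: 3 \<Rightarrow> ('p, 3) K2BV)"
    by (auto simp: K2BV_image_eq K2BV_lin_axis)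
  moreover have "K2BV_class g = K2BV_eval (K2BV_var :: 3 \<Rightarrow> ('p, 3) K2BV) g"
    using K2BV_hom_class[of "\<lambda>x :: ('p, 3) K2BV. x" g] by simp
  moreover have "K2BV_act (mat 1) x = K2BV_eval (K2BV_image (mat 1)) g"
    by (simp only: g K2BV_act_class)
  ultimately show ?thesis by (simp only: g)
qed

lemma K2BV_act_var_eq: "K2BV_act A (K2BV_var j) = (K2BV_lin (column j A) :: ('p, 3) K2BV)"
  by (simp add: K2BV_act_var K2BV_image_eq)

end

section \<open>Coefficients\<close>

lemma lookup_mult_single:
  fixes f :: "('d::finite \<Rightarrow>\<^sub>0 nat) \<Rightarrow>\<^sub>0 'a::comm_ring_1"
  shows "Poly_Mapping.lookup (f * Poly_Mapping.single a c) m =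
    (\<Sum>k\<in>Poly_Mapping.keys f. if k + a = m then Poly_Mapping.lookup f k * c else 0)"
proof -
  have "f * Poly_Mapping.single a c =
      (\<Sum>k\<in>Poly_Mapping.keys f. Poly_Mapping.single (k + a) (Poly_Mapping.lookup f k * c))"
    by (subst poly_mapping_sum_single[of f]) (simp only: sum_distrib_right mult_single)
  thus ?thesis by (simp add: lookup_sum lookup_single when_def)
qed

text \<open>The representative is an arbitrary choice, so the value has a meaning only for
  \<open>m\<close> in the box: every monomial of the relation ideal has an exponent of at least
  p^2.\<close>

definition K2BV_coeff :: "('d::finite \<Rightarrow>\<^sub>0 nat) \<Rightarrow> ('p::prime_card, 'd) K2BV \<Rightarrow> 'p K2" where
  "K2BV_coeff m x = Poly_Mapping.lookup (rep_K2BV x) m"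

lemma K2BV_coeff_class:
  fixes f :: "('d::finite \<Rightarrow>\<^sub>0 nat) \<Rightarrow>\<^sub>0 'p::prime_card K2"
  assumes "m \<in> exponent_box (CARD('p) ^ 2)"
  shows "K2BV_coeff m (K2BV_class f) = Poly_Mapping.lookup f m"
proof -
  have "K2BV_rel (rep_K2BV (K2BV_class f)) f"
    by (simp add: Quotient3_rep_abs[OF Quotient3_K2BV])
  then obtain c where c: "rep_K2BV (K2BV_class f) - f = (\<Sum>j\<in>UNIV. c j * pvar j ^ (CARD('p) ^ 2))"
    by (auto simp: K2BV_rel_def)
  have "k + Poly_Mapping.single j (CARD('p) ^ 2) \<noteq> m" for k and j :: 'd
    using assms by (auto simp: exponent_box_def lookup_add dest: spec[of _ j])
  hence "Poly_Mapping.lookup (rep_K2BV (K2BV_class f) - f) m = 0"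
    unfolding c by (simp add: lookup_sum pvar_power lookup_mult_single)
  thus ?thesis by (simp add: K2BV_coeff_def lookup_minus)
qed

lemma K2BV_class_cases: obtains f where "x = K2BV_class f"
  by (metis Quotient3_abs_rep[OF Quotient3_K2BV])

lemma K2BV_coeff_linear:
  fixes x y :: "('p::prime_card, 'd::finite) K2BV"
  assumes m: "m \<in> exponent_box (CARD('p) ^ 2)"
  shows K2BV_coeff_add: "K2BV_coeff m (x + y) = K2BV_coeff m x + K2BV_coeff m y"
    and K2BV_coeff_scale: "K2BV_coeff m (K2BV_scale c x) = c * K2BV_coeff m x"
proof -
  obtain f g where fg: "x = K2BV_class f" "y = K2BV_class g" by (metis K2BV_class_cases)
  show "K2BV_coeff m (x + y) = K2BV_coeff m x + K2BV_coeff m y"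
    by (simp add: fg plus_K2BV.abs_eq K2BV_coeff_class[OF m] lookup_add)
  have "Poly_Mapping.lookup (Poly_Mapping.single 0 c * f) m = c * Poly_Mapping.lookup f m"
    by (subst mult.commute) (auto simp: lookup_mult_single in_keys_iff mult.commute)
  thus "K2BV_coeff m (K2BV_scale c x) = c * K2BV_coeff m x"
    by (simp add: fg K2BV_scale_def times_K2BV.abs_eq K2BV_coeff_class[OF m])
qed

lemma K2BV_coeff_monom:
  "m \<in> exponent_box (CARD('p) ^ 2) \<Longrightarrow>
    K2BV_coeff m (K2BV_monom n :: ('p::prime_card, 'd::finite) K2BV) = (if n = m then 1 else 0)"
  by (simp add: K2BV_monom_def K2BV_coeff_class lookup_single when_def)

lemma K2BV_induct [case_names monom add]:
  fixes x :: "('p::prime_card, 'd::finite) K2BV"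
  assumes monom: "\<And>c m. Q (K2BV_scale c (K2BV_monom m))" and add: "\<And>x y. Q x \<Longrightarrow> Q y \<Longrightarrow> Q (x + y)"
  shows "Q x"
proof -
  have Q0: "Q 0" using monom[of 0 0] by (simp add: K2BV_scale_eq_mult K2BV_const_hom)
  obtain f where "x = K2BV_class f" by (rule K2BV_class_cases)
  hence "x = (\<Sum>m\<in>Poly_Mapping.keys f. K2BV_scale (Poly_Mapping.lookup f m) (K2BV_monom m))"
    by (subst (asm) poly_mapping_sum_single[of f])
      (simp only: K2BV_class_sum K2BV_class_single K2BV_scale_eq_mult)
  moreover have "Q (\<Sum>m\<in>S. K2BV_scale (Poly_Mapping.lookup f m) (K2BV_monom m))" if "finite S" for S
    using that by (induction S rule: finite_induct) (simp_all add: Q0 monom add)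
  ultimately show ?thesis by simp
qed

text \<open>The matrix acts by substituting a multiple of the single variable with index
  \<open>\<phi> j\<close> for the j-th one, without correction from F; monomials go to multiples of
  monomials. A map \<open>\<phi>\<close> that is not injective identifies variables, and zeros of
  \<open>\<kappa>\<close> eliminate them.\<close>

definition monomial_matrix :: "('d \<Rightarrow> 'd) \<Rightarrow> ('d \<Rightarrow> 'a::zero) \<Rightarrow> 'a ^ 'd ^ 'd" where
  "monomial_matrix \<phi> \<kappa> = (\<chi> i j. if i = \<phi> j then \<kappa> j else 0)"

context small_prime
begin

lemma K2BV_coeff_act_monomial_matrix:
  assumes a: "a \<in> exponent_box (CARD('p) ^ 2)"
  shows "K2BV_coeff a (K2BV_act (monomial_matrix \<phi> \<kappa>) (K2BV_scale c (K2BV_monom m)) :: ('p, 3) K2BV) =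
    c * (if (\<forall>i. Poly_Mapping.lookup a i = (\<Sum>j | \<phi> j = i. Poly_Mapping.lookup m j))
      then (\<Prod>j\<in>UNIV. of_int (to_int_mod_ring (\<kappa> j)) ^ Poly_Mapping.lookup m j) else 0)"
proof -
  let ?n = "\<Sum>j\<in>UNIV. Poly_Mapping.single (\<phi> j) (Poly_Mapping.lookup m j)"
  let ?e = "\<Prod>j\<in>UNIV. of_int (to_int_mod_ring (\<kappa> j)) ^ Poly_Mapping.lookup m j :: 'p K2"
  have act_prod: "K2BV_act A (prod h S) = (\<Prod>x\<in>S. K2BV_act A (h x :: ('p, 3) K2BV))"
    for A S and h :: "3 \<Rightarrow> _"
    by (induction S rule: infinite_finite_induct) (simp_all add: K2BV_act_algebra_hom)
  have act_power: "K2BV_act A (x ^ k) = K2BV_act A (x :: ('p, 3) K2BV) ^ k" for A x k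
    by (induction k) (simp_all add: K2BV_act_algebra_hom)
  have const_prod: "K2BV_const (prod h S) = (\<Prod>x\<in>S. K2BV_const (h x) :: ('p, 3) K2BV)"
    for S and h :: "3 \<Rightarrow> 'p K2"
    by (induction S rule: infinite_finite_induct) (simp_all add: K2BV_const_hom)
  have const_power: "K2BV_const (x ^ k) = (K2BV_const x :: ('p, 3) K2BV) ^ k" for x :: "'p K2" and k
    by (induction k) (simp_all add: K2BV_const_hom)
  have "column j (monomial_matrix \<phi> \<kappa>) = \<kappa> j *s axis (\<phi> j) 1" for j
    by (auto simp: vec_eq_iff column_def monomial_matrix_def axis_def)
  hence "K2BV_act (monomial_matrix \<phi> \<kappa>) (K2BV_var j) =
      K2BV_const (of_int (to_int_mod_ring (\<kappa> j))) * (K2BV_var (\<phi> j) :: ('p, 3) K2BV)" for j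
    by (simp only: K2BV_act_var_eq K2BV_lin_scale K2BV_lin_axis K2BV_const_of_int)
  hence "K2BV_act (monomial_matrix \<phi> \<kappa>) (K2BV_monom m) =
      K2BV_const ?e * (\<Prod>j\<in>UNIV. (K2BV_var (\<phi> j) :: ('p, 3) K2BV) ^ Poly_Mapping.lookup m j)"
    by (simp only: K2BV_monom_eq_prod[of m] act_prod act_power power_mult_distrib prod.distrib
        const_prod const_power)
  also have "\<dots> = K2BV_scale ?e (K2BV_monom ?n)"
    by (simp only: K2BV_scale_eq_mult K2BV_monom_sum K2BV_monom_single_power)
  finally have "K2BV_coeff a (K2BV_act (monomial_matrix \<phi> \<kappa>) (K2BV_scale c (K2BV_monom m)) :: ('p, 3) K2BV) =
      c * (?e * (if ?n = a then 1 else 0))"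
    by (simp only: K2BV_act_algebra_hom K2BV_coeff_scale[OF a] K2BV_coeff_monom[OF a])
  moreover have "?n = a \<longleftrightarrow> (\<forall>i. Poly_Mapping.lookup a i = (\<Sum>j | \<phi> j = i. Poly_Mapping.lookup m j))"
  proof -
    have "Poly_Mapping.lookup ?n i = (\<Sum>j | \<phi> j = i. Poly_Mapping.lookup m j)" for i
      by (simp add: lookup_sum lookup_single when_def sum.If_cases)
    thus ?thesis by (auto simp: poly_mapping_eq_iff fun_eq_iff)
  qed
  ultimately show ?thesis by simp
qed

end

section \<open>Unitriangular matrices\<close>

definition unitriangular :: "'a \<Rightarrow> 'a \<Rightarrow> 'a \<Rightarrow> 'a::comm_ring_1 ^ 3 ^ 3" where
  "unitriangular \<alpha> \<beta> \<gamma> = vector [vector [1, \<alpha>, \<gamma>], vector [0, 1, \<beta>], vector [0, 0, 1]]"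

lemma unitriangular_nth [simp]:
  "unitriangular \<alpha> \<beta> \<gamma> $ 1 $ 1 = 1" "unitriangular \<alpha> \<beta> \<gamma> $ 1 $ 2 = \<alpha>" "unitriangular \<alpha> \<beta> \<gamma> $ 1 $ 3 = \<gamma>"
  "unitriangular \<alpha> \<beta> \<gamma> $ 2 $ 1 = 0" "unitriangular \<alpha> \<beta> \<gamma> $ 2 $ 2 = 1" "unitriangular \<alpha> \<beta> \<gamma> $ 2 $ 3 = \<beta>"
  "unitriangular \<alpha> \<beta> \<gamma> $ 3 $ 1 = 0" "unitriangular \<alpha> \<beta> \<gamma> $ 3 $ 2 = 0" "unitriangular \<alpha> \<beta> \<gamma> $ 3 $ 3 = 1"
  by (simp_all add: unitriangular_def vector_3)

lemma unitriangular_mult: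
  "unitriangular \<alpha> \<beta> \<gamma> ** unitriangular \<alpha>' \<beta>' \<gamma>' =
    unitriangular (\<alpha> + \<alpha>') (\<beta> + \<beta>') (\<gamma> + \<gamma>' + \<alpha> * \<beta>')"
  by (simp add: vec_eq_iff forall_3 matrix_matrix_mult_def sum_3 add_ac)

lemma unitriangular_0: "unitriangular 0 0 0 = mat 1"
  by (simp add: vec_eq_iff forall_3 mat_def)

lemma column_unitriangular:
  "column 1 (unitriangular \<alpha> \<beta> \<gamma>) = axis 1 1"
  "column 2 (unitriangular \<alpha> \<beta> \<gamma>) = \<alpha> *s axis 1 1 + axis 2 1"
  "column 3 (unitriangular \<alpha> \<beta> \<gamma>) = \<gamma> *s axis 1 1 + \<beta> *s axis 2 1 + axis 3 1"
  by (simp_all add: vec_eq_iff forall_3 column_def axis_def)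

text \<open>A polynomial of degree at most p without constant term that vanishes on F_p is a
  multiple of t^p - t. Explicitly, the value at each nonzero t is multiplied by a number congruent
  to -1/t: modulo p the sum of t^(k-1) over these t is -1 if p - 1 divides k - 1, that is for k = 1
  and k = p, and 0 otherwise.\<close>

lemma sum_powers_vanish:
  fixes c :: "nat \<Rightarrow> 'a::comm_ring_1"
  assumes p: "p = 3 \<or> p = 5" and char: "of_nat p = (0 :: 'a)"
    and zero: "\<And>t. t < p \<Longrightarrow> (\<Sum>k=1..p. of_nat t ^ k * c k) = 0"
  shows "c 1 + c p = 0"
  using p
proof
  assume [simp]: "p = 3"
  have s: "{Suc 0..3} = {1, 2, 3}" by auto
  have "c 1 + c 2 + c 3 = 0" "2 * c 1 + 4 * c 2 + 8 * c 3 = 0"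
    using zero[of 1] zero[of 2] by (simp_all add: s add.assoc)
  hence "0 = 2 * c 1 + 4 * c 2 + 8 * c 3 - (c 1 + c 2 + c 3)" by simp
  also have "\<dots> = c 1 + c 3 + 3 * (c 2 + 2 * c 3)" by (simp add: algebra_simps)
  also have "\<dots> = c 1 + c p" using char by simp
  finally show ?thesis by (rule sym)
next
  assume [simp]: "p = 5"
  have s: "{Suc 0..5} = {1, 2, 3, 4, 5}" by auto
  have "c 1 + c 2 + c 3 + c 4 + c 5 = 0" "2 * c 1 + 4 * c 2 + 8 * c 3 + 16 * c 4 + 32 * c 5 = 0"
    "3 * c 1 + 9 * c 2 + 27 * c 3 + 81 * c 4 + 243 * c 5 = 0"
    "4 * c 1 + 16 * c 2 + 64 * c 3 + 256 * c 4 + 1024 * c 5 = 0"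
    using zero[of 1] zero[of 2] zero[of 3] zero[of 4] by (simp_all add: s add.assoc)
  \<comment> \<open>The multipliers at t = 1, 2, 3, 4 are -1, 2, -2, 1, congruent to -1/t modulo
    5.\<close>
  hence "0 = (4 * c 1 + 16 * c 2 + 64 * c 3 + 256 * c 4 + 1024 * c 5) -
      2 * (3 * c 1 + 9 * c 2 + 27 * c 3 + 81 * c 4 + 243 * c 5) +
      2 * (2 * c 1 + 4 * c 2 + 8 * c 3 + 16 * c 4 + 32 * c 5) - (c 1 + c 2 + c 3 + c 4 + c 5)"
    by simp
  also have "\<dots> = c 1 + c 5 + 5 * (c 2 + 5 * c 3 + 25 * c 4 + 120 * c 5)" by (simp add: algebra_simps)
  also have "\<dots> = c 1 + c p" using char by simp
  finally show ?thesis by (rule sym)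
qed

context small_prime
begin

section \<open>The action of unitriangular matrices\<close>

lemma of_nat_p_K2: "of_nat CARD('p) = (0 :: 'p K2)"
proof -
  have "of_nat CARD('p) = (0 :: 'p mod_ring)" by transfer simp
  thus ?thesis by (simp flip: single_of_nat)
qed

lemma act_var_1: "K2BV_act (unitriangular \<alpha> \<beta> \<gamma>) (K2BV_var 1) = (K2BV_var 1 :: ('p, 3) K2BV)"
  by (simp only: K2BV_act_var_eq column_unitriangular K2BV_lin_axis)

lemma act_var_2: "K2BV_act (unitriangular \<alpha> \<beta> \<gamma>) (K2BV_var 2) =
    fgl CARD('p) K2BV_v (of_int (to_int_mod_ring \<alpha>) * K2BV_var 1) (K2BV_var 2 :: ('p, 3) K2BV)"
  by (simp only: K2BV_act_var_eq column_unitriangular K2BV_lin_add K2BV_lin_scale K2BV_lin_axis)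

lemma act_var_3: "K2BV_act (unitriangular \<alpha> \<beta> \<gamma>) (K2BV_var 3) =
    fgl CARD('p) K2BV_v (fgl CARD('p) K2BV_v (of_int (to_int_mod_ring \<gamma>) * K2BV_var 1)
      (of_int (to_int_mod_ring \<beta>) * K2BV_var 2)) (K2BV_var 3 :: ('p, 3) K2BV)"
  by (simp only: K2BV_act_var_eq column_unitriangular K2BV_lin_add K2BV_lin_scale K2BV_lin_axis)

lemma act_power: "K2BV_act A (x ^ k) = K2BV_act A (x :: ('p, 3) K2BV) ^ k"
  by (induction k) (simp_all add: K2BV_act_algebra_hom)

lemma act_diff: "K2BV_act A (x - y) = K2BV_act A x - K2BV_act A (y :: ('p, 3) K2BV)"
  using K2BV_act_algebra_hom(1)[of A "x - y" y] by (simp add: algebra_simps)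

lemma act_0: "K2BV_act A 0 = (0 :: ('p, 3) K2BV)"
  using act_diff[of A 0 0] by simp

lemma act_uminus: "K2BV_act A (- y) = - K2BV_act A (y :: ('p, 3) K2BV)"
  using act_diff[of A 0 y] by (simp add: act_0)

lemma act_fgl_quadratic: "K2BV_act A (fgl_quadratic k K2BV_v x y) =
    fgl_quadratic k K2BV_v (K2BV_act A x) (K2BV_act A y :: ('p, 3) K2BV)"
  by (subst ring_hom_fgl_quadratic[of "K2BV_act A"]) (simp_all add: K2BV_act_algebra_hom K2BV_act_v)

lemma act_fgl_cocycle_quot: "K2BV_act A (fgl_cocycle_quot k x y) =
    fgl_cocycle_quot k (K2BV_act A x) (K2BV_act A y :: ('p, 3) K2BV)"
  by (rule ring_hom_fgl_cocycle_quot) (simp_all add: K2BV_act_algebra_hom)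

lemma act_unitriangular_funpow:
  "(K2BV_act (unitriangular \<alpha> \<beta> \<gamma>) ^^ n) x =
    K2BV_act (unitriangular (of_nat n * \<alpha>) (of_nat n * \<beta>) (of_nat n * \<gamma> + of_nat (n choose 2) * \<alpha> * \<beta>))
      (x :: ('p, 3) K2BV)"
proof (induction n)
  case 0
  show ?case by (simp add: unitriangular_0 K2BV_act_one binomial_eq_0)
next
  case (Suc n)
  have "Suc n choose 2 = n + (n choose 2)" by (simp add: numeral_2_eq_2)
  thus ?case
    by (simp add: Suc unitriangular_mult algebra_simps flip: K2BV_act_mult)
qed

text \<open>As p is odd, it divides the binomial coefficient (p choose 2) that occurs in the p-th
  power.\<close>

lemma act_unitriangular_period:
  "(K2BV_act (unitriangular \<alpha> \<beta> \<gamma>) ^^ CARD('p)) x = (x :: ('p, 3) K2BV)"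
proof -
  have p: "of_nat CARD('p) = (0 :: 'p mod_ring)" by transfer simp
  have "CARD('p) dvd (CARD('p) choose 2)"
    using small prime_p by (intro dvd_choose_prime) auto
  then obtain k where "CARD('p) choose 2 = CARD('p) * k" by (rule dvdE)
  hence "of_nat (CARD('p) choose 2) = (0 :: 'p mod_ring)" by (simp only: of_nat_mult p mult_zero_left)
  thus ?thesis by (simp only: act_unitriangular_funpow p mult_zero_left add_0_right unitriangular_0 K2BV_act_one)
qed

section \<open>Coefficients isolated by substitutions\<close>

lemma coeff_single_in_box:
  "k < (CARD('p))\<^sup>2 \<Longrightarrow> Poly_Mapping.single (i :: 3) k \<in> exponent_box ((CARD('p))\<^sup>2)"
  by (auto simp: exponent_box_def lookup_single when_def)

lemma lookup_all_single_iff: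
  "(\<forall>i. Poly_Mapping.lookup (Poly_Mapping.single a n) i = (\<Sum>j | a = i. Poly_Mapping.lookup m j)) \<longleftrightarrow>
    total_degree m = n" for m :: "3 \<Rightarrow>\<^sub>0 nat"
  by (auto simp: lookup_single when_def total_degree_def dest: spec[of _ a])

text \<open>For constant \<open>\<phi>\<close> every variable becomes a multiple of one variable, so
  the coefficient of its n-th power is the degree n part evaluated at the point
  \<open>\<kappa>\<close>.\<close>

lemma coeff_act_row:
  fixes a :: 3
  assumes "n < (CARD('p))\<^sup>2"
  shows "K2BV_coeff (Poly_Mapping.single a n)
      (K2BV_act (monomial_matrix (\<lambda>_. a) \<kappa>) (K2BV_scale c (K2BV_monom m)) :: ('p, 3) K2BV) =
    c * (if total_degree m = n
      then (\<Prod>j\<in>UNIV. of_int (to_int_mod_ring (\<kappa> j)) ^ Poly_Mapping.lookup m j) else 0)"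
  unfolding K2BV_coeff_act_monomial_matrix[OF coeff_single_in_box[OF assms]]
    lookup_all_single_iff ..

lemma prod_3: "prod f (UNIV :: 3 set) = f 1 * f 2 * f 3"
  unfolding UNIV_3 by (simp add: mult.assoc)

lemma exponent_eq_iff: "m = n \<longleftrightarrow> Poly_Mapping.lookup m 1 = Poly_Mapping.lookup n 1 \<and>
    Poly_Mapping.lookup m 2 = Poly_Mapping.lookup n 2 \<and> Poly_Mapping.lookup m 3 = Poly_Mapping.lookup n 3"
  for m n :: "3 \<Rightarrow>\<^sub>0 nat"
  by (simp add: poly_mapping_eq_iff fun_eq_iff forall_3)

lemma p_less_square: "CARD('p) < (CARD('p))\<^sup>2" "1 < CARD('p)" "1 < (CARD('p))\<^sup>2"
  using small by auto

text \<open>Eliminating x_1 and x_2 keeps the pure power of x_3. A unitriangular matrix is absorbed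
  by this projection because its last row is (0, 0, 1), which makes the coefficient an invariant
  functional.\<close>

lemma coeff_top_power:
  "K2BV_coeff (Poly_Mapping.single 3 CARD('p)) (K2BV_act (monomial_matrix (\<lambda>_. 3) (\<lambda>j. if j = 3 then 1 else 0)) x) =
    K2BV_coeff (Poly_Mapping.single 3 CARD('p)) (x :: ('p, 3) K2BV)"
proof (induction x rule: K2BV_induct)
  case (monom c m)
  show ?case
    unfolding coeff_act_row[OF p_less_square(1)]
      K2BV_coeff_scale[OF coeff_single_in_box[OF p_less_square(1)]]
      K2BV_coeff_monom[OF coeff_single_in_box[OF p_less_square(1)]]
    by (auto simp: prod_3 exponent_eq_iff total_degree_def sum_3 lookup_single power_0_left)
qed (simp add: K2BV_act_algebra_hom K2BV_coeff_add[OF coeff_single_in_box[OF p_less_square(1)]])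

text \<open>Such a row is the row (1, 0, 0) times a unitriangular matrix. The formula therefore
  tells how the coefficient of x_1 varies along an orbit.\<close>

lemma coeff_linear_row:
  "K2BV_coeff (Poly_Mapping.single 1 1)
      (K2BV_act (monomial_matrix (\<lambda>_. 1) (\<lambda>j. if j = 1 then 1 else if j = 2 then of_nat s else of_nat t)) x) =
    K2BV_coeff (Poly_Mapping.single 1 1) (x :: ('p, 3) K2BV) +
    of_nat s * K2BV_coeff (Poly_Mapping.single 2 1) x + of_nat t * K2BV_coeff (Poly_Mapping.single 3 1) x"
proof (induction x rule: K2BV_induct)
  case (monom c m)
  have box: "Poly_Mapping.single (i :: 3) 1 \<in> exponent_box ((CARD('p))\<^sup>2)" for i
    by (rule coeff_single_in_box[OF p_less_square(3)])
  have "total_degree m \<noteq> 1 \<or> m = Poly_Mapping.single 1 1 \<or> m = Poly_Mapping.single 2 1 \<or>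
      m = Poly_Mapping.single 3 1"
    by (simp add: exponent_eq_iff total_degree_def sum_3 lookup_single) arith
  then consider "total_degree m \<noteq> 1" | "m = Poly_Mapping.single 1 1" | "m = Poly_Mapping.single 2 1" |
    "m = Poly_Mapping.single 3 1" by blast
  thus ?case
    unfolding coeff_act_row[OF p_less_square(3)] K2BV_coeff_scale[OF box] K2BV_coeff_monom[OF box]
    by cases (auto simp: prod_3 exponent_eq_iff total_degree_def sum_3 lookup_single
        of_int_to_int_of_nat[OF of_nat_p_K2])
next
  case (add x y)
  thus ?case
    by (simp only: K2BV_act_algebra_hom K2BV_coeff_add[OF coeff_single_in_box[OF p_less_square(3)]]
        distrib_left add_ac)
qed

text \<open>Let c_k be the coefficient of x_2^(p-k) x_3^k. Invariance under the first matrix makes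
  the sum of the c_k t^k independent of t in F_p, so c_1 + c_p = 0 by
  \<open>sum_powers_vanish\<close>. Invariance under the second one forces c_1 = 0.\<close>

lemma invariant_coeff_zero:
  assumes a: "K2BV_act (unitriangular \<epsilon> 1 0) x = x" and b: "K2BV_act (unitriangular 0 0 1) x = (x :: ('p, 3) K2BV)"
  shows "K2BV_coeff (Poly_Mapping.single 3 CARD('p)) x = 0"
proof -
  define p where "p = CARD('p)"
  define \<mu> :: "nat \<Rightarrow> 3 \<Rightarrow>\<^sub>0 nat"
    where "\<mu> k = Poly_Mapping.single 2 (p - k) + Poly_Mapping.single 3 k" for k
  define c where "c k = K2BV_coeff (\<mu> k) x" for k
  \<comment> \<open>Substitutes 0, x_2 and t x_2 for the variables. The row (0, 1, t) times the
    first matrix is (0, 1, t + 1), for any \<open>\<epsilon>\<close>.\<close>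
  define E :: "nat \<Rightarrow> 'p mod_ring ^ 3 ^ 3" where
    "E t = monomial_matrix (\<lambda>_. 2) (\<lambda>j. if j = 1 then 0 else if j = 2 then 1 else of_nat t)" for t
  \<comment> \<open>Substitutes x_1, x_2 and t x_1, so that x_2^(p-1) x_3 contributes t c_1 to the
    coefficient of x_1 x_2^(p-1). Moreover \<open>G 0\<close> times the second matrix is
    \<open>G 1\<close>.\<close>
  define G :: "nat \<Rightarrow> 'p mod_ring ^ 3 ^ 3" where
    "G t = monomial_matrix (\<lambda>j. if j = 2 then 2 else 1) (\<lambda>j. if j = 3 then of_nat t else 1)" for t
  have p1: "p > 1" and pq: "p < p\<^sup>2" using p_less_square by (simp_all add: p_def)
  have box_\<mu>: "\<mu> k \<in> exponent_box ((CARD('p))\<^sup>2)" if "k \<le> p" for k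
    using that pq by (auto simp: \<mu>_def exponent_box_def lookup_add lookup_single when_def p_def)
  have box_p: "Poly_Mapping.single (2 :: 3) p \<in> exponent_box ((CARD('p))\<^sup>2)"
    using pq unfolding p_def by (rule coeff_single_in_box)
  define \<eta> :: "3 \<Rightarrow>\<^sub>0 nat" where "\<eta> = Poly_Mapping.single 1 1 + Poly_Mapping.single 2 (p - 1)"
  have box_\<eta>: "\<eta> \<in> exponent_box ((CARD('p))\<^sup>2)"
    using pq p1 by (auto simp: \<eta>_def exponent_box_def lookup_add lookup_single when_def p_def)
  have coeff_E: "K2BV_coeff (Poly_Mapping.single 2 p) (K2BV_act (E t) y) =
      (\<Sum>k\<le>p. of_nat t ^ k * K2BV_coeff (\<mu> k) y)" for t y
  proof (induction y rule: K2BV_induct)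
    case (monom d m)
    let ?m = "Poly_Mapping.lookup m"
    have "(\<Sum>k\<le>p. of_nat t ^ k * K2BV_coeff (\<mu> k) (K2BV_scale d (K2BV_monom m))) =
        (\<Sum>k\<le>p. if k = ?m 3 then (if ?m 1 = 0 \<and> ?m 2 + ?m 3 = p then d * of_nat t ^ ?m 3 else 0) else 0)"
    proof (rule sum.cong[OF refl])
      fix k assume "k \<in> {..p}"
      hence k: "k \<le> p" by simp
      have "m = \<mu> k \<longleftrightarrow> k = ?m 3 \<and> ?m 1 = 0 \<and> ?m 2 + ?m 3 = p"
        using k by (auto simp: exponent_eq_iff \<mu>_def lookup_add lookup_single)
      thus "of_nat t ^ k * K2BV_coeff (\<mu> k) (K2BV_scale d (K2BV_monom m)) =
          (if k = ?m 3 then (if ?m 1 = 0 \<and> ?m 2 + ?m 3 = p then d * of_nat t ^ ?m 3 else 0) else 0)"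
        unfolding K2BV_coeff_scale[OF box_\<mu>[OF k]] K2BV_coeff_monom[OF box_\<mu>[OF k]] by auto
    qed
    also have "\<dots> = (if ?m 1 = 0 \<and> ?m 2 + ?m 3 = p then d * of_nat t ^ ?m 3 else 0)" by auto
    also have "\<dots> = K2BV_coeff (Poly_Mapping.single 2 p) (K2BV_act (E t) (K2BV_scale d (K2BV_monom m)))"
      unfolding E_def coeff_act_row[OF pq[unfolded p_def], folded p_def]
      by (auto simp: prod_3 total_degree_def sum_3 of_int_to_int_of_nat[OF of_nat_p_K2] power_0_left)
    finally show ?case by (rule sym)
  next
    case (add y z)
    have "K2BV_coeff (\<mu> k) (y + z) = K2BV_coeff (\<mu> k) y + K2BV_coeff (\<mu> k) z" if "k \<le> p" for k
      by (rule K2BV_coeff_add[OF box_\<mu>[OF that]])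
    thus ?case
      by (simp add: K2BV_act_algebra_hom K2BV_coeff_add[OF box_p] add.IH distrib_left sum.distrib)
  qed
  have coeff_G: "K2BV_coeff \<eta> (K2BV_act (G t) y) = K2BV_coeff \<eta> y + of_nat t * K2BV_coeff (\<mu> 1) y" for t y
  proof (induction y rule: K2BV_induct)
    case (monom d m)
    let ?m = "Poly_Mapping.lookup m"
    have 1: "{j :: 3. (if j = 2 then 2 else 1) = (1 :: 3)} = {1, 3}"
      "{j :: 3. (if j = 2 then 2 else 1) = (2 :: 3)} = {2}" "{j :: 3. (if j = 2 then 2 else 1) = (3 :: 3)} = {}"
      using exhaust_3 by auto
    have eta: "m = \<eta> \<longleftrightarrow> ?m 1 = 1 \<and> ?m 2 = p - 1 \<and> ?m 3 = 0"
      and mu: "m = \<mu> 1 \<longleftrightarrow> ?m 1 = 0 \<and> ?m 2 = p - 1 \<and> ?m 3 = 1"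
      by (auto simp: exponent_eq_iff \<mu>_def \<eta>_def lookup_add lookup_single)
    have "(\<forall>i. Poly_Mapping.lookup \<eta> i = (\<Sum>j | (if j = 2 then 2 else 1) = i. ?m j)) \<longleftrightarrow>
        1 = ?m 1 + ?m 3 \<and> p - 1 = ?m 2"
      unfolding forall_3 1 by (simp add: \<eta>_def lookup_add lookup_single)
    also have "\<dots> \<longleftrightarrow> m = \<eta> \<or> m = \<mu> 1" unfolding eta mu by arith
    finally have cond: "(\<forall>i. Poly_Mapping.lookup \<eta> i = (\<Sum>j | (if j = 2 then 2 else 1) = i. ?m j)) \<longleftrightarrow>
        m = \<eta> \<or> m = \<mu> 1" .
    have prod: "(\<Prod>j\<in>UNIV. of_int (to_int_mod_ring (if j = 3 then of_nat t else 1 :: 'p mod_ring)) ^ ?m j) =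
        (of_nat t ^ ?m 3 :: 'p K2)"
      by (simp add: prod_3 of_int_to_int_of_nat[OF of_nat_p_K2])
    consider "m = \<eta>" "m \<noteq> \<mu> 1" "?m 3 = 0" | "m = \<mu> 1" "m \<noteq> \<eta>" "?m 3 = 1" | "m \<noteq> \<eta>" "m \<noteq> \<mu> 1"
      using eta mu by (metis zero_neq_one)
    thus ?case
      unfolding G_def K2BV_coeff_act_monomial_matrix[OF box_\<eta>] cond prod K2BV_coeff_scale[OF box_\<eta>]
        K2BV_coeff_monom[OF box_\<eta>] K2BV_coeff_scale[OF box_\<mu>[OF less_imp_le[OF p1]]]
        K2BV_coeff_monom[OF box_\<mu>[OF less_imp_le[OF p1]]]
      by cases (simp_all add: mult.commute)
  next
    case (add y z)
    thus ?case
      by (simp only: K2BV_act_algebra_hom K2BV_coeff_add[OF box_\<eta>]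
          K2BV_coeff_add[OF box_\<mu>[OF less_imp_le[OF p1]]] distrib_left add_ac)
  qed
  have "E t ** unitriangular \<epsilon> 1 0 = E (Suc t)" for t
    by (simp add: vec_eq_iff forall_3 matrix_matrix_mult_def sum_3 E_def monomial_matrix_def add.commute)
  hence "K2BV_act (E (Suc t)) x = K2BV_act (E t) x" for t
    using K2BV_act_mult[of "E t" "unitriangular \<epsilon> 1 0" x] a by simp
  hence act_E: "K2BV_act (E t) x = K2BV_act (E 0) x" for t by (induction t) simp_all
  have const: "(\<Sum>k\<le>p. of_nat t ^ k * c k) = (\<Sum>k\<le>p. of_nat 0 ^ k * c k)" for t
    unfolding c_def coeff_E[symmetric] by (simp only: act_E[of t])
  have split: "(\<Sum>k\<le>p. of_nat t ^ k * c k) = c 0 + (\<Sum>k=1..p. of_nat t ^ k * c k)" for t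
    by (simp add: atMost_atLeast0 sum.atLeast_Suc_atMost[of 0])
  have at_0: "(\<Sum>k=1..p. of_nat 0 ^ k * c k) = 0" by (intro sum.neutral) auto
  have "(\<Sum>k=1..p. of_nat t ^ k * c k) = 0" for t
    using const[of t] unfolding split at_0 by simp
  hence "c 1 + c p = 0"
    using small of_nat_p_K2 by (intro sum_powers_vanish) (auto simp: p_def)
  moreover have "c 1 = 0"
  proof -
    have "G 0 ** unitriangular 0 0 1 = G 1"
      by (simp add: vec_eq_iff forall_3 matrix_matrix_mult_def sum_3 G_def monomial_matrix_def)
    hence "K2BV_act (G 1) x = K2BV_act (G 0) x"
      using K2BV_act_mult[of "G 0" "unitriangular 0 0 1" x] b by simp
    thus ?thesis using coeff_G[of 1 x] coeff_G[of 0 x] by (simp add: c_def)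
  qed
  moreover have "\<mu> p = Poly_Mapping.single 3 CARD('p)" by (simp add: \<mu>_def p_def)
  ultimately show ?thesis by (simp add: c_def)
qed

lemma no_permuted_basis_E23:
  assumes B: "\<not> Modules.module.dependent K2BV_scale B" "Modules.module.span K2BV_scale B = UNIV"
    and bij: "bij_betw (K2BV_act (unitriangular \<epsilon> 1 0)) B B"
      "bij_betw (K2BV_act (unitriangular 0 0 1)) B (B :: ('p, 3) K2BV set)"
  shows False
proof -
  interpret K: Modules.module "K2BV_scale :: 'p K2 \<Rightarrow> ('p, 3) K2BV \<Rightarrow> _" by (rule module_K2BV)
  let ?F = "fgl CARD('p) (K2BV_v :: ('p, 3) K2BV)"
  let ?Q = "fgl_quadratic CARD('p) (K2BV_v :: ('p, 3) K2BV)"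
  let ?a = "K2BV_act (unitriangular \<epsilon> 1 0) :: ('p, 3) K2BV \<Rightarrow> _"
  let ?b = "K2BV_act (unitriangular 0 0 1) :: ('p, 3) K2BV \<Rightarrow> _"
  let ?\<theta> = "K2BV_coeff (Poly_Mapping.single 3 CARD('p)) :: ('p, 3) K2BV \<Rightarrow> 'p K2"
  let ?T = "monomial_matrix (\<lambda>_. 3) (\<lambda>j. if j = 3 then 1 else 0) :: 'p mod_ring ^ 3 ^ 3"
  note box = coeff_single_in_box[OF p_less_square(1), of 3]
  define X where "X = of_int (to_int_mod_ring \<epsilon>) * (K2BV_var 1 :: ('p, 3) K2BV)"
  define h where "h = ?Q X (K2BV_var 2)"
  \<comment> \<open>On p-th powers the action is linear: (a - 1)^2 maps x_3^p to X^p, and h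
    compensates this. For \<open>\<epsilon> = 0\<close> both X and h vanish.\<close>
  define w where "w = K2BV_var 3 ^ CARD('p) + h"
  have X: "X ^ (CARD('p))\<^sup>2 = 0" unfolding X_def by (rule term_nilpotent)
  have inv: "?\<theta> (K2BV_act (unitriangular \<alpha> \<beta> \<gamma>) x) = ?\<theta> x" for \<alpha> \<beta> \<gamma> x
  proof -
    have "?T ** unitriangular \<alpha> \<beta> \<gamma> = ?T"
      by (simp add: vec_eq_iff forall_3 matrix_matrix_mult_def sum_3 monomial_matrix_def)
    hence "K2BV_act ?T (K2BV_act (unitriangular \<alpha> \<beta> \<gamma>) x) = K2BV_act ?T x"
      using K2BV_act_mult[of ?T "unitriangular \<alpha> \<beta> \<gamma>" x] by simp
    thus ?thesis using coeff_top_power by metis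
  qed
  have "unitriangular \<epsilon> 1 0 ** unitriangular 0 0 1 = unitriangular 0 0 1 ** unitriangular \<epsilon> 1 (0 :: 'p mod_ring)"
    by (simp add: unitriangular_mult)
  hence comm: "?a (?b x) = ?b (?a x)" for x by (simp flip: K2BV_act_mult)
  have aX: "?a X = X" and bX: "?b X = X"
    unfolding X_def by (simp_all only: K2BV_act_algebra_hom K2BV_act_of_int act_var_1)
  have a2: "?a (K2BV_var 2) = ?F (K2BV_var 2) X"
    unfolding act_var_2 X_def by (rule fgl_commute)
  have "?b (K2BV_var 2) = K2BV_var 2" unfolding act_var_2 by simp
  hence bh: "?b h = h" unfolding h_def act_fgl_quadratic bX by simp
  have ah: "?a h = ?Q X (?F (K2BV_var 2) X)" unfolding h_def act_fgl_quadratic aX a2 ..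
  hence aah: "?a (?a h) = ?Q X (?F (?F (K2BV_var 2) X) X)"
    by (simp only: act_fgl_quadratic K2BV_act_fgl aX a2)
  have a3: "?a (K2BV_var 3 ^ CARD('p)) = K2BV_var 2 ^ CARD('p) + K2BV_var 3 ^ CARD('p)"
    unfolding act_power act_var_3 by (simp add: fgl_power_p var_nilpotent)
  have a2p: "?a (K2BV_var 2 ^ CARD('p)) = K2BV_var 2 ^ CARD('p) + X ^ CARD('p)"
    unfolding act_power a2 by (rule fgl_power_p[OF var_nilpotent X])
  have b3: "?b (K2BV_var 3 ^ CARD('p)) = K2BV_var 1 ^ CARD('p) + K2BV_var 3 ^ CARD('p)"
    unfolding act_power act_var_3 by (simp add: fgl_power_p var_nilpotent)
  have b1p: "?b (K2BV_var 1 ^ CARD('p)) = K2BV_var 1 ^ CARD('p)"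
    unfolding act_power act_var_1 ..
  have "?a (?a h) - 2 * ?a h + h = - (X ^ CARD('p))"
    unfolding aah unfolding ah unfolding h_def by (rule fgl_quadratic_second_difference[OF X var_nilpotent])
  hence "?a (?a h) = 2 * ?a h - h - X ^ CARD('p)" by (simp add: algebra_simps)
  hence wa: "?a (?a w) - ?a w = ?a w - w"
    unfolding w_def by (simp add: K2BV_act_algebra_hom(1) a3 a2p)
  have wb: "?b (?b w) - ?b w = ?b w - w"
    unfolding w_def by (simp add: K2BV_act_algebra_hom(1) b3 b1p bh)
  have odd: "odd CARD('p)" using small by auto
  have "?\<theta> w = 0"
    by (rule K.invariant_functional_zero[where a = ?a and b = ?b, OF B prime_p odd of_nat_p_K2
          K2BV_act_algebra_hom(1,4) K2BV_act_algebra_hom(1,4) bij comm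
          act_unitriangular_period act_unitriangular_period K2BV_coeff_add[OF box] K2BV_coeff_scale[OF box]
          inv inv invariant_coeff_zero wa wb])
  moreover have "?\<theta> w = 1"
  proof -
    \<comment> \<open>The projection kills X and x_2, so h contributes nothing to the coefficient of
      x_3^p.\<close>
    have col: "column 1 ?T = 0" "column 2 ?T = 0" "column 3 ?T = axis 3 1"
      by (auto simp: vec_eq_iff column_def monomial_matrix_def axis_def)
    have "K2BV_act ?T X = 0" "K2BV_act ?T (K2BV_var 2) = 0" "K2BV_act ?T (K2BV_var 3) = K2BV_var 3"
      unfolding X_def by (simp_all only: K2BV_act_algebra_hom K2BV_act_of_int K2BV_act_var_eq col
          K2BV_lin_0 K2BV_lin_axis mult_zero_right)
    moreover have "?Q 0 0 = 0" by (simp add: fgl_quadratic_def)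
    ultimately have "K2BV_act ?T w = K2BV_monom (Poly_Mapping.single 3 CARD('p))"
      unfolding w_def h_def
      by (simp add: K2BV_act_algebra_hom(1) act_power act_fgl_quadratic K2BV_monom_single_power)
    hence "?\<theta> (K2BV_act ?T w) = 1" by (simp add: K2BV_coeff_monom[OF box])
    thus ?thesis by (simp only: coeff_top_power)
  qed
  ultimately show False by simp
qed

text \<open>Write C' for \<open>fgl_cocycle_quot\<close>. The difference (a - 1) x_2 misses x_1 by v
  C(y_1, y_2) = x_1 P with P invariant under b. Adding (b - 1) (x_3 P) repairs this up to v C(y_1,
  y_3) P, and that error is v C'(y_1, y_3) times (a - 1) m. Since v C'(y_1, y_3) is invariant under
  a, it can be pulled inside.\<close>

lemma no_permuted_basis_E12:
  assumes B: "\<not> Modules.module.dependent K2BV_scale B" "Modules.module.span K2BV_scale B = UNIV"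
    and bij: "bij_betw (K2BV_act (unitriangular 1 0 0)) B B"
      "bij_betw (K2BV_act (unitriangular 0 0 1)) B (B :: ('p, 3) K2BV set)"
  shows False
proof -
  interpret K: Modules.module "K2BV_scale :: 'p K2 \<Rightarrow> ('p, 3) K2BV \<Rightarrow> _" by (rule module_K2BV)
  let ?v = "K2BV_v :: ('p, 3) K2BV"
  let ?F = "fgl CARD('p) ?v"
  let ?W = "fgl_cocycle CARD('p) :: ('p, 3) K2BV \<Rightarrow> _"
  let ?W' = "fgl_cocycle_quot CARD('p) :: ('p, 3) K2BV \<Rightarrow> _"
  let ?a = "K2BV_act (unitriangular 1 0 0) :: ('p, 3) K2BV \<Rightarrow> _"
  let ?b = "K2BV_act (unitriangular 0 0 1) :: ('p, 3) K2BV \<Rightarrow> _"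
  let ?\<theta> = "K2BV_coeff (Poly_Mapping.single 1 1) :: ('p, 3) K2BV \<Rightarrow> 'p K2"
  define x1 x2 x3 :: "('p, 3) K2BV" where "x1 = K2BV_var 1" and "x2 = K2BV_var 2" and "x3 = K2BV_var 3"
  define y1 y2 y3 where "y1 = x1 ^ CARD('p)" and "y2 = x2 ^ CARD('p)" and "y3 = x3 ^ CARD('p)"
  define z where "z = x1 ^ (CARD('p) - 1)"
  define h where "h = fgl_quadratic CARD('p) ?v x1 x2"
  \<comment> \<open>Division of v C(y_1, y_2) by x_1: one factor y_1 splits off from the cocycle and
    equals x_1 z.\<close>
  define P where "P = ?v * z * ?W' y1 y2"
  \<comment> \<open>Chosen such that (a - 1) m = z v C(y_1, y_2): the unwanted y_1 in (a - 1) (z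
    x_2) cancels against (a - 1)^2 h = - y_1.\<close>
  define m where "m = - (?a h - h + z * x2)"
  note box = coeff_single_in_box[OF p_less_square(3), of 1]
  have a1: "?a x1 = x1" and b1: "?b x1 = x1" unfolding x1_def by (rule act_var_1)+
  have a2: "?a x2 = ?F x2 x1" unfolding x1_def x2_def act_var_2 by (simp add: fgl_commute)
  have b2: "?b x2 = x2" unfolding x2_def act_var_2 by simp
  have a3: "?a x3 = x3" unfolding x3_def act_var_3 by simp
  have b3: "?b x3 = ?F x3 x1" unfolding x1_def x3_def act_var_3 by (simp add: fgl_commute)
  have x1z: "x1 * z = y1" using p_less_square(2) by (simp add: z_def y1_def power_eq_if)
  have az: "?a z = z" and bz: "?b z = z" unfolding z_def act_power a1 b1 by simp_all
  have W: "?W y1 y = y1 * ?W' y1 y" for y by (rule fgl_cocycle_eq_mult)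
  have F: "?F x x1 = x + x1 - ?v * ?W y1 (x ^ CARD('p))" for x
    by (simp only: fgl_def y1_def fgl_cocycle_commute)
  have bP: "?b P = P"
    unfolding P_def K2BV_act_algebra_hom K2BV_act_v bz act_fgl_cocycle_quot y1_def y2_def act_power b1 b2 ..
  have aW: "?a (?W' y1 y3) = ?W' y1 y3"
    unfolding act_fgl_cocycle_quot y1_def y3_def act_power a1 a3 ..
  have am: "?a m - m = z * (?v * ?W y1 y2)"
  proof -
    have "?a (?a h) - 2 * ?a h + h = - y1"
      unfolding h_def act_fgl_quadratic K2BV_act_fgl a1 a2 y1_def
      by (rule fgl_quadratic_second_difference) (unfold x1_def x2_def, rule var_nilpotent, rule var_nilpotent)
    hence "?a (?a h) = 2 * ?a h - h - y1" by (simp add: algebra_simps)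
    moreover have "?a (z * x2) = z * x2 + y1 - z * (?v * ?W y1 y2)"
      by (simp add: K2BV_act_algebra_hom az a2 F y2_def algebra_simps x1z[symmetric])
    ultimately show ?thesis
      by (simp add: m_def act_uminus act_diff K2BV_act_algebra_hom(1))
  qed
  have decomp: "x1 = (?a (x2 + ?v * ?W' y1 y3 * m) - (x2 + ?v * ?W' y1 y3 * m)) + (?b (x3 * P) - x3 * P)"
  proof -
    have "?a (x2 + ?v * ?W' y1 y3 * m) - (x2 + ?v * ?W' y1 y3 * m) =
        (?a x2 - x2) + ?v * ?W' y1 y3 * (?a m - m)"
      by (simp only: K2BV_act_algebra_hom K2BV_act_v aW) (simp add: algebra_simps)
    also have "\<dots> = x1 - ?v * ?W y1 y2 + ?v * ?W' y1 y3 * (z * (?v * ?W y1 y2))"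
      unfolding am a2 F y2_def by (simp add: algebra_simps)
    finally have 1: "?a (x2 + ?v * ?W' y1 y3 * m) - (x2 + ?v * ?W' y1 y3 * m) =
        x1 - ?v * ?W y1 y2 + ?v * ?W' y1 y3 * (z * (?v * ?W y1 y2))" .
    have 2: "?b (x3 * P) - x3 * P = x1 * P - ?v * ?W y1 y3 * P"
      by (simp only: K2BV_act_algebra_hom bP b3 F y3_def) (simp add: algebra_simps)
    have 3: "x1 * P = ?v * ?W y1 y2"
    proof -
      have "x1 * P = ?v * ((x1 * z) * ?W' y1 y2)" unfolding P_def by (simp only: mult_ac)
      thus ?thesis unfolding x1z W .
    qed
    have 4: "?v * ?W y1 y3 * P = ?v * ?W' y1 y3 * (z * (?v * ?W y1 y2))"
      unfolding P_def W by (simp only: mult_ac)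
    show ?thesis unfolding 1 2 3 4 by simp
  qed
  \<comment> \<open>Along an orbit the coefficient of x_1 is an arithmetic progression in i, whose
    step is a combination of the coefficients of x_2 and x_3.\<close>
  have tr: "(\<Sum>i<CARD('p). ?\<theta> ((K2BV_act (unitriangular \<alpha> 0 \<gamma>) ^^ i) x)) = 0"
    if \<alpha>\<gamma>: "\<alpha> = of_nat s" "\<gamma> = of_nat t" for \<alpha> \<gamma> x s t
  proof -
    let ?R = "\<lambda>s t. monomial_matrix (\<lambda>_. 1)
      (\<lambda>j. if j = 1 then 1 else if j = 2 then of_nat s else of_nat t) :: 'p mod_ring ^ 3 ^ 3"
    let ?c = "\<lambda>i. K2BV_coeff (Poly_Mapping.single i 1) x"
    have "?\<theta> ((K2BV_act (unitriangular \<alpha> 0 \<gamma>) ^^ i) x) =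
        ?c 1 + of_nat i * (of_nat s * ?c 2 + of_nat t * ?c 3)" for i
    proof -
      have "?R 0 0 ** unitriangular (of_nat i * \<alpha>) 0 (of_nat i * \<gamma>) = ?R (i * s) (i * t)"
        by (simp add: vec_eq_iff forall_3 matrix_matrix_mult_def sum_3 monomial_matrix_def \<alpha>\<gamma>)
      hence "K2BV_act (?R 0 0) (K2BV_act (unitriangular (of_nat i * \<alpha>) 0 (of_nat i * \<gamma>)) x) =
          K2BV_act (?R (i * s) (i * t)) x"
        using K2BV_act_mult[of "?R 0 0" "unitriangular (of_nat i * \<alpha>) 0 (of_nat i * \<gamma>)" x] by simp
      moreover have "?\<theta> (K2BV_act (?R 0 0) y) = ?\<theta> y" for y
        unfolding coeff_linear_row by simp
      ultimately have "?\<theta> (K2BV_act (unitriangular (of_nat i * \<alpha>) 0 (of_nat i * \<gamma>)) x) =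
          ?\<theta> (K2BV_act (?R (i * s) (i * t)) x)" by metis
      thus ?thesis
        unfolding act_unitriangular_funpow coeff_linear_row by (simp add: algebra_simps)
    qed
    hence "(\<Sum>i<CARD('p). ?\<theta> ((K2BV_act (unitriangular \<alpha> 0 \<gamma>) ^^ i) x)) =
        (\<Sum>i<CARD('p). ?c 1 + of_nat i * (of_nat s * ?c 2 + of_nat t * ?c 3))"
      by (intro sum.cong refl) blast
    also have "\<dots> = 0"
      using small of_nat_p_K2 by (intro sum_arith_progression_zero) (auto simp: algebra_simps)
    finally show ?thesis .
  qed
  have "unitriangular 1 0 0 ** unitriangular 0 0 1 = unitriangular 0 0 1 ** unitriangular 1 0 (0 :: 'p mod_ring)"
    by (simp add: unitriangular_mult)
  hence comm: "?a (?b x) = ?b (?a x)" for x by (simp flip: K2BV_act_mult)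
  have "?\<theta> x1 = 0"
    by (rule K.trace_functional_zero[where a = ?a and b = ?b, OF B prime_p
          K2BV_act_algebra_hom(1,4) K2BV_act_algebra_hom(1,4) bij comm
          act_unitriangular_period act_unitriangular_period K2BV_coeff_add[OF box] K2BV_coeff_scale[OF box]
          tr[of 1 1 0 0, OF of_nat_1[symmetric] of_nat_0[symmetric]]
          tr[of 0 0 1 1, OF of_nat_0[symmetric] of_nat_1[symmetric]] a1 b1 decomp])
  moreover have "?\<theta> x1 = 1"
    using K2BV_coeff_monom[OF box, of "Poly_Mapping.single 1 1"]
    by (simp only: x1_def K2BV_monom_single if_True refl)
  ultimately show False by simp
qed

end

no_notation fps_nth (infixl "$" 75)

section \<open>Subgroups of order \<open>p\<^sup>2\<close>\<close>

text \<open>Orbits other than fixed points have p-power size greater than 1, so the number of fixed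
  points is congruent to \<open>card E\<close> and thus divisible by p. It cannot be 1.\<close>

lemma p_group_second_fixed_point:
  fixes act :: "'g \<Rightarrow> 'x \<Rightarrow> 'x"
  assumes G: "Group.group G" "order G = p ^ n" and p: "prime p"
    and E: "finite E" "p dvd card E" "x0 \<in> E"
    and closed: "\<And>g x. g \<in> carrier G \<Longrightarrow> x \<in> E \<Longrightarrow> act g x \<in> E"
    and one: "\<And>x. x \<in> E \<Longrightarrow> act \<one>\<^bsub>G\<^esub> x = x"
    and mult: "\<And>g h x. g \<in> carrier G \<Longrightarrow> h \<in> carrier G \<Longrightarrow> x \<in> E \<Longrightarrow> act (g \<otimes>\<^bsub>G\<^esub> h) x = act g (act h x)"
    and fixed: "\<And>g. g \<in> carrier G \<Longrightarrow> act g x0 = x0"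
  shows "\<exists>x\<in>E. x \<noteq> x0 \<and> (\<forall>g\<in>carrier G. act g x = x)"
proof (rule ccontr)
  assume contr: "\<not> ?thesis"
  interpret G: Group.group G by (rule G(1))
  \<comment> \<open>Elements of \<open>BijGroup E\<close> are extensional functions, hence the
    restriction.\<close>
  define \<phi> where "\<phi> g = restrict (act g) E" for g
  have bij: "bij_betw (\<phi> g) E E" if g: "g \<in> carrier G" for g
  proof (rule bij_betw_byWitness[where f' = "act (inv\<^bsub>G\<^esub> g)"])
    show "\<forall>x\<in>E. act (inv\<^bsub>G\<^esub> g) (\<phi> g x) = x" "\<forall>x\<in>E. \<phi> g (act (inv\<^bsub>G\<^esub> g) x) = x"
      using g closed one by (simp_all add: \<phi>_def mult[symmetric])
  qed (use g closed in \<open>auto simp: \<phi>_def\<close>)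
  have "\<phi> \<in> hom G (BijGroup E)"
  proof (rule homI)
    show "\<phi> g \<in> carrier (BijGroup E)" if "g \<in> carrier G" for g
      using bij[OF that] by (auto simp: BijGroup_def Bij_def \<phi>_def)
    fix g h assume gh: "g \<in> carrier G" "h \<in> carrier G"
    have "\<phi> g \<in> Bij E" "\<phi> h \<in> Bij E"
      using bij gh by (auto simp: Bij_def \<phi>_def)
    moreover have "\<phi> (g \<otimes>\<^bsub>G\<^esub> h) = compose E (\<phi> g) (\<phi> h)"
      using gh closed by (auto simp: \<phi>_def compose_def mult fun_eq_iff)
    ultimately show "\<phi> (g \<otimes>\<^bsub>G\<^esub> h) = \<phi> g \<otimes>\<^bsub>BijGroup E\<^esub> \<phi> h"
      by (simp add: BijGroup_def)
  qed
  hence "group_hom G (BijGroup E) \<phi>"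
    using G(1) group_BijGroup by (simp add: group_hom_def group_hom_axioms_def)
  then interpret A: group_action G E \<phi> by (simp add: group_action_def)
  interpret P: partition E "orbits G E \<phi>" by (rule A.orbit_partition)
  have orbit0: "orbit G \<phi> x0 = {x0}"
    using E(3) fixed G.one_closed by (force simp: orbit_def \<phi>_def)
  hence mem0: "{x0} \<in> orbits G E \<phi>" using E(3) by (force simp: orbits_def)
  have dvd: "p dvd card X" if X: "X \<in> orbits G E \<phi> - {{x0}}" for X
  proof -
    obtain x where x: "x \<in> E" "X = orbit G \<phi> x" using X by (auto simp: orbits_def)
    have "card X dvd p ^ n"
      using A.orbit_stabilizer_theorem[OF x(1)] G(2) x(2) by (metis dvd_triv_left)
    then obtain k where k: "card X = p ^ k" using divides_primepow_nat[OF p] by blast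
    have "k \<noteq> 0"
    proof
      assume "k = 0"
      then obtain y where "X = {y}" using k card_1_singletonE by (metis power_0)
      moreover have "x \<in> X" using A.orbit_refl x by blast
      ultimately have "X = {x}" by blast
      hence "act g x = x" if "g \<in> carrier G" for g
        using that x by (auto simp: orbit_def \<phi>_def)
      moreover have "x \<noteq> x0" using X \<open>X = {x}\<close> by blast
      ultimately show False using contr x(1) by blast
    qed
    thus ?thesis unfolding k by (simp add: dvd_power)
  qed
  have finE: "finite (orbits G E \<phi>)" using E(1) by (simp add: orbits_def)
  have "card E = (\<Sum>X\<in>orbits G E \<phi>. card X)"
    using P.disjoint_sum[OF E(1), of "\<lambda>_. 1 :: nat"] by simp
  also have "\<dots> = 1 + (\<Sum>X\<in>orbits G E \<phi> - {{x0}}. card X)"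
    using sum.remove[OF finE mem0, of card] by simp
  finally have "card E = 1 + (\<Sum>X\<in>orbits G E \<phi> - {{x0}}. card X)" .
  moreover have "p dvd (\<Sum>X\<in>orbits G E \<phi> - {{x0}}. card X)" by (rule dvd_sum) (rule dvd)
  ultimately have "p dvd 1" using E(2) by (metis dvd_add_left_iff)
  thus False using p by simp
qed

section \<open>Conjugation into the unitriangular group\<close>

lemma mod_ring_power_card: "x ^ CARD('p) = (x :: 'p::prime_card mod_ring)"
proof -
  have "of_nat n ^ CARD('p) = (of_nat n :: 'p mod_ring)" for n
  proof (induction n)
    case 0
    show ?case by (simp add: power_0_left)
  next
    case (Suc n)
    thus ?case using power_add_prime[OF prime_card[where 'a = 'p], of 1 "of_nat n :: 'p mod_ring"] by simp
  qed
  thus ?thesis using surj_of_nat_mod_ring[of x] by blast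
qed

text \<open>Translation by \<open>r\<close> moves every point and has period p, so counting in F_p
  by \<open>sum_zero_free_orbits\<close> gives 0. This replaces computing the dimension of a
  subspace.\<close>

lemma card_dvd_translation_invariant:
  fixes E :: "('p::prime_card mod_ring ^ 'd::finite) set"
  assumes "r \<noteq> 0" "\<And>x. x \<in> E \<Longrightarrow> x + r \<in> E"
  shows "CARD('p) dvd card E"
proof -
  let ?f = "\<lambda>x. x + r"
  have iter: "(?f ^^ n) x = x + of_nat n *s r" for n x
    by (induction n) (simp_all add: vector_sadd_rdistrib add_ac)
  have "(\<Sum>x\<in>E. 1 :: 'p mod_ring) = 0"
  proof (rule sum_zero_free_orbits[OF prime_card[where 'a = 'p], of E ?f])
    show "?f x \<in> E \<and> (?f ^^ CARD('p)) x = x \<and> ?f x \<noteq> x" if "x \<in> E" for x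
      using assms that by (simp add: iter of_nat_card_eq_0)
  qed (simp_all add: of_nat_card_eq_0)
  hence "of_nat (card E) = (0 :: 'p mod_ring)" by simp
  thus ?thesis by (simp add: of_nat_eq_0_iff_char_dvd)
qed

text \<open>The second column of the matrix is the cross product of \<open>r\<close> and \<open>w\<close>.\<close>

lemma adapted_basis_exists:
  fixes u r :: "'a::field ^ 3"
  assumes "u \<noteq> 0" "r \<noteq> 0" and ru: "r $ 1 * u $ 1 + r $ 2 * u $ 2 + r $ 3 * u $ 3 = 0"
  shows "\<exists>P :: 'a ^ 3 ^ 3. invertible P \<and> P *v axis 1 1 = u \<and> transpose P *v r = axis 3 1"
proof -
  have dual: "\<exists>w :: 'a ^ 3. x $ 1 * w $ 1 + x $ 2 * w $ 2 + x $ 3 * w $ 3 = 1" if x: "x \<noteq> 0" for x :: "'a ^ 3"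
  proof -
    obtain k where "x $ k \<noteq> 0" using x by (auto simp: vec_eq_iff)
    hence "x $ 1 * axis k (1 / x $ k) $ 1 + x $ 2 * axis k (1 / x $ k) $ 2 + x $ 3 * axis k (1 / x $ k) $ 3 = 1"
      using exhaust_3[of k] by (auto simp: axis_def)
    thus ?thesis by (rule exI)
  qed
  obtain w :: "'a ^ 3" where w: "u $ 1 * w $ 1 + u $ 2 * w $ 2 + u $ 3 * w $ 3 = 1" using dual[OF assms(1)] by blast
  obtain e :: "'a ^ 3" where e: "r $ 1 * e $ 1 + r $ 2 * e $ 2 + r $ 3 * e $ 3 = 1" using dual[OF assms(2)] by blast
  define P :: "'a ^ 3 ^ 3" where "P = vector [vector [u $ 1, r $ 2 * w $ 3 - r $ 3 * w $ 2, e $ 1],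
    vector [u $ 2, r $ 3 * w $ 1 - r $ 1 * w $ 3, e $ 2], vector [u $ 3, r $ 1 * w $ 2 - r $ 2 * w $ 1, e $ 3]]"
  \<comment> \<open>The triple product expansion of (r x w) x e. Since u.w = r.e = 1 and r.u = 0,
    the determinant is 1.\<close>
  have "det P = (u $ 1 * w $ 1 + u $ 2 * w $ 2 + u $ 3 * w $ 3) * (r $ 1 * e $ 1 + r $ 2 * e $ 2 + r $ 3 * e $ 3) -
      (r $ 1 * u $ 1 + r $ 2 * u $ 2 + r $ 3 * u $ 3) * (w $ 1 * e $ 1 + w $ 2 * e $ 2 + w $ 3 * e $ 3)"
    by (simp add: det_3 P_def vector_3 algebra_simps)
  hence "invertible P" by (simp add: w e ru invertible_det_nz)
  moreover have "P *v axis 1 1 = u"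
    by (simp add: vec_eq_iff forall_3 matrix_vector_mult_def sum_3 P_def vector_3 axis_def)
  moreover have "transpose P *v r = axis 3 1"
    using ru e by (simp add: vec_eq_iff forall_3 matrix_vector_mult_def transpose_def sum_3 P_def vector_3 axis_def
        algebra_simps)
  ultimately show ?thesis by blast
qed

text \<open>A p-group fixes a nonzero vector u and, acting on the functionals that vanish on u, a
  nonzero functional r. In a basis adapted to the flag spanned by u inside ker r, the first column
  and the last row are standard. The middle diagonal entry is then multiplicative on
  \<open>H\<close>, hence 1, because an element of F_p equals its own p^n-th power.\<close>

lemma unitriangular_conjugation:
  fixes H :: "('p::prime_card mod_ring ^ 3 ^ 3) set"
  assumes H: "subgroup H GL" and card: "card H = CARD('p) ^ n"
  obtains P Q where "P ** Q = mat 1" "Q ** P = mat 1"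
    "\<And>h. h \<in> H \<Longrightarrow> \<exists>\<alpha> \<beta> \<gamma>. Q ** h ** P = unitriangular \<alpha> \<beta> \<gamma>"
proof -
  let ?G = "GL\<lparr>carrier := H\<rparr> :: ('p mod_ring ^ 3 ^ 3) monoid"
  note p = prime_card[where 'a = 'p]
  have G: "Group.group ?G" by (rule subgroup.subgroup_is_group[OF H group_GL])
  interpret G: Group.group ?G by (rule G)
  have order: "order ?G = CARD('p) ^ n" using card by (simp add: order_def)
  have simps: "carrier ?G = H" "\<one>\<^bsub>?G\<^esub> = mat 1" "g \<otimes>\<^bsub>?G\<^esub> h = g ** h" for g h
    by (simp_all add: GL_def)
  have "\<exists>x\<in>UNIV. x \<noteq> 0 \<and> (\<forall>g\<in>carrier ?G. g *v x = x)"
  proof (rule p_group_second_fixed_point[OF G order p])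
    show "CARD('p) dvd card (UNIV :: ('p mod_ring ^ 3) set)"
      by (rule card_dvd_translation_invariant[of "axis 1 1"]) (auto simp: axis_eq_0_iff)
  qed (simp_all add: GL_def matrix_vector_mul_assoc)
  then obtain u where u: "u \<noteq> 0" "\<And>h. h \<in> H \<Longrightarrow> h *v u = u" by (auto simp: simps)
  let ?d = "\<lambda>r :: 'p mod_ring ^ 3. r $ 1 * u $ 1 + r $ 2 * u $ 2 + r $ 3 * u $ 3"
  define E where "E = {r. ?d r = 0}"
  have d_adj: "?d (transpose h *v r) = ?d r" if "h \<in> H" for h r
  proof -
    have "?d (transpose h *v r) = (h *v u) $ 1 * r $ 1 + (h *v u) $ 2 * r $ 2 + (h *v u) $ 3 * r $ 3"
      by (simp add: matrix_vector_mult_def transpose_def sum_3 algebra_simps)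
    thus ?thesis using u(2)[OF that] by (simp add: mult.commute)
  qed
  \<comment> \<open>Transposition reverses products; the inverse turns it back into a left action on
    functionals.\<close>
  have "\<exists>r\<in>E. r \<noteq> 0 \<and> (\<forall>g\<in>carrier ?G. transpose (inv\<^bsub>?G\<^esub> g) *v r = r)"
  proof (rule p_group_second_fixed_point[OF G order p])
    show "CARD('p) dvd card E"
    proof -
      \<comment> \<open>A nonzero functional vanishing on u, found by hand; translation by it
        preserves \<open>E\<close>.\<close>
      define r0 :: "'p mod_ring ^ 3" where
        "r0 = (if u $ 1 = 0 \<and> u $ 2 = 0 then vector [1, 0, 0] else vector [- u $ 2, u $ 1, 0])"
      have "r0 \<noteq> 0" by (auto simp: r0_def vec_eq_iff forall_3 vector_3)
      moreover have "?d r0 = 0" by (simp add: r0_def vector_3)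
      hence "x + r0 \<in> E" if "x \<in> E" for x
        using that by (simp add: E_def algebra_simps)
      ultimately show ?thesis by (rule card_dvd_translation_invariant)
    qed
    show "transpose (inv\<^bsub>?G\<^esub> g) *v x \<in> E" if "g \<in> carrier ?G" "x \<in> E" for g x
      using that G.inv_closed[OF that(1)] d_adj by (simp add: E_def simps)
    show "transpose (inv\<^bsub>?G\<^esub> \<one>\<^bsub>?G\<^esub>) *v x = x" for x
      unfolding G.inv_one by (simp add: simps(2) transpose_mat)
    show "transpose (inv\<^bsub>?G\<^esub> (g \<otimes>\<^bsub>?G\<^esub> h)) *v x = transpose (inv\<^bsub>?G\<^esub> g) *v (transpose (inv\<^bsub>?G\<^esub> h) *v x)"
      if "g \<in> carrier ?G" "h \<in> carrier ?G" for g h x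
    proof -
      have "inv\<^bsub>?G\<^esub> (g \<otimes>\<^bsub>?G\<^esub> h) = inv\<^bsub>?G\<^esub> h \<otimes>\<^bsub>?G\<^esub> inv\<^bsub>?G\<^esub> g" by (rule G.inv_mult_group[OF that])
      also have "\<dots> = inv\<^bsub>?G\<^esub> h ** inv\<^bsub>?G\<^esub> g" by (rule simps(3))
      finally show ?thesis by (simp only: matrix_transpose_mul matrix_vector_mul_assoc)
    qed
  qed (auto simp: E_def)
  then obtain r where r: "r \<noteq> 0" "?d r = 0" and r': "\<And>g. g \<in> carrier ?G \<Longrightarrow> transpose (inv\<^bsub>?G\<^esub> g) *v r = r"
    by (auto simp: E_def)
  have r_fix: "transpose h *v r = r" if "h \<in> H" for h
    using r'[of "inv\<^bsub>?G\<^esub> h"] that G.inv_closed[of h] G.inv_inv[of h] by (simp only: simps)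
  obtain P :: "'p mod_ring ^ 3 ^ 3" where P: "invertible P" "P *v axis 1 1 = u" "transpose P *v r = axis 3 1"
    using adapted_basis_exists[OF u(1) r] by blast
  obtain Q :: "'p mod_ring ^ 3 ^ 3" where Q: "P ** Q = mat 1" "Q ** P = mat 1" using P(1) by (auto simp: invertible_def)
  have Qu: "Q *v u = axis 1 1"
    unfolding P(2)[symmetric] matrix_vector_mul_assoc Q by simp
  have Qr: "transpose Q *v axis 3 1 = r"
    unfolding P(3)[symmetric] matrix_vector_mul_assoc matrix_transpose_mul[symmetric] Q
    by (simp add: transpose_mat)
  let ?M = "\<lambda>h. Q ** h ** P"
  have col: "?M h $ i $ 1 = axis 1 1 $ i" if "h \<in> H" for h i
  proof -
    have "?M h *v axis 1 1 = axis 1 1"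
      by (simp only: matrix_vector_mul_assoc[symmetric] P u(2)[OF that] Qu)
    moreover have "(?M h *v axis 1 1) $ i = ?M h $ i $ 1"
      by (simp add: matrix_vector_mult_def axis_def if_distrib[of "\<lambda>x. _ * x"] cong: if_cong)
    ultimately show ?thesis by simp
  qed
  have row: "?M h $ 3 $ i = axis 3 1 $ i" if "h \<in> H" for h i
  proof -
    have "transpose (?M h) *v axis 3 1 = axis 3 1"
      by (simp only: matrix_transpose_mul matrix_vector_mul_assoc[symmetric] P Qr r_fix[OF that])
    moreover have "(transpose (?M h) *v axis 3 1) $ i = ?M h $ 3 $ i"
      by (simp add: matrix_vector_mult_def axis_def transpose_def if_distrib[of "\<lambda>x. _ * x"] cong: if_cong)
    ultimately show ?thesis by simp
  qed
  have M_mult: "?M (g ** h) = ?M g ** ?M h" for g h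
  proof -
    have "?M g ** ?M h = Q ** g ** (P ** Q) ** h ** P" by (simp only: matrix_mul_assoc)
    thus ?thesis by (simp only: Q matrix_mul_rid matrix_mul_assoc)
  qed
  have diag: "?M h $ 2 $ 2 = 1" if h: "h \<in> H" for h
  proof -
    have "?M (h [^]\<^bsub>?G\<^esub> k) $ 2 $ 2 = (?M h $ 2 $ 2) ^ k" for k :: nat
    proof (induction k)
      case 0
      show ?case by (simp add: simps(2) Q) (simp add: mat_def)
    next
      case (Suc k)
      have hk: "h [^]\<^bsub>?G\<^esub> k \<in> H" using G.nat_pow_closed[of h k] h by (simp only: simps)
      have "?M (h [^]\<^bsub>?G\<^esub> Suc k) = ?M (h [^]\<^bsub>?G\<^esub> k) ** ?M h"
        by (simp only: G.nat_pow_Suc simps M_mult)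
      hence "?M (h [^]\<^bsub>?G\<^esub> Suc k) $ 2 $ 2 = ?M (h [^]\<^bsub>?G\<^esub> k) $ 2 $ 1 * ?M h $ 1 $ 2 +
          ?M (h [^]\<^bsub>?G\<^esub> k) $ 2 $ 2 * ?M h $ 2 $ 2 + ?M (h [^]\<^bsub>?G\<^esub> k) $ 2 $ 3 * ?M h $ 3 $ 2"
        unfolding matrix_matrix_mult_def[of "?M (h [^]\<^bsub>?G\<^esub> k)"] by (simp only: vec_lambda_beta sum_3)
      also have "?M (h [^]\<^bsub>?G\<^esub> k) $ 2 $ 1 = 0" unfolding col[OF hk] by (simp add: axis_def)
      also have "?M h $ 3 $ 2 = 0" unfolding row[OF h] by (simp add: axis_def)
      finally show ?case using Suc by (simp add: mult.commute)
    qed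
    note pow = this[of "CARD('p) ^ n"]
    have "h [^]\<^bsub>?G\<^esub> (CARD('p) ^ n) = \<one>\<^bsub>?G\<^esub>"
      using G.pow_order_eq_1[of h] h by (simp only: order simps)
    hence "(?M h $ 2 $ 2) ^ (CARD('p) ^ n) = 1"
      using pow by (simp add: simps(2) Q) (simp add: mat_def)
    moreover have "x ^ (CARD('p) ^ n) = x" for x :: "'p mod_ring"
    proof (induction n)
      case (Suc n)
      have "x ^ CARD('p) = x" by (rule mod_ring_power_card)
      thus ?case by (simp add: power_mult Suc)
    qed simp
    ultimately show ?thesis by simp
  qed
  have "?M h = unitriangular (?M h $ 1 $ 2) (?M h $ 2 $ 3) (?M h $ 1 $ 3)" if "h \<in> H" for h
    using col[OF that] row[OF that] diag[OF that] by (simp add: vec_eq_iff forall_3 axis_def)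
  thus thesis using that[OF Q] by blast
qed

section \<open>Subgroups of order p^2 of the unitriangular group\<close>

lemma unitriangular_inject:
  "unitriangular \<alpha> \<beta> \<gamma> = unitriangular \<alpha>' \<beta>' \<gamma>' \<longleftrightarrow> \<alpha> = \<alpha>' \<and> \<beta> = \<beta>' \<and> \<gamma> = \<gamma>'"
  by (auto dest: arg_cong[of _ _ "\<lambda>A. A $ 1 $ 2"] arg_cong[of _ _ "\<lambda>A. A $ 2 $ 3"] arg_cong[of _ _ "\<lambda>A. A $ 1 $ 3"])

text \<open>A subgroup of order \<open>p\<^sup>2\<close> of the group of unitriangular matrices, which is given by the
  coordinates of its elements, contains the center: otherwise it would map onto the
  quotient by the center, and the commutator of two lifts is a nontrivial central element.\<close>

lemma unitriangular_subgroup_cases: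
  fixes S :: "('p::prime_card mod_ring \<times> 'p mod_ring \<times> 'p mod_ring) set"
  assumes card: "card S = CARD('p) ^ 2" and one: "(0, 0, 0) \<in> S"
    and mult: "\<And>\<alpha> \<beta> \<gamma> \<alpha>' \<beta>' \<gamma>'. (\<alpha>, \<beta>, \<gamma>) \<in> S \<Longrightarrow> (\<alpha>', \<beta>', \<gamma>') \<in> S \<Longrightarrow>
      (\<alpha> + \<alpha>', \<beta> + \<beta>', \<gamma> + \<gamma>' + \<alpha> * \<beta>') \<in> S"
  shows "(0, 0, 1) \<in> S \<and> ((1, 0, 0) \<in> S \<or> (\<exists>\<epsilon>. (\<epsilon>, 1, 0) \<in> S))"
proof -
  have p1: "CARD('p) > 1" by (rule prime_gt_1_nat[OF prime_card])
  have power: "(of_nat n * \<alpha>, of_nat n * \<beta>, of_nat n * \<gamma> + of_nat (n choose 2) * \<alpha> * \<beta>) \<in> S"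
    if "(\<alpha>, \<beta>, \<gamma>) \<in> S" for n \<alpha> \<beta> \<gamma>
  proof (induction n)
    case 0
    show ?case using one by (simp add: binomial_eq_0)
  next
    case (Suc n)
    have "Suc n choose 2 = n + (n choose 2)" by (simp add: numeral_2_eq_2)
    thus ?case using mult[OF that Suc] by (simp add: algebra_simps)
  qed
  have fin: "finite S" using card p1 by (metis card.infinite power_not_zero not_less_zero)
  have "\<exists>\<gamma>. \<gamma> \<noteq> 0 \<and> (0, 0, \<gamma>) \<in> S"
  proof (rule ccontr)
    assume contr: "\<not> ?thesis"
    have inj: "\<gamma> = \<gamma>'" if x: "(\<alpha>, \<beta>, \<gamma>) \<in> S" and y: "(\<alpha>, \<beta>, \<gamma>') \<in> S" for \<alpha> \<beta> \<gamma> \<gamma>'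
    proof -
      \<comment> \<open>Only closure under products is given, so the power with exponent p - 1 takes
        the place of the inverse.\<close>
      let ?n = "CARD('p) - 1"
      have n: "of_nat ?n = (- 1 :: 'p mod_ring)"
        using p1 by (simp add: of_nat_diff)
      define \<delta> where "\<delta> = of_nat ?n * \<gamma> + of_nat (?n choose 2) * \<alpha> * \<beta>"
      have z: "(- \<alpha>, - \<beta>, \<delta>) \<in> S" using power[OF x, of ?n] by (simp only: n \<delta>_def mult_minus1)
      have "(0, 0, \<delta> + \<gamma> - \<alpha> * \<beta>) \<in> S" "(0, 0, \<delta> + \<gamma>' - \<alpha> * \<beta>) \<in> S"
        using mult[OF z x] mult[OF z y] by simp_all
      hence "\<delta> + \<gamma> - \<alpha> * \<beta> = 0" "\<delta> + \<gamma>' - \<alpha> * \<beta> = 0" using contr by blast+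
      thus ?thesis by (metis add_left_cancel add_diff_eq diff_eq_eq)
    qed
    let ?\<pi> = "\<lambda>(\<alpha>, \<beta>, \<gamma>). (\<alpha>, \<beta>)"
    have "inj_on ?\<pi> S" by (rule inj_onI) (auto dest: inj)
    hence "card (?\<pi> ` S) = card (UNIV :: ('p mod_ring \<times> 'p mod_ring) set)"
      using card by (simp add: card_image power2_eq_square)
    hence "?\<pi> ` S = UNIV" by (intro card_subset_eq) auto
    hence "(1, 0) \<in> ?\<pi> ` S" "(0, 1) \<in> ?\<pi> ` S" by simp_all
    then obtain \<gamma>1 \<gamma>2 where g: "(1, 0, \<gamma>1) \<in> S" "(0, 1, \<gamma>2) \<in> S" by auto
    \<comment> \<open>The two lifts multiplied in either order: the products agree modulo the center
      and differ by 1 in it.\<close>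
    have "(1, 1, \<gamma>1 + \<gamma>2 + 1) \<in> S" "(1, 1, \<gamma>1 + \<gamma>2) \<in> S"
      using mult[OF g] mult[OF g(2,1)] by (simp_all add: add.commute)
    from inj[OF this] show False by simp
  qed
  then obtain \<gamma>0 where g0: "\<gamma>0 \<noteq> 0" "(0, 0, \<gamma>0) \<in> S" by blast
  have center: "(0, 0, c) \<in> S" for c
  proof -
    obtain n where "c / \<gamma>0 = of_nat n" using surj_of_nat_mod_ring by blast
    hence "of_nat n * \<gamma>0 = c" using g0 by (simp add: field_simps)
    thus ?thesis using power[OF g0(2), of n] by simp
  qed
  have shift: "(\<alpha>, \<beta>, 0) \<in> S" if "(\<alpha>, \<beta>, \<gamma>) \<in> S" for \<alpha> \<beta> \<gamma>
    using mult[OF that center[of "- \<gamma>"]] by simp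
  have "\<exists>\<alpha> \<beta> \<gamma>. (\<alpha>, \<beta>, \<gamma>) \<in> S \<and> (\<alpha> \<noteq> 0 \<or> \<beta> \<noteq> 0)"
  proof (rule ccontr)
    assume "\<not> ?thesis"
    hence "S \<subseteq> (\<lambda>\<gamma>. (0, 0, \<gamma>)) ` UNIV" by (auto simp: image_iff)
    hence "card S \<le> card (UNIV :: 'p mod_ring set)"
      by (metis card_image_le card_mono finite finite_imageI le_trans)
    thus False using card p1 by (simp add: power2_eq_square)
  qed
  then obtain \<alpha> \<beta> \<gamma> where s: "(\<alpha>, \<beta>, \<gamma>) \<in> S" "\<alpha> \<noteq> 0 \<or> \<beta> \<noteq> 0" by blast
  \<comment> \<open>A power of a noncentral element normalizes \<open>\<beta>\<close>, or
    \<open>\<alpha>\<close> in case \<open>\<beta> = 0\<close>, to 1; the center then removes the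
    last coordinate.\<close>
  have "(1, 0, 0) \<in> S \<or> (\<exists>\<epsilon>. (\<epsilon>, 1, 0) \<in> S)"
  proof (cases "\<beta> = 0")
    case True
    obtain n where "1 / \<alpha> = of_nat n" using surj_of_nat_mod_ring by blast
    hence "of_nat n * \<alpha> = 1" using s True by (simp add: field_simps)
    thus ?thesis using shift[OF power[OF s(1), of n]] True by simp
  next
    case False
    obtain n where "1 / \<beta> = of_nat n" using surj_of_nat_mod_ring by blast
    hence "of_nat n * \<beta> = 1" using False by (simp add: field_simps)
    thus ?thesis using shift[OF power[OF s(1), of n]] by auto
  qed
  thus ?thesis using center by blast
qed

theorem theorem1p4:
  fixes H :: "('p::prime_card mod_ring ^ 3 ^ 3) set"
  assumes "CARD('p) = 3 \<or> CARD('p) = 5"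
    and "subgroup H GL"
    and "card H = CARD('p) ^ 2"
  shows "\<not> permutation_module (K2BV_scale :: 'p K2 \<Rightarrow> ('p, 3) K2BV \<Rightarrow> ('p, 3) K2BV)
             (GL\<lparr>carrier := H\<rparr>) K2BV_act"
proof
  assume "permutation_module (K2BV_scale :: 'p K2 \<Rightarrow> ('p, 3) K2BV \<Rightarrow> ('p, 3) K2BV)
             (GL\<lparr>carrier := H\<rparr>) K2BV_act"
  then obtain B :: "('p, 3) K2BV set" where B: "\<not> Modules.module.dependent K2BV_scale B"
      "Modules.module.span K2BV_scale B = UNIV" and bij: "\<And>h. h \<in> H \<Longrightarrow> bij_betw (K2BV_act h) B B"
    unfolding permutation_module_def by auto
  interpret small_prime "TYPE('p)" by unfold_locales (rule assms(1))
  obtain P Q where PQ: "P ** Q = mat 1" "Q ** P = mat 1"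
    and tri: "\<And>h. h \<in> H \<Longrightarrow> \<exists>\<alpha> \<beta> \<gamma>. Q ** h ** P = unitriangular \<alpha> \<beta> \<gamma>"
    using unitriangular_conjugation[OF assms(2,3)] by blast
  define S where "S = {(\<alpha>, \<beta>, \<gamma>). P ** unitriangular \<alpha> \<beta> \<gamma> ** Q \<in> H}"
  have H_mult: "g ** h \<in> H" if "g \<in> H" "h \<in> H" for g h
    using subgroup.m_closed[OF assms(2) that] by (simp add: GL_def)
  have conj: "P ** (Q ** h ** P) ** Q = h" for h
  proof -
    have "P ** (Q ** h ** P) ** Q = (P ** Q) ** h ** (P ** Q)" by (simp only: matrix_mul_assoc)
    thus ?thesis by (simp add: PQ)
  qed
  have conj': "Q ** (P ** U ** Q) ** P = U" for U
  proof -
    have "Q ** (P ** U ** Q) ** P = (Q ** P) ** U ** (Q ** P)" by (simp only: matrix_mul_assoc)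
    thus ?thesis by (simp add: PQ)
  qed
  have conj_mult: "(P ** U ** Q) ** (P ** V ** Q) = P ** (U ** V) ** Q" for U V
  proof -
    have "(P ** U ** Q) ** (P ** V ** Q) = P ** U ** (Q ** P) ** V ** Q" by (simp only: matrix_mul_assoc)
    thus ?thesis by (simp add: PQ matrix_mul_assoc)
  qed
  have "bij_betw (\<lambda>(\<alpha>, \<beta>, \<gamma>). P ** unitriangular \<alpha> \<beta> \<gamma> ** Q) S H"
  proof (rule bij_betw_imageI)
    show "inj_on (\<lambda>(\<alpha>, \<beta>, \<gamma>). P ** unitriangular \<alpha> \<beta> \<gamma> ** Q) S"
    proof (rule inj_onI)
      fix x y
      assume eq: "(case x of (\<alpha>, \<beta>, \<gamma>) \<Rightarrow> P ** unitriangular \<alpha> \<beta> \<gamma> ** Q) =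
          (case y of (\<alpha>, \<beta>, \<gamma>) \<Rightarrow> P ** unitriangular \<alpha> \<beta> \<gamma> ** Q)"
      obtain \<alpha> \<beta> \<gamma> \<alpha>' \<beta>' \<gamma>' where xy: "x = (\<alpha>, \<beta>, \<gamma>)" "y = (\<alpha>', \<beta>', \<gamma>')"
        by (metis surj_pair)
      have "unitriangular \<alpha> \<beta> \<gamma> = unitriangular \<alpha>' \<beta>' \<gamma>'"
        using eq unfolding xy prod.case by (metis conj')
      thus "x = y" by (simp add: xy unitriangular_inject)
    qed
    show "(\<lambda>(\<alpha>, \<beta>, \<gamma>). P ** unitriangular \<alpha> \<beta> \<gamma> ** Q) ` S = H"
    proof (intro equalityI subsetI)
      fix h assume h: "h \<in> H"
      then obtain \<alpha> \<beta> \<gamma> where "Q ** h ** P = unitriangular \<alpha> \<beta> \<gamma>" using tri by blast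
      hence "h = P ** unitriangular \<alpha> \<beta> \<gamma> ** Q" using conj[of h] by simp
      moreover from this h have "(\<alpha>, \<beta>, \<gamma>) \<in> S" by (simp add: S_def)
      ultimately show "h \<in> (\<lambda>(\<alpha>, \<beta>, \<gamma>). P ** unitriangular \<alpha> \<beta> \<gamma> ** Q) ` S" by force
    qed (auto simp: S_def)
  qed
  hence "card S = CARD('p) ^ 2" using assms(3) by (simp add: bij_betw_same_card)
  moreover have "(0, 0, 0) \<in> S"
    using subgroup.one_closed[OF assms(2)] by (simp add: S_def unitriangular_0 PQ GL_def)
  moreover have "(\<alpha> + \<alpha>', \<beta> + \<beta>', \<gamma> + \<gamma>' + \<alpha> * \<beta>') \<in> S" if "(\<alpha>, \<beta>, \<gamma>) \<in> S" "(\<alpha>', \<beta>', \<gamma>') \<in> S"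
    for \<alpha> \<beta> \<gamma> \<alpha>' \<beta>' \<gamma>'
  proof -
    have "P ** (unitriangular \<alpha> \<beta> \<gamma> ** unitriangular \<alpha>' \<beta>' \<gamma>') ** Q \<in> H"
      using that H_mult unfolding conj_mult[symmetric] S_def by simp
    thus ?thesis by (simp only: unitriangular_mult S_def mem_Collect_eq case_prod_conv)
  qed
  ultimately have cases: "(0, 0, 1) \<in> S \<and> ((1, 0, 0) \<in> S \<or> (\<exists>\<epsilon>. (\<epsilon>, 1, 0) \<in> S))"
    by (rule unitriangular_subgroup_cases)
  interpret K: Modules.module "K2BV_scale :: 'p K2 \<Rightarrow> ('p, 3) K2BV \<Rightarrow> _" by (rule module_K2BV)
  interpret L: Modules.module_hom "K2BV_scale :: 'p K2 \<Rightarrow> ('p, 3) K2BV \<Rightarrow> _" K2BV_scale "K2BV_act Q"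
    by unfold_locales (simp_all add: K2BV_act_algebra_hom)
  have QP: "K2BV_act Q (K2BV_act P x) = x" and PQ': "K2BV_act P (K2BV_act Q x) = x" for x :: "('p, 3) K2BV"
    by (simp_all add: PQ K2BV_act_one flip: K2BV_act_mult)
  have inj: "inj (K2BV_act Q :: ('p, 3) K2BV \<Rightarrow> _)" by (metis injI PQ')
  have surj: "surj (K2BV_act Q :: ('p, 3) K2BV \<Rightarrow> _)" by (metis surjI QP)
  \<comment> \<open>Each h in \<open>H\<close> permutes \<open>B\<close>, so
    \<open>Q ** h ** P\<close> permutes the image of \<open>B\<close> under \<open>Q\<close>. This
    replaces \<open>H\<close> by its unitriangular conjugate.\<close>
  let ?B = "K2BV_act Q ` B"
  have "\<not> K.dependent ?B" using B inj by (intro L.independent_injective_image) auto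
  moreover have "K.span ?B = UNIV" using B surj by (simp add: L.span_image)
  moreover have bij_S: "bij_betw (K2BV_act (unitriangular \<alpha> \<beta> \<gamma>)) ?B ?B" if "(\<alpha>, \<beta>, \<gamma>) \<in> S" for \<alpha> \<beta> \<gamma>
  proof -
    let ?U = "unitriangular \<alpha> \<beta> \<gamma>"
    have U: "K2BV_act ?U x = K2BV_act Q (K2BV_act (P ** ?U ** Q) (K2BV_act P x))" for x :: "('p, 3) K2BV"
      by (simp only: K2BV_act_mult[symmetric] matrix_mul_assoc[symmetric] conj'[unfolded matrix_mul_assoc[symmetric]])
    have "bij_betw (K2BV_act P) ?B B"
      using PQ' by (intro bij_betw_byWitness[where f' = "K2BV_act Q"]) (auto simp: QP)
    moreover have "bij_betw (K2BV_act (P ** ?U ** Q)) B B" using bij that by (simp add: S_def)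
    moreover have "bij_betw (K2BV_act Q) B ?B" using inj by (auto simp: bij_betw_def intro: inj_on_subset)
    ultimately have "bij_betw (K2BV_act Q \<circ> (K2BV_act (P ** ?U ** Q) \<circ> K2BV_act P)) ?B ?B"
      by (blast intro: bij_betw_trans)
    thus ?thesis by (simp add: U[abs_def] comp_def)
  qed
  ultimately show False
    using cases no_permuted_basis_E23[of ?B] no_permuted_basis_E12[of ?B] by blast
qed

end
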